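(* Let $(\Omega^+,\mathcal F^+,\mathbb P,\sigma)$ be a one-sided Markovian full shift over $k$ symbols, let $\varphi$ be a strongly irreducible and spatially invertible linear random dynamical system (LRDS) on $\mathbb R^d$ determined by $\varphi(1,\omega)=M(\omega)$, and assume $M(\omega)$ depends only on the first coordinate $\omega_0$. Let $\gamma$ be the Lyapunov exponent of $\varphi$, and suppose $\mathbb E[\log^+\|M(\omega)\|]<\infty$. (1) For a sequence $(x_n)$ of vectors converging to a non-zero $x\in\mathbb R^d$, $$\gamma=\lim_{n\to\infty}\frac1n\log\|\varphi(n,\omega)x_n\|\qquad\mathbb P\text{-a.s.}$$ (2) If $\nu$ is the invariant measure for the normalized random dynamical system $\psi$ on $\mathbb RP^{d-1}$ induced by $\varphi$, then $$\gamma=\int\log\|M(\omega)\bar x\|\,\nu(d\omega,d\bar x).$$ (3) Moreover, if $\mathbb E[\log^+\|M^{-1}(\omega)\|]<\infty$, then $$\frac1n\mathbb E\big[\log\|\varphi(n,\omega)x\|\big]\to\gamma\qquad(n\to\infty)$$ uniformly on $\{x\in\mathbb R^d:\|x\|=1\}$.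
   Context: Shift: $\Omega^+=\{1,\dots,k\}^{\mathbb N}$, $\mathbb N=\{0,1,2,\dots\}$, with the cylinder $\sigma$-algebra $\mathcal F^+$ and $(\sigma\omega)_i=\omega_{i+1}$. "One-sided Markovian full shift over $k$ symbols" means that $\mathbb P$ is a $\sigma$-invariant probability measure under which $(\omega_i)$ is a Markov chain and every non-empty cylinder set has positive probability. $\mathbb E$ is expectation under $\mathbb P$; $\log^+=\max\{\log,0\}$. LRDS: $\varphi(0,\omega)=\mathrm{Id}$, $\varphi(n,\omega)=M(\sigma^{n-1}\omega)\cdots M(\sigma\omega)M(\omega)$ for $n\ge1$, where each $M(\omega)$ is a $d\times d$ real matrix. Spatially invertible means every $M(\omega)$ is invertible. The induced normalized system is $\psi(n,\omega)[x]=[\varphi(n,\omega)x]$ on $\mathbb RP^{d-1}$. The Lyapunov exponent is $\gamma=\lim_{n\to\infty}\frac1n\mathbb E[\log\|\varphi(n,\omega)\|]$. In (2), $\|M(\omega)\bar x\|$ is computed with a unit vector representing $\bar x\in\mathbb RP^{d-1}$. Let $\mathcal S_\varphi=\{\varphi(n,\omega):n\ge0,\omega\in\Omega^+\}$. $\varphi$ is strongly irreducible if there is no non-empty finite family of nonzero proper linear subspaces $V_1,\dots,V_m$ of $\mathbb R^d$ with $A(V_1\cup\dots\cup V_m)=V_1\cup\dots\cup V_m$ for every $A\in\mathcal S_\varphi$. Invariant measure for $\psi$: a probability measure $\nu$ on $\Omega^+\times\mathbb RP^{d-1}$ with marginal $\mathbb P$ on $\Omega^+$, invariant under the skew product $(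\omega,x)\mapsto(\sigma\omega,\psi(1,\omega)x)$.
   Formalization: In (2), ν is assumed to be either the only invariant measure or of the form P(dω)ρ_{ω_0}(dx); for an arbitrary invariant measure (2) fails, e.g. for the one carried by the slow Oseledets line of i.i.d. SL_2(R) matrices. *)

theory Defs
  imports "HOL-Probability.Probability"
begin

section \<open>One-sided Markovian full shifts\<close>

text \<open>The \<open>k\<close> symbols are the elements of a finite type \<^typ>\<open>'s\<close> (so \<open>k = CARD('s)\<close>), and the
  shift space is the full type \<^typ>\<open>nat \<Rightarrow> 's\<close>.\<close>

definition seq_space :: "(nat \<Rightarrow> 's::finite) measure" where
  "seq_space = Pi\<^sub>M UNIV (\<lambda>_. count_space UNIV)"

definition shift :: "(nat \<Rightarrow> 's) \<Rightarrow> nat \<Rightarrow> 's" where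
  "shift \<omega> = (\<lambda>i. \<omega> (Suc i))"

definition cylinder :: "'s list \<Rightarrow> (nat \<Rightarrow> 's) set" where
  "cylinder w = {\<omega>. \<forall>i<length w. \<omega> i = w ! i}"

definition markov_property :: "(nat \<Rightarrow> 's) measure \<Rightarrow> bool" where
  "markov_property P \<longleftrightarrow>
    (\<forall>n w. \<P>(\<omega> in P. \<omega> (Suc n) = w (Suc n) \<bar> \<forall>i\<le>n. \<omega> i = w i)
          = \<P>(\<omega> in P. \<omega> (Suc n) = w (Suc n) \<bar> \<omega> n = w n))"

text \<open>Every non-empty cylinder set contains a set \<^term>\<open>cylinder w\<close>, so it suffices to require
  positivity of the latter. Time-homogeneity of the chain follows from shift-invariance.\<close>

definition markovian_full_shift :: "(nat \<Rightarrow> 's::finite) measure \<Rightarrow> bool" where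
  "markovian_full_shift P \<longleftrightarrow>
    prob_space P \<and> sets P = sets seq_space \<and> distr P P shift = P \<and>
    markov_property P \<and> (\<forall>w. measure P (cylinder w) > 0)"


section \<open>Linear random dynamical systems\<close>

fun lrds :: "((nat \<Rightarrow> 's) \<Rightarrow> real^'d^'d) \<Rightarrow> nat \<Rightarrow> (nat \<Rightarrow> 's) \<Rightarrow> real^'d^'d" where
  "lrds M 0 \<omega> = mat 1"
| "lrds M (Suc n) \<omega> = M ((shift ^^ n) \<omega>) ** lrds M n \<omega>"

definition depends_on_first :: "((nat \<Rightarrow> 's) \<Rightarrow> 'b) \<Rightarrow> bool" where
  "depends_on_first f \<longleftrightarrow> (\<forall>\<omega> \<omega>'. \<omega> 0 = \<omega>' 0 \<longrightarrow> f \<omega> = f \<omega>')"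

text \<open>The library norm on matrices is the Frobenius norm; we use the operator norm induced by the
  Euclidean norm.\<close>

definition opnorm :: "real^'d^'d \<Rightarrow> real" where
  "opnorm A = onorm ((*v) A)"

definition log_plus :: "real \<Rightarrow> real" where
  "log_plus t = max (ln t) 0"

definition lyapunov_exponent ::
  "(nat \<Rightarrow> 's) measure \<Rightarrow> ((nat \<Rightarrow> 's) \<Rightarrow> real^'d^'d) \<Rightarrow> real" where
  "lyapunov_exponent P M = lim (\<lambda>n. (1 / real n) * (\<integral>\<omega>. ln (opnorm (lrds M n \<omega>)) \<partial>P))"

definition strongly_irreducible :: "((nat \<Rightarrow> 's) \<Rightarrow> real^'d^'d) \<Rightarrow> bool" where
  "strongly_irreducible M \<longleftrightarrow>
    \<not> (\<exists>\<V>. finite \<V> \<and> \<V> \<noteq> {} \<and>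
          (\<forall>V\<in>\<V>. subspace V \<and> V \<noteq> {0} \<and> V \<noteq> UNIV) \<and>
          (\<forall>A \<in> {lrds M n \<omega> | n \<omega>. True}. (*v) A ` \<Union>\<V> = \<Union>\<V>))"


section \<open>The normalized system on projective space\<close>

text \<open>A point \<open>[x]\<close> of the projective space is the line \<^term>\<open>span {x}\<close>.\<close>

definition proj_points :: "(real^'d) set set" where
  "proj_points = {span {x} | x. x \<noteq> 0}"

text \<open>The Borel sets of the quotient topology: \<open>U\<close> is open iff its preimage under
  \<open>x \<mapsto> [x]\<close> is open in the punctured space, equivalently in the whole space.\<close>

definition proj_space :: "(real^'d) set measure" where
  "proj_space = sigma proj_points {U. U \<subseteq> proj_points \<and> open {x. x \<noteq> 0 \<and> span {x} \<in> U}}"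

definition normalized_rds ::
  "((nat \<Rightarrow> 's) \<Rightarrow> real^'d^'d) \<Rightarrow> nat \<Rightarrow> (nat \<Rightarrow> 's) \<Rightarrow> (real^'d) set \<Rightarrow> (real^'d) set" where
  "normalized_rds M n \<omega> L = (*v) (lrds M n \<omega>) ` L"

lemma normalized_rds_span: "normalized_rds M n \<omega> (span {x}) = span {lrds M n \<omega> *v x}"
  using linear_span_image[OF matrix_vector_mul_linear, of "lrds M n \<omega>" "{x}"]
  by (simp add: normalized_rds_def)

definition unit_rep :: "(real^'d) set \<Rightarrow> real^'d" where
  "unit_rep L = (SOME u. u \<in> L \<and> norm u = 1)"

lemma unit_rep:
  assumes "L \<in> proj_points"
  shows "unit_rep L \<in> L" "norm (unit_rep L) = 1"
proof -
  obtain x where x: "L = span {x}" "x \<noteq> 0"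
    using assms by (auto simp: proj_points_def)
  have "(1 / norm x) *\<^sub>R x \<in> L \<and> norm ((1 / norm x) *\<^sub>R x) = 1"
    using x by (simp add: span_base span_scale)
  then have "unit_rep L \<in> L \<and> norm (unit_rep L) = 1"
    unfolding unit_rep_def by (rule someI)
  then show "unit_rep L \<in> L" "norm (unit_rep L) = 1" by auto
qed

text \<open>The choice of the unit vector is immaterial:\<close>

lemma norm_mult_unit_rep:
  assumes "L \<in> proj_points" "u \<in> L" "norm u = 1"
  shows "norm (A *v unit_rep L) = norm (A *v u)"
proof -
  obtain x where x: "L = span {x}" "x \<noteq> 0"
    using assms by (auto simp: proj_points_def)
  obtain a b where ab: "u = a *\<^sub>R x" "unit_rep L = b *\<^sub>R x"
    using assms(2) unit_rep(1)[OF assms(1)] x by (auto simp: span_singleton)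
  have "\<bar>a\<bar> * norm x = \<bar>b\<bar> * norm x"
    using assms(3) unit_rep(2)[OF assms(1)] ab by simp
  then have "\<bar>a\<bar> = \<bar>b\<bar>" using x by simp
  then show ?thesis by (simp add: ab matrix_vector_mult_scaleR)
qed

definition skew_product ::
  "((nat \<Rightarrow> 's) \<Rightarrow> real^'d^'d) \<Rightarrow> (nat \<Rightarrow> 's) \<times> (real^'d) set \<Rightarrow> (nat \<Rightarrow> 's) \<times> (real^'d) set" where
  "skew_product M = (\<lambda>(\<omega>, L). (shift \<omega>, normalized_rds M 1 \<omega> L))"

definition invariant_measure ::
  "(nat \<Rightarrow> 's) measure \<Rightarrow> ((nat \<Rightarrow> 's) \<Rightarrow> real^'d^'d)
    \<Rightarrow> ((nat \<Rightarrow> 's) \<times> (real^'d) set) measure \<Rightarrow> bool" where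
  "invariant_measure P M \<nu> \<longleftrightarrow>
    prob_space \<nu> \<and> sets \<nu> = sets (P \<Otimes>\<^sub>M proj_space) \<and>
    distr \<nu> P fst = P \<and> distr \<nu> \<nu> (skew_product M) = \<nu>"

text \<open>Over a one-sided shift, invariant measures with marginal \<open>P\<close> need not be unique: when the
  exponents differ, the slowest Oseledets space \<open>E(\<omega>)\<close> is a function of \<open>\<omega>\<close>, and any invariant
  measure carried by it has the smallest exponent as its Furstenberg integral. ``The'' invariant
  measure therefore means an invariant measure which either is the only one, or is Markovian,
  i.e. it has the form \<open>\<nu>(d\<omega>, dx) = P(d\<omega>) \<rho>\<^bsub>\<omega> 0\<^esub>(dx)\<close> (for Bernoulli \<open>P\<close> and constant \<open>\<rho>\<close>, the product of \<open>P\<close>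
  with a stationary measure).\<close>

definition markovian_disintegration ::
  "(nat \<Rightarrow> 's) measure \<Rightarrow> ((nat \<Rightarrow> 's) \<times> (real^'d) set) measure \<Rightarrow> bool" where
  "markovian_disintegration P \<nu> \<longleftrightarrow>
    (\<exists>\<rho>. (\<forall>s. prob_space (\<rho> s) \<and> sets (\<rho> s) = sets proj_space) \<and>
         (\<forall>A\<in>sets P. \<forall>B\<in>sets proj_space.
            emeasure \<nu> (A \<times> B) = (\<integral>\<^sup>+\<omega>\<in>A. emeasure (\<rho> (\<omega> 0)) B \<partial>P)))"

definition the_invariant_measure ::
  "(nat \<Rightarrow> 's) measure \<Rightarrow> ((nat \<Rightarrow> 's) \<Rightarrow> real^'d^'d)
    \<Rightarrow> ((nat \<Rightarrow> 's) \<times> (real^'d) set) measure \<Rightarrow> bool" where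
  "the_invariant_measure P M \<nu> \<longleftrightarrow>
    invariant_measure P M \<nu> \<and>
    ((\<forall>\<nu>'. invariant_measure P M \<nu>' \<longrightarrow> \<nu>' = \<nu>) \<or> markovian_disintegration P \<nu>)"

end

theory Submission
  imports Defs
begin

text \<open>The alphabet is finite, so \<open>ln \<parallel>\<phi>(n,\<omega>)x\<parallel>\<close> changes by at most a constant \<open>C\<close> per step. The pair
\<open>(\<omega> n, \<phi>(n,\<omega>)x)\<close> is a Markov chain on symbols times vectors; \<open>Q\<close> is its transition operator, and
\<open>D n s x\<close> is the expected increase of \<open>ln \<parallel>x\<parallel>\<close> over \<open>n\<close> steps when the first symbol is \<open>s\<close>. Let \<open>\<beta>\<close> be
the supremum over \<open>n \<ge> 1\<close> of the infimum of \<open>D n s x / n\<close> over \<open>s\<close> and \<open>x \<noteq> 0\<close>. Everything follows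
from the fact that \<open>D n s x / n\<close> tends to \<open>\<beta>\<close> uniformly in \<open>s\<close> and \<open>x\<close>, and that \<open>\<beta>\<close> is the Lyapunov
exponent.

The lower bound is a Chernoff argument (\<open>chernoff\<close>): some block length has drift close to \<open>\<beta>\<close> from
every starting point, so by the Markov property deviations below \<open>n (\<beta> - \<epsilon>)\<close> have exponentially small
probability. For the upper bound (\<open>excess_bound\<close>), take a starting point \<open>(s, x)\<close> at which \<open>D n\<close> is
nearly minimal, hence at most about \<open>n \<beta>\<close>. As downward deviations are negligible, the expected
positive part of \<open>ln \<parallel>\<phi>(n,\<omega>)x\<parallel> - n (\<beta> - \<epsilon>)\<close> is \<open>O(\<epsilon> n)\<close>. By irreducibility and compactness
(\<open>spanning\<close>), boundedly many steps lead from \<open>x\<close>, with probability bounded below, to each of finitely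
many vectors such that every matrix attains a fixed fraction of its norm at one of them. So the same \<open>O(\<epsilon> n)\<close> controls
\<open>ln \<parallel>\<phi>(n,\<omega>)\<parallel>\<close> itself, and with it \<open>ln \<parallel>\<phi>(n,\<omega>)y\<parallel>\<close> for all unit vectors \<open>y\<close>. This gives the uniform
convergence of expectations.

With uniform convergence the Chernoff bound works in both directions and is uniform over unit
vectors. Hence Borel-Cantelli applies to any deterministic sequence of directions, in particular to
\<open>X n / \<parallel>X n\<parallel>\<close>, which is the almost sure statement.

A Markovian invariant measure is a stationary law of the chain on symbols times projective space.
The integral of \<open>D n\<close> against it is \<open>n\<close> times the integral of \<open>D 1\<close>, and dividing by \<open>n\<close> yields the
formula for the exponent (\<open>furstenberg_formula\<close>). An invariant measure that is the only one is
Markovian because a Markovian one exists (\<open>markovian_invariant_measure_exists\<close>). The latter is the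
Krylov-Bogoliubov argument. The weak compactness that it needs is obtained from Helly's theorem on
the real line: a space-filling curve with a measurable right inverse transports laws on a cube to
laws on the line and their weak limits back.\<close>

section \<open>Transition probabilities and the Markov property\<close>

locale markov_shift =
  fixes P :: "(nat \<Rightarrow> 's::finite) measure"
  assumes full_shift: "markovian_full_shift P"
begin

definition stat :: "'s \<Rightarrow> real" where
  "stat s = measure P {\<omega>. \<omega> 0 = s}"

definition trans_prob :: "'s \<Rightarrow> 's \<Rightarrow> real" where
  "trans_prob s t = measure P {\<omega>. \<omega> 0 = s \<and> \<omega> (Suc 0) = t} / stat s"

sublocale prob_space P
  using full_shift by (simp add: markovian_full_shift_def)

lemma sets_P: "sets P = sets seq_space"
  using full_shift by (simp add: markovian_full_shift_def)

lemma space_P [simp]: "space P = UNIV"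
  using sets_eq_imp_space_eq[OF sets_P] by (simp add: seq_space_def space_PiM)

lemma coordinate_measurable [measurable]: "(\<lambda>\<omega>. \<omega> i) \<in> measurable P (count_space UNIV)"
proof -
  have "(\<lambda>\<omega>. \<omega> i) \<in> measurable seq_space (count_space UNIV)"
    unfolding seq_space_def by measurable
  then show ?thesis
    using measurable_cong_sets[OF sets_P refl] by blast
qed

lemma cylinder_sets [measurable]: "cylinder w \<in> sets P"
proof -
  have "{\<omega>\<in>space P. \<forall>i\<in>{..<length w}. \<omega> i = w ! i} \<in> sets P"
    by measurable
  then show ?thesis by (simp add: cylinder_def Ball_def)
qed

lemma cylinder_iff_prefix: "\<omega> \<in> cylinder w \<longleftrightarrow> map \<omega> [0..<length w] = w"
proof -
  have "map \<omega> [0..<length w] = w \<longleftrightarrow> (\<forall>i<length w. map \<omega> [0..<length w] ! i = w ! i)"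
    by (subst list_eq_iff_nth_eq) simp
  then show ?thesis by (simp add: cylinder_def)
qed

lemma shift_measurable [measurable]: "shift \<in> measurable P P"
proof -
  have "shift \<in> measurable seq_space seq_space"
    unfolding seq_space_def shift_def
    by (rule measurable_PiM_single') auto
  then show ?thesis
    using measurable_cong_sets[OF sets_P sets_P] by blast
qed

lemma measure_shift_vimage:
  assumes "E \<in> sets P"
  shows "measure P {\<omega>. shift \<omega> \<in> E} = measure P E"
proof -
  have "distr P P shift = P"
    using full_shift by (simp add: markovian_full_shift_def)
  then have "measure P E = measure (distr P P shift) E" by simp
  also have "\<dots> = measure P (shift -` E \<inter> space P)"
    by (rule measure_distr) (use assms in auto)
  finally show ?thesis by (simp add: vimage_def)
qed

lemma measure_coordinate: "measure P {\<omega>. \<omega> n = s} = stat s"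
proof (induction n)
  case (Suc n)
  have "{\<omega>\<in>space P. \<omega> n = s} \<in> sets P" by measurable
  from measure_shift_vimage[OF this] Suc show ?case unfolding shift_def by simp
next
  case 0 show ?case unfolding stat_def ..
qed

lemma stat_pos: "stat s > 0"
proof -
  have "measure P (cylinder [s]) > 0"
    using full_shift by (simp add: markovian_full_shift_def)
  then show ?thesis by (simp add: stat_def cylinder_def)
qed

text \<open>Shift invariance makes the chain homogeneous in time, so one transition matrix serves all
  steps.\<close>

lemma measure_two_coordinates:
  "measure P {\<omega>. \<omega> n = s \<and> \<omega> (Suc n) = t} = stat s * trans_prob s t"
proof (induction n)
  case 0
  show ?case using stat_pos[of s] by (simp add: trans_prob_def)
next
  case (Suc n)
  have "{\<omega>\<in>space P. \<omega> n = s \<and> \<omega> (Suc n) = t} \<in> sets P" by measurable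
  from measure_shift_vimage[OF this] Suc show ?case unfolding shift_def by simp
qed

lemma trans_prob_pos: "trans_prob s t > 0"
proof -
  have "cylinder [s, t] = {\<omega>. \<omega> 0 = s \<and> \<omega> (Suc 0) = t}"
    by (auto simp: cylinder_def less_Suc_eq nth_Cons split: nat.splits)
  moreover have "measure P (cylinder [s, t]) > 0"
    using full_shift by (simp add: markovian_full_shift_def)
  ultimately show ?thesis
    using stat_pos[of s] by (simp add: trans_prob_def)
qed

lemma sum_stat: "(\<Sum>s\<in>UNIV. stat s) = 1"
proof -
  have "measure P (\<Union>s\<in>UNIV. {\<omega>. \<omega> 0 = s}) = (\<Sum>s\<in>UNIV. measure P {\<omega>. \<omega> 0 = s})"
  proof (rule finite_measure_finite_Union)
    have "{\<omega>\<in>space P. \<omega> 0 = s} \<in> sets P" for s by measurable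
    then show "(\<lambda>s. {\<omega>. \<omega> 0 = s}) ` UNIV \<subseteq> sets P" by auto
  qed (auto simp: disjoint_family_on_def)
  moreover have "(\<Union>s\<in>UNIV. {\<omega>. \<omega> 0 = s}) = space P" by auto
  ultimately show ?thesis using prob_space by (simp add: stat_def)
qed

lemma sum_trans_prob: "(\<Sum>t\<in>UNIV. trans_prob s t) = 1"
proof -
  have "measure P (\<Union>t\<in>UNIV. {\<omega>. \<omega> 0 = s \<and> \<omega> (Suc 0) = t})
      = (\<Sum>t\<in>UNIV. measure P {\<omega>. \<omega> 0 = s \<and> \<omega> (Suc 0) = t})"
  proof (rule finite_measure_finite_Union)
    have "{\<omega>\<in>space P. \<omega> 0 = s \<and> \<omega> (Suc 0) = t} \<in> sets P" for t by measurable
    then show "(\<lambda>t. {\<omega>. \<omega> 0 = s \<and> \<omega> (Suc 0) = t}) ` UNIV \<subseteq> sets P" by auto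
  qed (auto simp: disjoint_family_on_def)
  moreover have "(\<Union>t\<in>UNIV. {\<omega>. \<omega> 0 = s \<and> \<omega> (Suc 0) = t}) = {\<omega>. \<omega> 0 = s}" by auto
  ultimately have "stat s = (\<Sum>t\<in>UNIV. stat s * trans_prob s t)"
    using measure_two_coordinates[of 0 s] by (simp add: stat_def)
  then have "stat s * 1 = stat s * (\<Sum>t\<in>UNIV. trans_prob s t)"
    by (simp add: sum_distrib_left)
  then show ?thesis using stat_pos[of s] by simp
qed

lemma measure_cylinder_append:
  assumes "w \<noteq> []"
  shows "measure P (cylinder (w @ [t])) = measure P (cylinder w) * trans_prob (last w) t"
proof -
  obtain n where n: "length w = Suc n" using assms by (cases w) auto
  let ?w = "\<lambda>i. (w @ [t]) ! i"
  have l: "?w n = last w" "?w (Suc n) = t"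
    using n assms by (auto simp: nth_append last_conv_nth)
  have w: "?w i = w ! i" if "i \<le> n" for i
    using n that by (simp add: nth_append)
  have "\<P>(\<omega> in P. \<omega> (Suc n) = ?w (Suc n) \<bar> \<forall>i\<le>n. \<omega> i = ?w i)
      = \<P>(\<omega> in P. \<omega> (Suc n) = ?w (Suc n) \<bar> \<omega> n = ?w n)"
    using full_shift unfolding markovian_full_shift_def markov_property_def by blast
  moreover have "{\<omega>. \<omega> (Suc n) = ?w (Suc n) \<and> (\<forall>i\<le>n. \<omega> i = ?w i)} = cylinder (w @ [t])"
    by (auto simp: cylinder_def n less_Suc_eq_le le_Suc_eq)
  moreover have "{\<omega>. \<forall>i\<le>n. \<omega> i = ?w i} = cylinder w"
    by (auto simp: cylinder_def n less_Suc_eq_le w)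
  moreover have "{\<omega>. \<omega> (Suc n) = ?w (Suc n) \<and> \<omega> n = ?w n}
      = {\<omega>. \<omega> n = last w \<and> \<omega> (Suc n) = t}"
    unfolding l by auto
  moreover have "{\<omega>. \<omega> n = ?w n} = {\<omega>. \<omega> n = last w}"
    unfolding l by simp
  ultimately have "measure P (cylinder (w @ [t])) / measure P (cylinder w)
      = stat (last w) * trans_prob (last w) t / stat (last w)"
    by (simp add: cond_prob_def measure_coordinate measure_two_coordinates)
  moreover have "measure P (cylinder w) > 0"
    using full_shift by (simp add: markovian_full_shift_def)
  ultimately show ?thesis
    using stat_pos[of "last w"] by (simp add: field_simps)
qed

text \<open>The factor is the transition probability of the time-reversed stationary chain from
  \<open>t\<close> to \<open>s\<close>.\<close>

lemma measure_cylinder_Cons: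
  "measure P (cylinder (s # t # w)) = stat s * trans_prob s t / stat t * measure P (cylinder (t # w))"
proof (induction w rule: rev_induct)
  case Nil
  have "cylinder [s, t] = {\<omega>. \<omega> 0 = s \<and> \<omega> (Suc 0) = t}" "cylinder [t] = {\<omega>. \<omega> 0 = t}"
    by (auto simp: cylinder_def less_Suc_eq nth_Cons split: nat.splits)
  then show ?case
    using measure_two_coordinates[of 0 s t] stat_pos[of t] by (simp add: stat_def)
next
  case (snoc a w)
  have "measure P (cylinder (s # t # w @ [a]))
      = measure P (cylinder (s # t # w)) * trans_prob (last (t # w)) a"
    using measure_cylinder_append[of "s # t # w" a] by simp
  also have "\<dots> = stat s * trans_prob s t / stat t
      * (measure P (cylinder (t # w)) * trans_prob (last (t # w)) a)"
    by (simp add: snoc)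
  also have "\<dots> = stat s * trans_prob s t / stat t * measure P (cylinder (t # w @ [a]))"
    using measure_cylinder_append[of "t # w" a] by simp
  finally show ?case .
qed

lemma integral_prefix:
  fixes H :: "'s list \<Rightarrow> real"
  shows "integrable P (\<lambda>\<omega>. H (map \<omega> [0..<n]))"
    and "(\<integral>\<omega>. H (map \<omega> [0..<n]) \<partial>P)
      = (\<Sum>w | length w = n. measure P (cylinder w) * H w)"
proof -
  have fin: "finite {w :: 's list. length w = n}"
    using finite_lists_length_eq[of "UNIV :: 's set" n] by simp
  have eq: "H (map \<omega> [0..<n]) = (\<Sum>w | length w = n. indicator (cylinder w) \<omega> * H w)" for \<omega>
  proof -
    have "(\<Sum>w | length w = n. indicator (cylinder w) \<omega> * H w)
        = (\<Sum>w | length w = n. if w = map \<omega> [0..<n] then H w else 0)"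
      by (rule sum.cong) (auto simp: indicator_def cylinder_iff_prefix)
    also have "\<dots> = H (map \<omega> [0..<n])"
      using fin by (simp add: sum.delta)
    finally show ?thesis by simp
  qed
  have int: "integrable P (\<lambda>\<omega>. indicator (cylinder w) \<omega> * H w)" for w
    by (intro integrable_mult_left integrable_real_indicator) (auto simp: less_top[symmetric])
  show "integrable P (\<lambda>\<omega>. H (map \<omega> [0..<n]))"
    unfolding eq by (intro Bochner_Integration.integrable_sum int)
  show "(\<integral>\<omega>. H (map \<omega> [0..<n]) \<partial>P)
      = (\<Sum>w | length w = n. measure P (cylinder w) * H w)"
  proof -
    have "(\<integral>\<omega>. (\<Sum>w | length w = n. indicator (cylinder w) \<omega> * H w) \<partial>P)
        = (\<Sum>w | length w = n. \<integral>\<omega>. indicator (cylinder w) \<omega> * H w \<partial>P)"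
      by (rule Bochner_Integration.integral_sum) (rule int)
    also have "\<dots> = (\<Sum>w | length w = n. measure P (cylinder w) * H w)"
      by (rule sum.cong) simp_all
    finally show ?thesis unfolding eq .
  qed
qed

lemma sum_words_snoc:
  "(\<Sum>w | length w = Suc n. G w) = (\<Sum>w | length w = n. \<Sum>t\<in>UNIV. (G (w @ [t]) :: real))"
  for G :: "'s list \<Rightarrow> real"
proof -
  have "(\<Sum>w | length w = n. \<Sum>t\<in>UNIV. G (w @ [t]))
      = (\<Sum>(w, t)\<in>{w. length w = n} \<times> UNIV. G (w @ [t]))"
    by (rule sum.cartesian_product)
  also have "\<dots> = (\<Sum>w | length w = Suc n. G w)"
  proof (rule sum.reindex_bij_witness[where i = "\<lambda>w. (butlast w, last w)" and j = "\<lambda>(w, t). w @ [t]"])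
    fix w :: "'s list" assume w: "w \<in> {w. length w = Suc n}"
    then have "w \<noteq> []" by auto
    then show "(case (butlast w, last w) of (w, t) \<Rightarrow> w @ [t]) = w" by simp
    show "(butlast w, last w) \<in> {w. length w = n} \<times> UNIV" using w by simp
  qed auto
  finally show ?thesis by (rule sym)
qed

text \<open>The Markov property for integrals: a function of finitely many symbols may be averaged over the
  last one, conditionally on the others.\<close>

lemma integral_next_symbol:
  fixes H :: "'s list \<Rightarrow> 's \<Rightarrow> real"
  shows "(\<integral>\<omega>. H (map \<omega> [0..<Suc n]) (\<omega> (Suc n)) \<partial>P)
    = (\<integral>\<omega>. (\<Sum>t\<in>UNIV. trans_prob (\<omega> n) t * H (map \<omega> [0..<Suc n]) t) \<partial>P)"
proof -
  have snoc: "map \<omega> [0..<Suc (Suc n)] = map \<omega> [0..<Suc n] @ [\<omega> (Suc n)]" for \<omega> :: "nat \<Rightarrow> 's"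
    by simp
  have "(\<integral>\<omega>. H (map \<omega> [0..<Suc n]) (\<omega> (Suc n)) \<partial>P)
      = (\<integral>\<omega>. (\<lambda>w. H (butlast w) (last w)) (map \<omega> [0..<Suc (Suc n)]) \<partial>P)"
    by (simp only: snoc butlast_snoc last_snoc)
  also have "\<dots> = (\<Sum>w | length w = Suc n. \<Sum>t\<in>UNIV.
      measure P (cylinder (w @ [t])) * H w t)"
    by (subst integral_prefix(2), subst sum_words_snoc) simp
  also have "\<dots> = (\<Sum>w | length w = Suc n. measure P (cylinder w)
      * (\<Sum>t\<in>UNIV. trans_prob (last w) t * H w t))"
  proof (rule sum.cong)
    fix w :: "'s list" assume "w \<in> {w. length w = Suc n}"
    then have "w \<noteq> []" by auto
    then show "(\<Sum>t\<in>UNIV. measure P (cylinder (w @ [t])) * H w t)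
      = measure P (cylinder w) * (\<Sum>t\<in>UNIV. trans_prob (last w) t * H w t)"
      by (simp add: measure_cylinder_append sum_distrib_left mult.assoc)
  qed simp
  also have "\<dots> = (\<integral>\<omega>. (\<lambda>w. \<Sum>t\<in>UNIV. trans_prob (last w) t * H w t) (map \<omega> [0..<Suc n]) \<partial>P)"
    by (subst integral_prefix(2)) simp
  finally show ?thesis by simp
qed

end

lemma lrds_cong:
  assumes "depends_on_first M" "\<forall>i<n. \<omega> i = \<omega>' i"
  shows "lrds M n \<omega> = lrds M n \<omega>'"
proof -
  have sh: "(shift ^^ m) \<omega> i = \<omega> (m + i)" for m i and \<omega> :: "nat \<Rightarrow> 's"
    by (induction m arbitrary: i) (auto simp: shift_def)
  show ?thesis
    using assms(2)
  proof (induction n)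
    case (Suc n)
    have "M ((shift ^^ n) \<omega>) = M ((shift ^^ n) \<omega>')"
      using assms(1)[unfolded depends_on_first_def, rule_format, of "(shift ^^ n) \<omega>" "(shift ^^ n) \<omega>'"]
        Suc.prems by (simp add: sh)
    with Suc show ?case by simp
  qed simp
qed

lemma lrds_prefix:
  assumes "depends_on_first M"
  shows "lrds M n \<omega> = lrds M n (\<lambda>i. map \<omega> [0..<n] ! i)"
  by (rule lrds_cong[OF assms]) simp

locale markov_cocycle = markov_shift P for P :: "(nat \<Rightarrow> 's::finite) measure" +
  fixes M :: "(nat \<Rightarrow> 's) \<Rightarrow> real^'d^'d"
  assumes irreducible: "strongly_irreducible M"
    and invertible_M: "invertible (M \<omega>)"
    and first_coordinate: "depends_on_first M"
begin

text \<open>The one-step matrices as a function of the symbol that \<open>M\<close> reads.\<close>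

definition A :: "'s \<Rightarrow> real^'d^'d" where
  "A s = M (\<lambda>_. s)"

text \<open>The transition operator of the Markov chain \<open>(\<omega> n, \<phi>(n,\<omega>)x)\<close>. The
  value \<open>(Q ^^ n) F s x\<close> is the expectation of \<open>F\<close> after \<open>n\<close> steps,
  conditionally on \<open>\<omega> 0 = s\<close>.\<close>

definition Q :: "('s \<Rightarrow> real^'d \<Rightarrow> real) \<Rightarrow> 's \<Rightarrow> real^'d \<Rightarrow> real" where
  "Q F s x = (\<Sum>t\<in>UNIV. trans_prob s t * F t (A s *v x))"

lemma M_eq_A: "M \<omega> = A (\<omega> 0)"
  unfolding A_def
  by (rule first_coordinate[unfolded depends_on_first_def, rule_format]) (rule refl)

lemma lrds_Suc_mult: "lrds M (Suc n) \<omega> *v x = A (\<omega> n) *v (lrds M n \<omega> *v x)"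
proof -
  have "(shift ^^ m) \<omega> i = \<omega> (m + i)" for m i
    by (induction m arbitrary: i) (auto simp: shift_def)
  then show ?thesis by (simp add: M_eq_A matrix_vector_mul_assoc)
qed

lemma integrable_lrds: "integrable P (\<lambda>\<omega>. (G :: real^'d^'d \<Rightarrow> real) (lrds M n \<omega>))"
proof -
  have eq: "(\<lambda>\<omega>. G (lrds M n \<omega>)) = (\<lambda>\<omega>. (\<lambda>w. G (lrds M n (\<lambda>i. w ! i))) (map \<omega> [0..<n]))"
    by (intro ext arg_cong[where f = G]) (rule lrds_prefix[OF first_coordinate])
  show ?thesis
    unfolding eq by (rule integral_prefix(1)[of "\<lambda>w. G (lrds M n (\<lambda>i. w ! i))" n])
qed

lemma integral_eq_Q:
  "(\<integral>\<omega>. F (\<omega> n) (lrds M n \<omega> *v x) \<partial>P) = (\<Sum>s\<in>UNIV. stat s * (Q ^^ n) F s x)"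
proof (induction n arbitrary: F)
  case 0
  have "(\<integral>\<omega>. F (\<omega> 0) x \<partial>P) = (\<integral>\<omega>. (\<lambda>w. F (hd w) x) (map \<omega> [0..<Suc 0]) \<partial>P)"
    by simp
  also have "\<dots> = (\<Sum>s\<in>UNIV. stat s * F s x)"
    by (subst integral_prefix(2), subst sum_words_snoc) (simp add: stat_def cylinder_def)
  finally show ?case by simp
next
  case (Suc n)
  let ?Z = "\<lambda>w. A (last w) *v (lrds M n (\<lambda>i. w ! i) *v x)"
  have Z: "lrds M (Suc n) \<omega> *v x = ?Z (map \<omega> [0..<Suc n])" for \<omega>
  proof -
    have "lrds M n \<omega> = lrds M n (\<lambda>i. map \<omega> [0..<Suc n] ! i)"
      by (rule lrds_cong[OF first_coordinate]) (simp add: nth_append)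
    moreover have "last (map \<omega> [0..<Suc n]) = \<omega> n" by simp
    ultimately show ?thesis by (simp only: lrds_Suc_mult)
  qed
  have "(\<integral>\<omega>. F (\<omega> (Suc n)) (lrds M (Suc n) \<omega> *v x) \<partial>P)
      = (\<integral>\<omega>. (\<Sum>t\<in>UNIV. trans_prob (\<omega> n) t * F t (lrds M (Suc n) \<omega> *v x)) \<partial>P)"
    unfolding Z by (rule integral_next_symbol[of "\<lambda>w t. F t (?Z w)"])
  also have "\<dots> = (\<integral>\<omega>. Q F (\<omega> n) (lrds M n \<omega> *v x) \<partial>P)"
    by (simp only: Q_def lrds_Suc_mult)
  also have "\<dots> = (\<Sum>s\<in>UNIV. stat s * (Q ^^ Suc n) F s x)"
    unfolding Suc by (simp add: funpow_swap1)
  finally show ?case .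
qed

lemma invertible_A: "invertible (A s)"
  by (simp add: A_def invertible_M)

lemma A_nonzero [simp]: "A s *v x = 0 \<longleftrightarrow> x = 0"
  using invertible_A[of s] inj_matrix_vector_mult[of "A s"]
  by (metis injD matrix_vector_mult_0_right)

lemma lrds_nonzero [simp]: "lrds M n \<omega> *v x = 0 \<longleftrightarrow> x = 0"
proof (induction n)
  case (Suc n)
  then show ?case by (simp only: lrds_Suc_mult A_nonzero)
qed simp

definition \<Lambda> :: "real^'d \<Rightarrow> real" where
  "\<Lambda> x = ln (norm x)"

text \<open>Finitely many invertible matrices distort norms by bounded factors in both directions.\<close>

lemma one_step_bound: "\<exists>C>0. \<forall>s x. x \<noteq> 0 \<longrightarrow> \<bar>\<Lambda> (A s *v x) - \<Lambda> x\<bar> \<le> C"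
proof -
  have "\<exists>C. \<forall>x. x \<noteq> 0 \<longrightarrow> \<bar>\<Lambda> (A s *v x) - \<Lambda> x\<bar> \<le> C" for s
  proof -
    obtain K where K: "K > 0" "\<And>x. norm (A s *v x) \<le> norm x * K"
      using bounded_linear.pos_bounded[OF matrix_vector_mul_bounded_linear[of "A s"]] by blast
    obtain B where B: "B ** A s = mat 1"
      using invertible_A[of s] by (auto simp: invertible_def)
    obtain L where L: "L > 0" "\<And>x. norm (B *v x) \<le> norm x * L"
      using bounded_linear.pos_bounded[OF matrix_vector_mul_bounded_linear[of B]] by blast
    have "\<bar>\<Lambda> (A s *v x) - \<Lambda> x\<bar> \<le> \<bar>ln K\<bar> + \<bar>ln L\<bar>" if "x \<noteq> 0" for x
    proof -
      have p: "norm (A s *v x) > 0" "norm x > 0" using that by simp_all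
      have "ln (norm (A s *v x)) \<le> ln (norm x * K)"
        using K p by (subst ln_le_cancel_iff) auto
      also have "\<dots> = ln (norm x) + ln K" using K p by (simp add: ln_mult)
      finally have 1: "\<Lambda> (A s *v x) - \<Lambda> x \<le> ln K" by (simp add: \<Lambda>_def)
      have "norm x \<le> norm (A s *v x) * L"
        using L(2)[of "A s *v x"] by (simp add: matrix_vector_mul_assoc B)
      then have "ln (norm x) \<le> ln (norm (A s *v x) * L)"
        using L p by (subst ln_le_cancel_iff) auto
      also have "\<dots> = ln (norm (A s *v x)) + ln L" using L p by (simp add: ln_mult)
      finally have 2: "\<Lambda> x - \<Lambda> (A s *v x) \<le> ln L" by (simp add: \<Lambda>_def)
      from 1 2 show ?thesis by linarith
    qed
    then show ?thesis by blast
  qed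
  then obtain c where c: "\<And>s x. x \<noteq> 0 \<Longrightarrow> \<bar>\<Lambda> (A s *v x) - \<Lambda> x\<bar> \<le> c s" by metis
  have "\<bar>\<Lambda> (A s *v x) - \<Lambda> x\<bar> \<le> 1 + (\<Sum>s\<in>UNIV. \<bar>c s\<bar>)" if "x \<noteq> 0" for s x
    using c[OF that, of s] member_le_sum[of s UNIV "\<lambda>s. \<bar>c s\<bar>"] by simp
  moreover have "1 + (\<Sum>s\<in>UNIV. \<bar>c s\<bar>) > 0"
    by (simp add: add_pos_nonneg sum_nonneg)
  ultimately show ?thesis by blast
qed

definition C :: real where
  "C = (SOME C. C > 0 \<and> (\<forall>s x. x \<noteq> 0 \<longrightarrow> \<bar>\<Lambda> (A s *v x) - \<Lambda> x\<bar> \<le> C))"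

lemma C_pos: "C > 0"
  and \<Lambda>_step: "x \<noteq> 0 \<Longrightarrow> \<bar>\<Lambda> (A s *v x) - \<Lambda> x\<bar> \<le> C"
  using someI_ex[OF one_step_bound] unfolding C_def by auto

lemma Qn_Suc: "(Q ^^ Suc n) F s x = (\<Sum>t\<in>UNIV. trans_prob s t * (Q ^^ n) F t (A s *v x))"
  by (simp add: Q_def)

text \<open>Monotonicity on the states that can be reached: \<open>n\<close> steps move
  \<open>\<Lambda>\<close> by at most \<open>C n\<close>, which later justifies expanding exponentials under
  \<open>Q ^^ n\<close>, and they never lead to \<open>0\<close>, where \<open>\<Lambda>\<close> has the
  default value \<open>ln 0 = 0\<close>.\<close>

lemma Qn_mono:
  assumes "x \<noteq> 0"
    and "\<And>t y. y \<noteq> 0 \<Longrightarrow> \<bar>\<Lambda> y - \<Lambda> x\<bar> \<le> C * real n \<Longrightarrow> F t y \<le> G t y"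
  shows "(Q ^^ n) F s x \<le> (Q ^^ n) G s x"
  using assms
proof (induction n arbitrary: s x)
  case (Suc n)
  have "(Q ^^ n) F t (A s *v x) \<le> (Q ^^ n) G t (A s *v x)" for t
  proof (rule Suc.IH)
    fix t y
    assume y: "y \<noteq> 0" "\<bar>\<Lambda> y - \<Lambda> (A s *v x)\<bar> \<le> C * real n"
    have "\<bar>\<Lambda> y - \<Lambda> x\<bar> \<le> C * real n + C"
      using y(2) \<Lambda>_step[OF Suc.prems(1), of s] by linarith
    then show "F t y \<le> G t y"
      by (intro Suc.prems(2) y) (simp add: algebra_simps)
  qed (use Suc.prems in simp)
  then show ?case
    unfolding Qn_Suc by (intro sum_mono mult_left_mono) (auto intro: less_imp_le trans_prob_pos)
qed simp

lemma Qn_const [simp]: "(Q ^^ n) (\<lambda>t y. b) s x = b"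
proof (induction n arbitrary: s x)
  case (Suc n)
  have "(Q ^^ Suc n) (\<lambda>t y. b) s x = (\<Sum>t\<in>UNIV. trans_prob s t) * b"
    unfolding Qn_Suc Suc by (simp add: sum_distrib_right)
  then show ?case by (simp add: sum_trans_prob)
qed simp

lemma Qn_add: "(Q ^^ n) (\<lambda>t y. F t y + G t y) s x = (Q ^^ n) F s x + (Q ^^ n) G s x"
proof (induction n arbitrary: s x)
  case (Suc n)
  show ?case unfolding Qn_Suc Suc by (simp add: distrib_left sum.distrib)
qed simp

lemma Qn_cmult: "(Q ^^ n) (\<lambda>t y. a * F t y) s x = a * (Q ^^ n) F s x"
proof (induction n arbitrary: s x)
  case (Suc n)
  show ?case unfolding Qn_Suc Suc by (simp add: sum_distrib_left mult.left_commute)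
qed simp

lemma Qn_scale: "(Q ^^ n) F s (c *\<^sub>R x) = (Q ^^ n) (\<lambda>t y. F t (c *\<^sub>R y)) s x"
proof (induction n arbitrary: s x)
  case (Suc n)
  show ?case unfolding Qn_Suc matrix_vector_mult_scaleR Suc ..
qed simp

lemma \<Lambda>_scale: "c \<noteq> 0 \<Longrightarrow> x \<noteq> 0 \<Longrightarrow> \<Lambda> (c *\<^sub>R x) = ln \<bar>c\<bar> + \<Lambda> x"
  by (simp add: \<Lambda>_def ln_mult)

text \<open>The expected increase of \<open>ln \<parallel>x\<parallel>\<close> over \<open>n\<close> steps. It
  depends on \<open>x\<close> through its direction only (\<open>D_scale\<close>).\<close>

definition D :: "nat \<Rightarrow> 's \<Rightarrow> real^'d \<Rightarrow> real" where
  "D n s x = (Q ^^ n) (\<lambda>_. \<Lambda>) s x - \<Lambda> x"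

lemma D_bound:
  assumes "x \<noteq> 0"
  shows "\<bar>D n s x\<bar> \<le> C * real n"
proof -
  have "(Q ^^ n) (\<lambda>_. \<Lambda>) s x \<le> (Q ^^ n) (\<lambda>_ _. \<Lambda> x + C * real n) s x"
    using assms by (intro Qn_mono) auto
  moreover have "(Q ^^ n) (\<lambda>_ _. \<Lambda> x - C * real n) s x \<le> (Q ^^ n) (\<lambda>_. \<Lambda>) s x"
    using assms by (intro Qn_mono) auto
  ultimately show ?thesis by (simp add: D_def)
qed

lemma D_scale:
  assumes "c \<noteq> 0" "x \<noteq> 0"
  shows "D n s (c *\<^sub>R x) = D n s x"
proof -
  have "(Q ^^ n) (\<lambda>_. \<Lambda>) s (c *\<^sub>R x) = (Q ^^ n) (\<lambda>t y. ln \<bar>c\<bar> + \<Lambda> y) s x"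
    unfolding Qn_scale using assms
    by (intro antisym Qn_mono) (auto simp: \<Lambda>_scale)
  then show ?thesis
    using assms by (simp add: D_def Qn_add \<Lambda>_scale)
qed

section \<open>Exponential moments\<close>

lemma exp_le_quadratic:
  fixes u :: real
  assumes "\<bar>u\<bar> \<le> 1"
  shows "exp u \<le> 1 + u + u\<^sup>2"
proof (cases "u \<ge> 0")
  case True
  then show ?thesis using exp_bound[of u] assms by simp
next
  case False
  define v where "v = - u"
  have v: "0 < v" "v \<le> 1" using False assms by (auto simp: v_def)
  have "1 + v \<le> exp v" by simp
  then have "exp (- v) \<le> 1 / (1 + v)"
    using v by (simp add: exp_minus field_simps)
  also have "1 / (1 + v) \<le> 1 - v + v\<^sup>2"
  proof -
    have "(1 - v + v\<^sup>2) * (1 + v) = 1 + v * v\<^sup>2"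
      by (simp add: algebra_simps power2_eq_square)
    moreover have "v * v\<^sup>2 \<ge> 0" using v by simp
    ultimately show ?thesis using v by (simp add: divide_le_eq)
  qed
  finally show ?thesis by (simp add: v_def)
qed

text \<open>The drift enters to first order in \<open>\<theta>\<close> and the spread only to second order. So
  for small \<open>\<theta>\<close> a drift bound becomes a bound for the exponential moment with almost the
  same rate.\<close>

lemma exp_block_bound:
  assumes "\<bar>\<theta>\<bar> * (C * real N) \<le> 1" "x \<noteq> 0"
    and drift: "\<theta> * D N s x \<le> d"
  shows "(Q ^^ N) (\<lambda>t y. exp (\<theta> * \<Lambda> y)) s x \<le> exp (\<theta> * \<Lambda> x + (d + (\<theta> * (C * real N))\<^sup>2))"
proof -
  let ?q = "(\<theta> * (C * real N))\<^sup>2"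
  have "(Q ^^ N) (\<lambda>t y. exp (\<theta> * \<Lambda> y)) s x
      \<le> (Q ^^ N) (\<lambda>t y. exp (\<theta> * \<Lambda> x) * (\<theta> * \<Lambda> y + (1 - \<theta> * \<Lambda> x + ?q))) s x"
  proof (rule Qn_mono)
    fix t :: 's and y :: "real^'d"
    assume y: "\<bar>\<Lambda> y - \<Lambda> x\<bar> \<le> C * real N"
    let ?u = "\<theta> * (\<Lambda> y - \<Lambda> x)"
    have le: "\<bar>?u\<bar> \<le> \<bar>\<theta>\<bar> * (C * real N)"
      using y by (simp add: abs_mult mult_left_mono)
    have "exp ?u \<le> 1 + ?u + ?u\<^sup>2"
      using le assms(1) by (intro exp_le_quadratic) simp
    moreover have "?u\<^sup>2 \<le> ?q"
      using le C_pos by (subst abs_le_square_iff[symmetric]) (simp add: abs_mult)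
    ultimately have "exp ?u \<le> \<theta> * \<Lambda> y + (1 - \<theta> * \<Lambda> x + ?q)"
      by (simp add: algebra_simps)
    then have "exp (\<theta> * \<Lambda> x) * exp ?u
        \<le> exp (\<theta> * \<Lambda> x) * (\<theta> * \<Lambda> y + (1 - \<theta> * \<Lambda> x + ?q))"
      by (intro mult_left_mono) auto
    then show "exp (\<theta> * \<Lambda> y) \<le> exp (\<theta> * \<Lambda> x) * (\<theta> * \<Lambda> y + (1 - \<theta> * \<Lambda> x + ?q))"
      by (simp add: right_diff_distrib flip: exp_add)
  qed fact
  also have "\<dots> = exp (\<theta> * \<Lambda> x) * (1 + \<theta> * D N s x + ?q)"
    unfolding Qn_cmult Qn_add by (simp add: D_def algebra_simps)
  also have "\<dots> \<le> exp (\<theta> * \<Lambda> x) * exp (d + ?q)"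
  proof (rule mult_left_mono)
    show "1 + \<theta> * D N s x + ?q \<le> exp (d + ?q)"
      using exp_ge_add_one_self[of "d + ?q"] drift by linarith
  qed simp
  finally show ?thesis by (simp add: exp_add)
qed

text \<open>The Markov property multiplies the bounds for successive blocks; an incomplete block costs a
  factor of at most \<open>e\<close>.\<close>

lemma exp_moment_iterate:
  assumes small: "\<bar>\<theta>\<bar> * (C * real N) \<le> 1"
    and block: "\<And>s x. x \<noteq> 0 \<Longrightarrow>
      (Q ^^ N) (\<lambda>t y. exp (\<theta> * \<Lambda> y)) s x \<le> exp (\<theta> * \<Lambda> x + b)"
    and "r \<le> N" "x \<noteq> 0"
  shows "(Q ^^ (k * N + r)) (\<lambda>t y. exp (\<theta> * \<Lambda> y)) s x \<le> exp (\<theta> * \<Lambda> x + real k * b + 1)"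
  using \<open>x \<noteq> 0\<close>
proof (induction k arbitrary: s x)
  case 0
  have "(Q ^^ r) (\<lambda>t y. exp (\<theta> * \<Lambda> y)) s x \<le> (Q ^^ r) (\<lambda>t y. exp (\<theta> * \<Lambda> x + 1)) s x"
  proof (rule Qn_mono)
    fix t :: 's and y :: "real^'d"
    assume y: "\<bar>\<Lambda> y - \<Lambda> x\<bar> \<le> C * real r"
    have "\<bar>\<theta> * (\<Lambda> y - \<Lambda> x)\<bar> \<le> \<bar>\<theta>\<bar> * (C * real r)"
      using y by (simp add: abs_mult mult_left_mono)
    also have "\<dots> \<le> \<bar>\<theta>\<bar> * (C * real N)"
      using \<open>r \<le> N\<close> C_pos by (intro mult_left_mono) auto
    finally have "\<theta> * (\<Lambda> y - \<Lambda> x) \<le> 1" using small by linarith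
    then show "exp (\<theta> * \<Lambda> y) \<le> exp (\<theta> * \<Lambda> x + 1)"
      by (simp add: right_diff_distrib)
  qed fact
  then show ?case by simp
next
  case (Suc k)
  have "(Q ^^ (Suc k * N + r)) (\<lambda>t y. exp (\<theta> * \<Lambda> y)) s x
      = (Q ^^ N) ((Q ^^ (k * N + r)) (\<lambda>t y. exp (\<theta> * \<Lambda> y))) s x"
    by (simp add: add.assoc funpow_add)
  also have "\<dots> \<le> (Q ^^ N) (\<lambda>t y. exp (real k * b + 1) * exp (\<theta> * \<Lambda> y)) s x"
    using Suc by (intro Qn_mono) (simp_all add: add_ac flip: exp_add)
  also have "\<dots> \<le> exp (real k * b + 1) * exp (\<theta> * \<Lambda> x + b)"
    unfolding Qn_cmult using block Suc.prems by (intro mult_left_mono) auto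
  also have "\<dots> = exp (\<theta> * \<Lambda> x + real (Suc k) * b + 1)"
    by (simp add: algebra_simps flip: exp_add)
  finally show ?case .
qed

text \<open>A drift bound over a single block length, uniform in the starting point, controls exponential
  moments for all times. Taking \<open>\<sigma> = 1\<close> bounds deviations upwards, \<open>\<sigma> =
  -1\<close> deviations downwards.\<close>

lemma chernoff:
  assumes \<sigma>: "\<bar>\<sigma>\<bar> = 1" and "N > 0" and "\<epsilon> > 0"
    and drift: "\<And>s x. x \<noteq> 0 \<Longrightarrow> \<sigma> * D N s x \<le> real N * a"
  obtains \<theta> K where "\<theta> > 0" "K > 0"
    "\<And>n s x. x \<noteq> 0 \<Longrightarrow> (Q ^^ n) (\<lambda>t y. exp (\<theta> * (\<sigma> * \<Lambda> y))) s x
      \<le> K * exp (\<theta> * (\<sigma> * \<Lambda> x + real n * (a + \<epsilon>)))"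
proof -
  \<comment> \<open>The first term makes \<open>exp_le_quadratic\<close> applicable, the second keeps the
    quadratic error below \<open>\<theta> N \<epsilon>\<close>.\<close>
  define \<theta> where "\<theta> = min (1 / (C * real N)) (\<epsilon> / (C\<^sup>2 * real N))"
  define b where "b = \<theta> * real N * (a + \<epsilon>)"
  have CN: "C * real N > 0" using C_pos \<open>N > 0\<close> by simp
  have \<theta>: "\<theta> > 0" using CN C_pos assms by (simp add: \<theta>_def)
  have small: "\<bar>\<theta> * \<sigma>\<bar> * (C * real N) \<le> 1"
  proof -
    have "\<theta> \<le> 1 / (C * real N)" by (simp add: \<theta>_def)
    then show ?thesis using \<sigma> \<theta> CN by (simp add: abs_mult field_simps)
  qed
  have quad: "(\<theta> * \<sigma> * (C * real N))\<^sup>2 \<le> \<theta> * real N * \<epsilon>"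
  proof -
    have "\<theta> \<le> \<epsilon> / (C\<^sup>2 * real N)" by (simp add: \<theta>_def)
    then have "\<theta> * (C\<^sup>2 * real N) \<le> \<epsilon>" using C_pos \<open>N > 0\<close> by (simp add: field_simps)
    then have "(\<theta> * real N) * (\<theta> * (C\<^sup>2 * real N)) \<le> (\<theta> * real N) * \<epsilon>"
      using \<theta> by (intro mult_left_mono) auto
    moreover have "(\<theta> * \<sigma> * (C * real N))\<^sup>2 = \<sigma>\<^sup>2 * ((\<theta> * real N) * (\<theta> * (C\<^sup>2 * real N)))"
      by (simp add: power2_eq_square mult_ac)
    moreover have "\<sigma>\<^sup>2 = 1" using \<sigma> by (metis power2_abs power_one)
    ultimately show ?thesis by simp
  qed
  have block: "(Q ^^ N) (\<lambda>t y. exp (\<theta> * \<sigma> * \<Lambda> y)) s x \<le> exp (\<theta> * \<sigma> * \<Lambda> x + b)"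
    if "x \<noteq> 0" for s x
  proof -
    have "\<theta> * \<sigma> * D N s x \<le> \<theta> * real N * a"
      using mult_left_mono[OF drift[OF that, of s], of \<theta>] \<theta> by (simp add: mult_ac)
    from exp_block_bound[OF small that this] show ?thesis
    proof (rule order_trans)
      show "exp (\<theta> * \<sigma> * \<Lambda> x + (\<theta> * real N * a + (\<theta> * \<sigma> * (C * real N))\<^sup>2))
          \<le> exp (\<theta> * \<sigma> * \<Lambda> x + b)"
        using quad by (simp add: b_def algebra_simps)
    qed
  qed
  define K where "K = exp (1 + \<bar>b\<bar>)"
  have "(Q ^^ n) (\<lambda>t y. exp (\<theta> * (\<sigma> * \<Lambda> y))) s x
      \<le> K * exp (\<theta> * (\<sigma> * \<Lambda> x + real n * (a + \<epsilon>)))" if "x \<noteq> 0" for n s x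
  proof -
    let ?k = "n div N"
    have "(Q ^^ (?k * N + n mod N)) (\<lambda>t y. exp (\<theta> * \<sigma> * \<Lambda> y)) s x
        \<le> exp (\<theta> * \<sigma> * \<Lambda> x + real ?k * b + 1)"
      using exp_moment_iterate[OF small block _ that, where r = "n mod N" and k = ?k and s = s] \<open>N > 0\<close>
      by (simp add: less_imp_le)
    moreover have "real ?k * b \<le> real n * (\<theta> * (a + \<epsilon>)) + \<bar>b\<bar>"
    proof -
      have n: "real n = real ?k * real N + real (n mod N)"
        by (metis div_mult_mod_eq of_nat_add of_nat_mult)
      have "\<bar>real (n mod N) * (\<theta> * (a + \<epsilon>))\<bar> \<le> \<bar>b\<bar>"
      proof -
        have "real (n mod N) * \<bar>\<theta> * (a + \<epsilon>)\<bar> \<le> real N * \<bar>\<theta> * (a + \<epsilon>)\<bar>"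
          using \<open>N > 0\<close> by (intro mult_right_mono) (auto intro: less_imp_le)
        then show ?thesis by (simp add: b_def abs_mult mult_ac)
      qed
      then have "- (real (n mod N) * (\<theta> * (a + \<epsilon>))) \<le> \<bar>b\<bar>" by linarith
      moreover have "real n * (\<theta> * (a + \<epsilon>)) = real ?k * b + real (n mod N) * (\<theta> * (a + \<epsilon>))"
        by (subst n) (simp add: b_def algebra_simps)
      ultimately show ?thesis by linarith
    qed
    then have "exp (\<theta> * \<sigma> * \<Lambda> x + real ?k * b + 1)
        \<le> K * exp (\<theta> * (\<sigma> * \<Lambda> x + real n * (a + \<epsilon>)))"
      by (simp add: K_def algebra_simps flip: exp_add)
    ultimately show ?thesis by (simp add: mult.assoc)
  qed
  with \<theta> show ?thesis by (intro that[of \<theta> K]) (auto simp: K_def)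
qed

section \<open>The minimal growth rate\<close>

definition inf_D :: "nat \<Rightarrow> real" where
  "inf_D n = (INF (s, x) \<in> UNIV \<times> {x. norm x = 1}. D n s x)"

text \<open>The best growth rate that is guaranteed in expectation from every starting point. It turns out to
  be the Lyapunov exponent.\<close>

definition \<beta> :: real where
  "\<beta> = (SUP n\<in>{1..}. inf_D n / real n)"

lemma unit_vector_exists: "\<exists>x :: real^'d. norm x = 1"
  using norm_axis_1 by blast

lemma unit_nonzero: "norm x = 1 \<Longrightarrow> x \<noteq> (0 :: real^'d)"
  by auto

lemma inf_D_bdd: "bdd_below ((\<lambda>(s, x). D n s x) ` (UNIV \<times> {x. norm x = 1}))"
proof (rule bdd_belowI2[where m = "- (C * real n)"])
  fix p :: "'s \<times> (real^'d)" assume "p \<in> UNIV \<times> {x. norm x = 1}"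
  then obtain s x where "p = (s, x)" "norm x = 1" by auto
  then show "- (C * real n) \<le> (case p of (s, x) \<Rightarrow> D n s x)"
    using D_bound[of x n s] unit_nonzero[of x] by auto
qed

lemma inf_D_le:
  assumes "x \<noteq> 0"
  shows "inf_D n \<le> D n s x"
proof -
  let ?u = "(1 / norm x) *\<^sub>R x"
  have "inf_D n \<le> (case (s, ?u) of (s, x) \<Rightarrow> D n s x)"
    unfolding inf_D_def using assms by (intro cINF_lower inf_D_bdd) auto
  then show ?thesis using assms D_scale[of "1 / norm x" x n s] by simp
qed

lemma inf_D_approx:
  assumes "e > 0"
  obtains s x where "norm x = 1" "D n s x < inf_D n + e"
proof -
  have "\<exists>p\<in>UNIV \<times> {x. norm x = 1}. (case p of (s, x) \<Rightarrow> D n s x) < inf_D n + e"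
  proof (subst cINF_less_iff[symmetric])
    show "UNIV \<times> {x :: real^'d. norm x = 1} \<noteq> {}" using unit_vector_exists by auto
    show "(INF p\<in>UNIV \<times> {x. norm x = 1}. case p of (s, x) \<Rightarrow> D n s x) < inf_D n + e"
      using assms by (simp add: inf_D_def)
  qed (rule inf_D_bdd)
  then show ?thesis using that by auto
qed

lemma inf_D_le_\<beta>:
  assumes "n \<ge> 1"
  shows "inf_D n \<le> real n * \<beta>"
proof -
  obtain x :: "real^'d" where x: "norm x = 1" using unit_vector_exists by blast
  have "inf_D n / real n \<le> C" if "n \<ge> 1" for n
  proof -
    have "inf_D n \<le> C * real n"
      using inf_D_le[of x n undefined] D_bound[of x n undefined] unit_nonzero[OF x] by linarith
    then show ?thesis using that by (simp add: field_simps)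
  qed
  then have "bdd_above ((\<lambda>n. inf_D n / real n) ` {1..})"
    by (intro bdd_aboveI2[where M = C]) auto
  then have "inf_D n / real n \<le> \<beta>"
    unfolding \<beta>_def using assms by (intro cSUP_upper) auto
  then show ?thesis using assms by (simp add: field_simps)
qed

lemma block_near_\<beta>:
  assumes "\<epsilon> > 0"
  obtains N where "N > 0" "\<And>s x. x \<noteq> 0 \<Longrightarrow> D N s x \<ge> real N * (\<beta> - \<epsilon>)"
proof -
  have "\<exists>N\<in>{1..}. \<beta> - \<epsilon> < inf_D N / real N"
  proof (rule ccontr)
    assume "\<not> ?thesis"
    then have "\<beta> \<le> \<beta> - \<epsilon>"
      unfolding \<beta>_def by (intro cSUP_least) (auto simp: not_less \<beta>_def)
    with assms show False by simp
  qed
  then obtain N where N: "N \<ge> 1" "\<beta> - \<epsilon> < inf_D N / real N" by auto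
  then have "real N * (\<beta> - \<epsilon>) \<le> inf_D N" by (simp add: field_simps)
  then show ?thesis using N inf_D_le by (intro that[of N]) (auto intro: order_trans)
qed

lemma chernoff_lower:
  assumes "\<epsilon> > 0"
  obtains \<theta> K where "\<theta> > 0" "K > 0"
    "\<And>n s x. x \<noteq> 0 \<Longrightarrow> (Q ^^ n) (\<lambda>t y. exp (- \<theta> * (\<Lambda> y - real n * (\<beta> - \<epsilon>)))) s x
      \<le> K * exp (- \<theta> * \<Lambda> x)"
proof -
  obtain N where N: "N > 0" "\<And>s x. x \<noteq> 0 \<Longrightarrow> D N s x \<ge> real N * (\<beta> - \<epsilon> / 2)"
    using block_near_\<beta>[of "\<epsilon> / 2"] assms by auto
  obtain \<theta> K where tk: "\<theta> > 0" "K > 0"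
    "\<And>n s x. x \<noteq> 0 \<Longrightarrow> (Q ^^ n) (\<lambda>t y. exp (\<theta> * (- 1 * \<Lambda> y))) s x
      \<le> K * exp (\<theta> * (- 1 * \<Lambda> x + real n * (- (\<beta> - \<epsilon> / 2) + \<epsilon> / 2)))"
  proof (rule chernoff[of "- 1" N "\<epsilon> / 2" "- (\<beta> - \<epsilon> / 2)"])
    show "- 1 * D N s x \<le> real N * - (\<beta> - \<epsilon> / 2)" if "x \<noteq> 0" for s x
      using N(2)[OF that, of s] by (simp add: algebra_simps)
  qed (use N assms in auto)
  have "(Q ^^ n) (\<lambda>t y. exp (- \<theta> * (\<Lambda> y - real n * (\<beta> - \<epsilon>)))) s x \<le> K * exp (- \<theta> * \<Lambda> x)"
    if "x \<noteq> 0" for n s x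
  proof -
    let ?a = "\<theta> * (real n * (\<beta> - \<epsilon>))"
    have "(Q ^^ n) (\<lambda>t y. exp (- \<theta> * (\<Lambda> y - real n * (\<beta> - \<epsilon>)))) s x
        = exp ?a * (Q ^^ n) (\<lambda>t y. exp (\<theta> * (- 1 * \<Lambda> y))) s x"
      unfolding Qn_cmult[symmetric] by (simp add: algebra_simps flip: exp_add)
    also have "\<dots> \<le> exp ?a * (K * exp (\<theta> * (- 1 * \<Lambda> x + real n * (- (\<beta> - \<epsilon> / 2) + \<epsilon> / 2))))"
      using tk(3)[OF that] by (intro mult_left_mono) auto
    also have "\<dots> = K * (exp ?a * exp (\<theta> * (- 1 * \<Lambda> x + real n * (- (\<beta> - \<epsilon> / 2) + \<epsilon> / 2))))"
      by simp
    also have "\<dots> = K * exp (- \<theta> * \<Lambda> x)"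
      unfolding exp_add[symmetric] by (simp add: algebra_simps)
    finally show ?thesis .
  qed
  with tk show ?thesis by (intro that[of \<theta> K]) auto
qed

section \<open>Irreducibility in quantitative form\<close>

definition run :: "'s list \<Rightarrow> real^'d \<Rightarrow> real^'d" where
  "run w x = fold (\<lambda>s y. A s *v y) w x"

lemma run_simps [simp]: "run [] x = x" "run (s # w) x = run w (A s *v x)"
  by (simp_all add: run_def)

lemma linear_run: "linear (run w)"
proof (induction w)
  case Nil
  show ?case by (simp add: run_def linear_iff)
next
  case (Cons s w)
  have "run (s # w) = run w \<circ> (*v) (A s)" by (simp add: fun_eq_iff)
  moreover have "linear (run w \<circ> (*v) (A s))"
    by (intro linear_compose Cons) simp
  ultimately show ?case by (simp only:)
qed

lemma run_nonzero [simp]: "run w x = 0 \<longleftrightarrow> x = 0"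
  by (induction w arbitrary: x) auto

text \<open>An invertible matrix that maps a subspace into itself maps it onto itself, so an invariant
  subspace would be a one-element family of the kind that strong irreducibility excludes.\<close>

lemma irreducible_subspace:
  assumes U: "subspace U" "U \<noteq> {0}" and inv: "\<And>s. (*v) (A s) ` U \<subseteq> U"
  shows "U = UNIV"
proof (rule ccontr)
  assume "U \<noteq> UNIV"
  have A_image: "(*v) (A s) ` U = U" for s
  proof (rule subspace_dim_equal)
    show "subspace ((*v) (A s) ` U)"
      using U by (intro linear_subspace_image) simp_all
    have "inj ((*v) (A s))"
      using invertible_A[of s] by (intro inj_matrix_vector_mult)
    then have "dim ((*v) (A s) ` U) = dim U"
      by (intro dim_image_eq) (auto intro: inj_on_subset)
    then show "dim U \<le> dim ((*v) (A s) ` U)" by simp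
  qed (use U inv in auto)
  have "(*v) (lrds M n \<omega>) ` U = U" for n \<omega>
  proof (induction n)
    case (Suc n)
    have "(*v) (lrds M (Suc n) \<omega>) ` U = (*v) (A (\<omega> n)) ` ((*v) (lrds M n \<omega>) ` U)"
      unfolding image_image lrds_Suc_mult ..
    then show ?case using Suc A_image by simp
  qed simp
  then have "\<exists>\<V>. finite \<V> \<and> \<V> \<noteq> {} \<and> (\<forall>V\<in>\<V>. subspace V \<and> V \<noteq> {0} \<and> V \<noteq> UNIV) \<and>
      (\<forall>B \<in> {lrds M n \<omega> | n \<omega>. True}. (*v) B ` \<Union>\<V> = \<Union>\<V>)"
    using U \<open>U \<noteq> UNIV\<close> by (intro exI[of _ "{U}"]) auto
  then show False using irreducible by (simp add: strongly_irreducible_def)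
qed

lemma opnorm_bound: "norm (B *v x) \<le> opnorm B * norm x"
  unfolding opnorm_def by (rule onorm) simp

lemma opnorm_le_norm: "opnorm B \<le> real CARD('d) * norm B" for B :: "real^'d^'d"
  unfolding opnorm_def
proof (rule onorm_le)
  fix x
  have "norm (B *v x) \<le> (\<Sum>i\<in>UNIV. \<bar>(B *v x) $ i\<bar>)"
    by (rule norm_le_l1_cart)
  also have "\<dots> \<le> (\<Sum>i\<in>(UNIV :: 'd set). norm B * norm x)"
  proof (rule sum_mono)
    fix i
    have "\<bar>(B *v x) $ i\<bar> \<le> norm (B $ i) * norm x"
      using Cauchy_Schwarz_ineq2[of "B $ i" x] by (simp add: matrix_mult_dot)
    also have "\<dots> \<le> norm B * norm x"
      using Finite_Cartesian_Product.norm_nth_le[of B i] by (intro mult_right_mono) auto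
    finally show "\<bar>(B *v x) $ i\<bar> \<le> norm B * norm x" .
  qed
  finally show "norm (B *v x) \<le> real CARD('d) * norm B * norm x" by simp
qed

text \<open>The vectors whose orbits are annihilated by a matrix \<open>B\<close> form an invariant subspace.
  If it contains the nonzero vector \<open>A s *v x\<close>, irreducibility forces \<open>B = 0\<close>.
  Compactness of the spheres of vectors and matrices turns this into a uniform bound with words of bounded
  length.\<close>

lemma spanning_unit:
  "\<exists>N. \<forall>x (B :: real^'d^'d). norm x = 1 \<longrightarrow> norm B = 1 \<longrightarrow>
    (\<exists>w. length w \<le> N \<and> norm (B *v run w (A s *v x)) \<ge> 1 / real (Suc N))"
proof (rule ccontr)
  assume neg: "\<not> ?thesis"
  have ex: "\<exists>x (B :: real^'d^'d). norm x = 1 \<and> norm B = 1 \<and>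
      (\<forall>w. length w \<le> N \<longrightarrow> norm (B *v run w (A s *v x)) < 1 / real (Suc N))" for N
  proof -
    obtain x and B :: "real^'d^'d" where xB: "norm x = 1" "norm B = 1"
      and none: "\<not> (\<exists>w. length w \<le> N \<and> norm (B *v run w (A s *v x)) \<ge> 1 / real (Suc N))"
      using neg by blast
    have "norm (B *v run w (A s *v x)) < 1 / real (Suc N)" if "length w \<le> N" for w
      using none that by (meson not_le)
    with xB show ?thesis by blast
  qed
  obtain X and Y :: "nat \<Rightarrow> real^'d^'d" where XY: "\<And>N. norm (X N) = 1" "\<And>N. norm (Y N) = 1"
      "\<And>N w. length w \<le> N \<Longrightarrow> norm (Y N *v run w (A s *v X N)) < 1 / real (Suc N)"
    using ex by metis
  \<comment> \<open>A limit of counterexamples is a matrix of norm 1 that annihilates the whole orbit of a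
    unit vector.\<close>
  have cpt: "compact (sphere (0 :: real^'d) 1 \<times> sphere (0 :: real^'d^'d) 1)"
    by (intro compact_Times compact_sphere)
  have mem: "\<forall>n. (X n, Y n) \<in> sphere 0 1 \<times> sphere 0 1"
    by (simp add: XY)
  obtain l r where l: "l \<in> sphere 0 1 \<times> sphere 0 1" and r: "strict_mono r"
    and lim: "((\<lambda>n. (X n, Y n)) \<circ> r) \<longlonglongrightarrow> l"
    using cpt[unfolded compact_def, THEN spec, of "\<lambda>n. (X n, Y n)", THEN mp, OF mem] by (elim bexE exE conjE)
  define x B where "x = fst l" and "B = snd l"
  have x: "norm x = 1" and B: "norm B = 1" using l by (auto simp: x_def B_def)
  have X: "(\<lambda>n. X (r n)) \<longlonglongrightarrow> x" and Y: "(\<lambda>n. Y (r n)) \<longlonglongrightarrow> B"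
    using tendsto_fst[OF lim] tendsto_snd[OF lim] by (simp_all add: x_def B_def o_def)
  have zero: "B *v run w (A s *v x) = 0" for w
  proof -
    let ?g = "\<lambda>n. Y (r n) *v run w (A s *v X (r n))"
    have bl: "bounded_linear (\<lambda>x. run w (A s *v x))"
    proof -
      have "(\<lambda>x. run w (A s *v x)) = run (s # w)" by (simp add: fun_eq_iff)
      then show ?thesis
        using linear_run[of "s # w"] by (simp only: linear_conv_bounded_linear)
    qed
    have "(\<lambda>n. run w (A s *v X (r n))) \<longlonglongrightarrow> run w (A s *v x)"
      using bounded_linear.tendsto[OF bl X] .
    then have "?g \<longlonglongrightarrow> B *v run w (A s *v x)"
      using Y by (intro vec_tendstoI) (simp add: matrix_mult_dot tendsto_inner tendsto_vec_nth)
    moreover have "?g \<longlonglongrightarrow> 0"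
    proof (rule Lim_null_comparison)
      have "(\<lambda>n. 1 / real (Suc n)) \<longlonglongrightarrow> 0"
        using LIMSEQ_Suc[OF lim_1_over_n[where 'a = real]] .
      then show "(\<lambda>n. 1 / real (Suc (r n))) \<longlonglongrightarrow> 0"
        using LIMSEQ_subseq_LIMSEQ[OF _ r] by (simp add: o_def)
      show "\<forall>\<^sub>F n in sequentially. norm (?g n) \<le> 1 / real (Suc (r n))"
      proof (rule eventually_sequentiallyI[of "length w"])
        fix n assume "length w \<le> n"
        then have "length w \<le> r n" using seq_suble[OF r, of n] by linarith
        from XY(3)[OF this] show "norm (?g n) \<le> 1 / real (Suc (r n))" by simp
      qed
    qed
    ultimately show ?thesis by (rule LIMSEQ_unique)
  qed
  define U where "U = {y. \<forall>w. B *v run w y = 0}"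
  have "U = UNIV"
  proof (rule irreducible_subspace)
    have lin: "linear (\<lambda>y. B *v run w y)" for w
      using linear_compose[OF linear_run matrix_vector_mul_linear[of B], of w] by (simp only: o_def)
    show "subspace U"
      unfolding U_def Collect_all_eq
    proof (rule subspace_Inter, clarify)
      show "subspace {y. B *v run w y = 0}" for w
        using linear_subspace_kernel[OF lin[of w]] .
    qed
    have "A s *v x \<in> U" using zero by (simp add: U_def)
    moreover have "A s *v x \<noteq> 0" using unit_nonzero[OF x] by simp
    ultimately show "U \<noteq> {0}" by auto
    show "(*v) (A t) ` U \<subseteq> U" for t
    proof clarify
      fix y assume y: "y \<in> U"
      have "B *v run w (A t *v y) = 0" for w
        using y unfolding U_def mem_Collect_eq by (metis run_simps(2))
      then show "A t *v y \<in> U" by (simp add: U_def)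
    qed
  qed
  then have "B *v y = 0" for y
  proof -
    have "y \<in> U" using \<open>U = UNIV\<close> by simp
    then have "B *v run [] y = 0" unfolding U_def by blast
    then show ?thesis by simp
  qed
  then have "B = 0" by (simp add: matrix_eq)
  with B show False by simp
qed

lemma spanning:
  obtains N c where "c > 0"
    "\<And>s x (B :: real^'d^'d). norm x = 1 \<Longrightarrow> \<exists>w. length w \<le> N \<and> c * opnorm B \<le> norm (B *v run w (A s *v x))"
proof -
  obtain N where N: "\<And>s x (B :: real^'d^'d). norm x = 1 \<Longrightarrow> norm B = 1 \<Longrightarrow>
      \<exists>w. length w \<le> N s \<and> norm (B *v run w (A s *v x)) \<ge> 1 / real (Suc (N s))"
    using spanning_unit by metis
  define N0 where "N0 = Max (range N)"
  have N0: "N s \<le> N0" for s by (simp add: N0_def)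
  define c where "c = 1 / (real (Suc N0) * real CARD('d))"
  have "\<exists>w. length w \<le> N0 \<and> c * opnorm B \<le> norm (B *v run w (A s *v x))"
    if x: "norm x = 1" for s x and B :: "real^'d^'d"
  proof (cases "B = 0")
    case True
    have "opnorm B \<le> 0" using opnorm_le_norm[of B] True by simp
    then have "c * opnorm B \<le> 0" by (intro mult_nonneg_nonpos) (auto simp: c_def)
    then show ?thesis by (intro exI[of _ "[]"]) (auto intro: order_trans)
  next
    case False
    let ?B = "(1 / norm B) *\<^sub>R B"
    obtain w where w: "length w \<le> N s" "norm (?B *v run w (A s *v x)) \<ge> 1 / real (Suc (N s))"
      using N[OF x, of ?B] False by auto
    have "c * opnorm B \<le> c * (real CARD('d) * norm B)"
      using opnorm_le_norm[of B] by (intro mult_left_mono) (auto simp: c_def)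
    also have "\<dots> = norm B * (1 / real (Suc N0))" by (simp add: c_def)
    also have "\<dots> \<le> norm B * (1 / real (Suc (N s)))"
      using N0[of s] by (intro mult_left_mono) (auto simp: frac_le)
    also have "\<dots> \<le> norm B * norm (?B *v run w (A s *v x))"
      using w by (intro mult_left_mono) auto
    also have "\<dots> = norm (B *v run w (A s *v x))"
      using False by (simp add: scaleR_matrix_vector_assoc[symmetric])
    finally show ?thesis using w N0[of s] by (intro exI[of _ w]) auto
  qed
  moreover have "c > 0" by (simp add: c_def)
  ultimately show ?thesis using that by blast
qed

definition pmin :: real where
  "pmin = Min (range (\<lambda>(s, t). trans_prob s t))"

lemma pmin_pos: "pmin > 0"
  unfolding pmin_def by (subst Min_gr_iff) (auto simp: trans_prob_pos)

lemma pmin_le: "pmin \<le> trans_prob s t"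
  unfolding pmin_def by (rule Min_le) (auto intro!: image_eqI[of _ _ "(s, t)"])

lemma pmin_le_1: "pmin \<le> 1"
proof -
  fix s t :: 's
  have "trans_prob s t \<le> (\<Sum>t\<in>UNIV. trans_prob s t)"
    by (rule member_le_sum) (auto intro: less_imp_le trans_prob_pos)
  then show ?thesis using pmin_le[of s t] sum_trans_prob[of s] by linarith
qed

text \<open>Keeping a single path in the expectation of a nonnegative function costs a factor
  \<open>pmin\<close> per step.\<close>

lemma path_lower_bound:
  assumes H: "\<And>t y. y \<noteq> 0 \<Longrightarrow> H t y \<ge> 0" and "x \<noteq> 0"
  shows "pmin ^ length w * H t (run w x) \<le> (Q ^^ length w) H (hd (w @ [t])) x"
  using \<open>x \<noteq> 0\<close>
proof (induction w arbitrary: x)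
  case (Cons s w)
  let ?t = "hd (w @ [t])"
  have nonneg: "(Q ^^ length w) H u (A s *v x) \<ge> 0" for u
    using Qn_mono[of "A s *v x" "length w" "\<lambda>_ _. 0" H u] H Cons.prems by simp
  have "pmin ^ length (s # w) * H t (run (s # w) x) = pmin * (pmin ^ length w * H t (run w (A s *v x)))"
    by simp
  also have "\<dots> \<le> pmin * (Q ^^ length w) H ?t (A s *v x)"
    using Cons pmin_pos by (intro mult_left_mono) auto
  also have "\<dots> \<le> trans_prob s ?t * (Q ^^ length w) H ?t (A s *v x)"
    using pmin_le nonneg by (intro mult_right_mono) auto
  also have "\<dots> \<le> (Q ^^ length (s # w)) H s x"
    unfolding length_Cons Qn_Suc using nonneg
    by (intro member_le_sum) (auto intro: mult_nonneg_nonneg less_imp_le trans_prob_pos)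
  finally show ?case by simp
qed simp

section \<open>The minimal growth rate is the Lyapunov exponent\<close>

lemma prob_UNIV [simp]: "prob UNIV = 1"
  using prob_space by simp

lemma Qn_commute: "(Q ^^ m) ((Q ^^ n) F) = (Q ^^ n) ((Q ^^ m) F)"
proof -
  have "(Q ^^ m \<circ> Q ^^ n) F = (Q ^^ n \<circ> Q ^^ m) F"
    unfolding funpow_add[symmetric] by (simp only: add.commute)
  then show ?thesis by (simp only: o_apply)
qed

text \<open>An exponential moment of \<open>- \<theta> u\<close> bounds the negative part of \<open>u\<close>,
  so the positive part is controlled by the mean.\<close>

lemma positive_part_le:
  fixes u \<theta> :: real
  assumes "\<theta> > 0"
  shows "max 0 u \<le> u + exp (- \<theta> * u) / \<theta>"
proof (cases "u \<ge> 0")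
  case True
  then show ?thesis using assms by (simp add: max_def)
next
  case False
  have "- \<theta> * u \<le> exp (- \<theta> * u)"
    using exp_ge_add_one_self[of "- \<theta> * u"] by linarith
  then have "- u \<le> exp (- \<theta> * u) / \<theta>"
    using assms by (simp add: field_simps)
  then show ?thesis using False by (simp add: max_def)
qed

lemma integral_le_of_Q:
  assumes "\<And>s. (Q ^^ n) F s x \<le> b"
  shows "(\<integral>\<omega>. F (\<omega> n) (lrds M n \<omega> *v x) \<partial>P) \<le> b"
proof -
  have "(\<integral>\<omega>. F (\<omega> n) (lrds M n \<omega> *v x) \<partial>P) \<le> (\<Sum>s\<in>UNIV. stat s * b)"
    unfolding integral_eq_Q using assms
    by (intro sum_mono mult_left_mono) (auto intro: less_imp_le stat_pos)
  then show ?thesis by (simp add: sum_stat flip: sum_distrib_right)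
qed

lemma opnorm_lrds_pos: "opnorm (lrds M n \<omega>) > 0"
proof -
  obtain x :: "real^'d" where x: "norm x = 1" using unit_vector_exists by blast
  then have "0 < norm (lrds M n \<omega> *v x)" using unit_nonzero[OF x] by simp
  also have "\<dots> \<le> opnorm (lrds M n \<omega>)" using opnorm_bound[of "lrds M n \<omega>" x] x by simp
  finally show ?thesis .
qed

text \<open>The growth of the norm cannot exceed the smallest growth from a single starting point. At an
  almost minimal starting point \<open>(s, x)\<close> the mean of \<open>ln
  \<parallel>\<phi>(n,\<omega>)x\<parallel>\<close> is at most \<open>n (\<beta> + \<epsilon>)\<close>, and
  its downward deviations from \<open>n (\<beta> - \<epsilon>)\<close> contribute only a constant, so the
  positive part of the difference has mean at most \<open>2 \<epsilon> n\<close> plus a constant. Up to the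
  factor \<open>pmin\<close> per step this bound is inherited by the vectors reached from \<open>x\<close> by
  words of bounded length, and on one of these vectors one sees a fixed fraction of the norm of
  \<open>\<phi>(n,\<omega>)\<close>. It is essential that \<open>L\<close> does not depend on
  \<open>\<epsilon>\<close>.\<close>

lemma excess_bound:
  "\<exists>L>0. \<forall>\<epsilon>>0. \<exists>K. \<forall>n\<ge>1.
    (\<integral>\<omega>. max 0 (ln (opnorm (lrds M n \<omega>)) - real n * (\<beta> - \<epsilon>)) \<partial>P) \<le> L * (\<epsilon> * real n) + K"
proof -
  obtain N c where c: "c > 0" and span:
    "\<And>s x (B :: real^'d^'d). norm x = 1 \<Longrightarrow>
      \<exists>w. length w \<le> N \<and> c * opnorm B \<le> norm (B *v run w (A s *v x))"
    by (rule spanning) (rule that)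
  define W where "W = {w :: 's list. length w \<le> N}"
  have W: "finite W" "[] \<in> W"
    using finite_lists_length_le[of "UNIV :: 's set" N] by (auto simp: W_def)
  define q where "q = pmin ^ Suc N"
  have q: "q > 0" using pmin_pos by (simp add: q_def)
  define L where "L = real (card W) * 2 / q"
  have "card W > 0" using W by (subst card_gt_0_iff) auto
  then have "L > 0" using q by (simp add: L_def)
  moreover have "\<exists>K. \<forall>n\<ge>1.
    (\<integral>\<omega>. max 0 (ln (opnorm (lrds M n \<omega>)) - real n * (\<beta> - \<epsilon>)) \<partial>P) \<le> L * (\<epsilon> * real n) + K"
    if \<epsilon>: "\<epsilon> > 0" for \<epsilon>
  proof -
    obtain \<theta> K0 where tk: "\<theta> > 0" "K0 > 0"
      "\<And>n s x. x \<noteq> 0 \<Longrightarrow> (Q ^^ n) (\<lambda>t y. exp (- \<theta> * (\<Lambda> y - real n * (\<beta> - \<epsilon>)))) s x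
        \<le> K0 * exp (- \<theta> * \<Lambda> x)"
      by (rule chernoff_lower[OF \<epsilon>]) (rule that)
    define K where "K = \<bar>ln c\<bar> + real (card W) * ((K0 / \<theta> + C * real (Suc N)) / q)"
    have "(\<integral>\<omega>. max 0 (ln (opnorm (lrds M n \<omega>)) - real n * (\<beta> - \<epsilon>)) \<partial>P) \<le> L * (\<epsilon> * real n) + K"
      if n: "n \<ge> 1" for n
    proof -
      define pos where "pos = (\<lambda>(t :: 's) y. max 0 (\<Lambda> y - real n * (\<beta> - \<epsilon>)))"
      define b where "b = (2 * \<epsilon> * real n + K0 / \<theta> + C * real (Suc N)) / q"
      have "real n * \<epsilon> > 0" using n \<epsilon> by simp
      then obtain s x where x: "norm x = 1" and near: "D n s x < inf_D n + real n * \<epsilon>"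
        by (rule inf_D_approx) (rule that)
      have x0: "x \<noteq> 0" using unit_nonzero[OF x] .
      have \<Lambda>x: "\<Lambda> x = 0" using x by (simp add: \<Lambda>_def)
      have start: "(Q ^^ n) pos s x \<le> 2 * \<epsilon> * real n + K0 / \<theta>"
      proof -
        have "(Q ^^ n) pos s x \<le> (Q ^^ n) (\<lambda>t y. (\<Lambda> y + - real n * (\<beta> - \<epsilon>))
            + 1 / \<theta> * exp (- \<theta> * (\<Lambda> y - real n * (\<beta> - \<epsilon>)))) s x"
        proof (rule Qn_mono[OF x0])
          fix t :: 's and y
          show "pos t y \<le> (\<Lambda> y + - real n * (\<beta> - \<epsilon>))
            + 1 / \<theta> * exp (- \<theta> * (\<Lambda> y - real n * (\<beta> - \<epsilon>)))"
            using positive_part_le[OF tk(1), of "\<Lambda> y - real n * (\<beta> - \<epsilon>)"]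
            by (simp add: pos_def)
        qed
        also have "\<dots> = D n s x - real n * (\<beta> - \<epsilon>)
            + 1 / \<theta> * (Q ^^ n) (\<lambda>t y. exp (- \<theta> * (\<Lambda> y - real n * (\<beta> - \<epsilon>)))) s x"
          unfolding Qn_add Qn_cmult by (simp add: D_def \<Lambda>x)
        also have "\<dots> \<le> D n s x - real n * (\<beta> - \<epsilon>) + 1 / \<theta> * K0"
          using tk(3)[OF x0, of n s] tk(1) by (simp add: \<Lambda>x divide_right_mono)
        also have "\<dots> \<le> 2 * \<epsilon> * real n + K0 / \<theta>"
          using near inf_D_le_\<beta>[OF n] by (simp add: algebra_simps)
        finally show ?thesis .
      qed
      have pos_nonneg: "(Q ^^ n) pos t y \<ge> 0" if "y \<noteq> 0" for t y
        using Qn_mono[OF that, of n "\<lambda>_ _. 0" pos t] by (simp add: pos_def)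
      have spread: "(Q ^^ n) pos t (run w (A s *v x)) \<le> b" if w: "w \<in> W" for w t
      proof -
        let ?m = "length (s # w)"
        have m: "?m \<le> Suc N" using w by (simp add: W_def)
        have "q * (Q ^^ n) pos t (run w (A s *v x)) \<le> pmin ^ ?m * (Q ^^ n) pos t (run w (A s *v x))"
          unfolding q_def using m pmin_pos pmin_le_1 x0
          by (intro mult_right_mono power_decreasing pos_nonneg) auto
        also have "\<dots> = pmin ^ ?m * (Q ^^ n) pos t (run (s # w) x)" by simp
        also have "\<dots> \<le> (Q ^^ ?m) ((Q ^^ n) pos) (hd ((s # w) @ [t])) x"
          by (rule path_lower_bound[OF pos_nonneg x0])
        \<comment> \<open>Running the extra steps at the end instead of the beginning changes
          \<open>pos\<close> by at most \<open>C\<close> per step.\<close>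
        also have "\<dots> = (Q ^^ n) ((Q ^^ ?m) pos) s x"
          unfolding Qn_commute[of ?m n] by simp
        also have "\<dots> \<le> (Q ^^ n) (\<lambda>t y. pos t y + C * real (Suc N)) s x"
        proof (rule Qn_mono[OF x0])
          fix t :: 's and y :: "real^'d" assume y: "y \<noteq> 0"
          have "(Q ^^ ?m) pos t y \<le> (Q ^^ ?m) (\<lambda>t' z. pos t y + C * real ?m) t y"
            by (rule Qn_mono[OF y]) (auto simp: pos_def)
          moreover have "C * real ?m \<le> C * real (Suc N)"
            using m C_pos by (intro mult_left_mono) auto
          ultimately show "(Q ^^ ?m) pos t y \<le> pos t y + C * real (Suc N)"
            unfolding Qn_const by linarith
        qed
        also have "\<dots> \<le> 2 * \<epsilon> * real n + K0 / \<theta> + C * real (Suc N)"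
          unfolding Qn_add using start by simp
        finally show ?thesis using q by (simp add: b_def field_simps)
      qed
      let ?e = "\<lambda>B. max 0 (ln (opnorm B) - real n * (\<beta> - \<epsilon>))"
      let ?f = "\<lambda>w B. pos s (B *v run w (A s *v x))"
      have "(\<integral>\<omega>. ?e (lrds M n \<omega>) \<partial>P) \<le> (\<integral>\<omega>. \<bar>ln c\<bar> + (\<Sum>w\<in>W. ?f w (lrds M n \<omega>)) \<partial>P)"
      proof (rule integral_mono)
        show "integrable P (\<lambda>\<omega>. ?e (lrds M n \<omega>))" by (rule integrable_lrds)
        show "integrable P (\<lambda>\<omega>. \<bar>ln c\<bar> + (\<Sum>w\<in>W. ?f w (lrds M n \<omega>)))"
          by (rule integrable_lrds[of "\<lambda>B. \<bar>ln c\<bar> + (\<Sum>w\<in>W. ?f w B)"])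
        fix \<omega>
        let ?B = "lrds M n \<omega>"
        obtain w where w: "length w \<le> N" "c * opnorm ?B \<le> norm (?B *v run w (A s *v x))"
          using span[OF x, of ?B s] by blast
        have "ln (c * opnorm ?B) \<le> \<Lambda> (?B *v run w (A s *v x))"
          unfolding \<Lambda>_def using w c opnorm_lrds_pos[of n \<omega>] x0
          by (subst ln_le_cancel_iff) auto
        then have "ln c + ln (opnorm ?B) \<le> \<Lambda> (?B *v run w (A s *v x))"
          using c opnorm_lrds_pos[of n \<omega>] by (simp add: ln_mult)
        then have "?e ?B \<le> \<bar>ln c\<bar> + ?f w ?B"
          by (auto simp: pos_def)
        moreover have "?f w ?B \<le> (\<Sum>w\<in>W. ?f w ?B)"
          using w W by (intro member_le_sum) (auto simp: W_def pos_def)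
        ultimately show "?e ?B \<le> \<bar>ln c\<bar> + (\<Sum>w\<in>W. ?f w ?B)" by linarith
      qed
      also have "\<dots> = \<bar>ln c\<bar> + (\<Sum>w\<in>W. \<integral>\<omega>. ?f w (lrds M n \<omega>) \<partial>P)"
      proof -
        have "integrable P (\<lambda>\<omega>. ?f w (lrds M n \<omega>))" for w by (rule integrable_lrds)
        then show ?thesis
          by (subst Bochner_Integration.integral_add) (simp_all add: prob_space)
      qed
      also have "\<dots> \<le> \<bar>ln c\<bar> + (\<Sum>w\<in>W. b)"
      proof (intro add_left_mono sum_mono)
        fix w assume "w \<in> W"
        have eq: "?f w (lrds M n \<omega>) = pos (\<omega> n) (lrds M n \<omega> *v run w (A s *v x))" for \<omega>
          by (simp add: pos_def)
        show "(\<integral>\<omega>. ?f w (lrds M n \<omega>) \<partial>P) \<le> b"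
          unfolding eq by (rule integral_le_of_Q) (rule spread[OF \<open>w \<in> W\<close>])
      qed
      also have "\<dots> = L * (\<epsilon> * real n) + K"
        by (simp add: L_def K_def b_def add_divide_distrib algebra_simps)
      finally show ?thesis .
    qed
    then show ?thesis by blast
  qed
  ultimately show ?thesis by blast
qed

lemma stat_lower_bound:
  assumes "\<And>t y. F t y \<ge> 0" "x \<noteq> 0"
  shows "stat s * (Q ^^ n) F s x \<le> (\<integral>\<omega>. F (\<omega> n) (lrds M n \<omega> *v x) \<partial>P)"
proof -
  have "(Q ^^ n) F t x \<ge> 0" for t
    using Qn_mono[OF assms(2), of n "\<lambda>_ _. 0" F t] assms(1) by simp
  then show ?thesis
    unfolding integral_eq_Q
    by (intro member_le_sum) (auto intro: mult_nonneg_nonneg less_imp_le stat_pos)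
qed

lemma upper_growth:
  assumes "\<delta> > 0"
  shows "\<exists>n0. \<forall>n\<ge>n0. (\<integral>\<omega>. ln (opnorm (lrds M n \<omega>)) \<partial>P) \<le> real n * (\<beta> + \<delta>) \<and>
    (\<forall>s x. x \<noteq> 0 \<longrightarrow> D n s x \<le> real n * (\<beta> + \<delta>))"
proof -
  obtain L where L: "L > 0" "\<And>\<epsilon>. \<epsilon> > 0 \<Longrightarrow> \<exists>K. \<forall>n\<ge>1.
    (\<integral>\<omega>. max 0 (ln (opnorm (lrds M n \<omega>)) - real n * (\<beta> - \<epsilon>)) \<partial>P) \<le> L * (\<epsilon> * real n) + K"
    using excess_bound by (elim exE conjE) (rule that, blast+)
  define m where "m = Min (range stat)"
  have m: "m > 0" unfolding m_def by (subst Min_gr_iff) (auto simp: stat_pos)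
  have m_le: "m \<le> stat s" for s unfolding m_def by (rule Min_le) auto
  have "m \<le> 1"
  proof -
    fix s
    have "stat s \<le> (\<Sum>s\<in>UNIV. stat s)"
      by (rule member_le_sum) (auto intro: less_imp_le stat_pos)
    then show ?thesis using m_le[of s] sum_stat by linarith
  qed
  \<comment> \<open>Passing from the integral to a fixed first symbol costs a factor \<open>1 / m\<close>, so
    the excess has to stay below \<open>m \<delta> n\<close>; half of it is spent on \<open>L \<epsilon>
    n\<close>, half on the constant \<open>K\<close>.\<close>
  define \<epsilon> where "\<epsilon> = \<delta> * m / (2 * L)"
  have \<epsilon>: "\<epsilon> > 0" using assms m L by (simp add: \<epsilon>_def)
  obtain K where K: "\<And>n. n \<ge> 1 \<Longrightarrow>
    (\<integral>\<omega>. max 0 (ln (opnorm (lrds M n \<omega>)) - real n * (\<beta> - \<epsilon>)) \<partial>P) \<le> L * (\<epsilon> * real n) + K"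
    using L(2)[OF \<epsilon>] by blast
  obtain n0 :: nat where n0: "real n0 \<ge> 2 * \<bar>K\<bar> / (m * \<delta>)" using real_arch_simple by blast
  have "(\<integral>\<omega>. ln (opnorm (lrds M n \<omega>)) \<partial>P) \<le> real n * (\<beta> + \<delta>) \<and>
    (\<forall>s x. x \<noteq> 0 \<longrightarrow> D n s x \<le> real n * (\<beta> + \<delta>))" if n: "n \<ge> Suc n0" for n
  proof -
    define E where "E = (\<integral>\<omega>. max 0 (ln (opnorm (lrds M n \<omega>)) - real n * (\<beta> - \<epsilon>)) \<partial>P)"
    have "E \<ge> 0" unfolding E_def by (rule Bochner_Integration.integral_nonneg) simp
    have "E \<le> m * (\<delta> * real n)"
    proof -
      have "real n \<ge> 2 * \<bar>K\<bar> / (m * \<delta>)" using n0 n by linarith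
      then have "K \<le> m * \<delta> * real n / 2" using m assms by (simp add: field_simps)
      moreover have "L * (\<epsilon> * real n) = m * \<delta> * real n / 2"
        using L by (simp add: \<epsilon>_def)
      moreover have "E \<le> L * (\<epsilon> * real n) + K" using K[of n] n unfolding E_def by simp
      ultimately have "E \<le> m * \<delta> * real n" by linarith
      then show ?thesis by (simp add: mult.assoc)
    qed
    have norm_le: "(\<integral>\<omega>. ln (opnorm (lrds M n \<omega>)) \<partial>P) \<le> real n * (\<beta> + \<delta>)"
    proof -
      have "(\<integral>\<omega>. ln (opnorm (lrds M n \<omega>)) \<partial>P)
          \<le> (\<integral>\<omega>. max 0 (ln (opnorm (lrds M n \<omega>)) - real n * (\<beta> - \<epsilon>)) + real n * (\<beta> - \<epsilon>) \<partial>P)"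
        by (rule integral_mono)
          (auto intro: integrable_lrds[of "\<lambda>B. ln (opnorm B)"]
            integrable_lrds[of "\<lambda>B. max 0 (ln (opnorm B) - real n * (\<beta> - \<epsilon>)) + real n * (\<beta> - \<epsilon>)"])
      also have "\<dots> = E + real n * (\<beta> - \<epsilon>)"
        using integrable_lrds[of "\<lambda>B. max 0 (ln (opnorm B) - real n * (\<beta> - \<epsilon>))" n]
        by (simp add: E_def prob_space)
      also have "\<dots> \<le> m * (\<delta> * real n) + real n * \<beta>"
      proof -
        have "real n * \<epsilon> \<ge> 0" using \<epsilon> by simp
        then show ?thesis
          using \<open>E \<le> m * (\<delta> * real n)\<close> unfolding right_diff_distrib by linarith
      qed
      also have "m * (\<delta> * real n) \<le> 1 * (\<delta> * real n)"
        using \<open>m \<le> 1\<close> assms by (intro mult_right_mono) auto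
      finally show ?thesis by (simp add: algebra_simps)
    qed
    have unit: "D n s x \<le> real n * (\<beta> + \<delta>)" if x: "norm x = 1" for s x
    proof -
      have x0: "x \<noteq> 0" using unit_nonzero[OF x] .
      have \<Lambda>x: "\<Lambda> x = 0" using x by (simp add: \<Lambda>_def)
      define F where "F = (\<lambda>(t :: 's) y. max 0 (\<Lambda> y - real n * (\<beta> - \<epsilon>)))"
      have "m * (Q ^^ n) F s x \<le> stat s * (Q ^^ n) F s x"
        using Qn_mono[OF x0, of n "\<lambda>_ _. 0" F s] m_le
        by (intro mult_right_mono) (auto simp: F_def)
      also have "\<dots> \<le> (\<integral>\<omega>. F (\<omega> n) (lrds M n \<omega> *v x) \<partial>P)"
        using x0 by (intro stat_lower_bound) (auto simp: F_def)
      also have "\<dots> \<le> E"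
        unfolding E_def F_def
      proof (rule integral_mono)
        show "integrable P (\<lambda>\<omega>. max 0 (\<Lambda> (lrds M n \<omega> *v x) - real n * (\<beta> - \<epsilon>)))"
          by (rule integrable_lrds[of "\<lambda>B. max 0 (\<Lambda> (B *v x) - real n * (\<beta> - \<epsilon>))"])
        show "integrable P (\<lambda>\<omega>. max 0 (ln (opnorm (lrds M n \<omega>)) - real n * (\<beta> - \<epsilon>)))"
          by (rule integrable_lrds[of "\<lambda>B. max 0 (ln (opnorm B) - real n * (\<beta> - \<epsilon>))"])
        fix \<omega>
        have "\<Lambda> (lrds M n \<omega> *v x) \<le> ln (opnorm (lrds M n \<omega>))"
          using opnorm_bound[of "lrds M n \<omega>" x] x x0 opnorm_lrds_pos[of n \<omega>]
          unfolding \<Lambda>_def by (subst ln_le_cancel_iff) auto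
        then show "max 0 (\<Lambda> (lrds M n \<omega> *v x) - real n * (\<beta> - \<epsilon>))
            \<le> max 0 (ln (opnorm (lrds M n \<omega>)) - real n * (\<beta> - \<epsilon>))" by auto
      qed
      finally have "m * (Q ^^ n) F s x \<le> m * (\<delta> * real n)"
        using \<open>E \<le> m * (\<delta> * real n)\<close> by linarith
      then have "(Q ^^ n) F s x \<le> \<delta> * real n" using m by simp
      moreover have "(Q ^^ n) (\<lambda>t y. \<Lambda> y + - real n * (\<beta> - \<epsilon>)) s x \<le> (Q ^^ n) F s x"
        by (rule Qn_mono[OF x0]) (auto simp: F_def)
      then have "D n s x - real n * (\<beta> - \<epsilon>) \<le> (Q ^^ n) F s x"
        unfolding Qn_add by (simp add: D_def \<Lambda>x)
      moreover have "real n * \<epsilon> \<ge> 0" using \<epsilon> by simp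
      ultimately show ?thesis by (simp add: algebra_simps)
    qed
    have "D n s x \<le> real n * (\<beta> + \<delta>)" if "x \<noteq> 0" for s x
      using unit[of "(1 / norm x) *\<^sub>R x" s] D_scale[of "1 / norm x" x n s] that by simp
    with norm_le show ?thesis by blast
  qed
  then show ?thesis by blast
qed

text \<open>The mean is recovered from the exponential moment through \<open>u \<le> exp u\<close>.\<close>

lemma lower_growth:
  assumes "\<delta> > 0"
  shows "\<exists>n0. \<forall>n\<ge>n0. \<forall>s x. x \<noteq> 0 \<longrightarrow> real n * (\<beta> - \<delta>) \<le> D n s x"
proof -
  obtain \<theta> K where tk: "\<theta> > 0" "K > 0"
    "\<And>n s x. x \<noteq> 0 \<Longrightarrow> (Q ^^ n) (\<lambda>t y. exp (- \<theta> * (\<Lambda> y - real n * (\<beta> - \<delta> / 2)))) s x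
      \<le> K * exp (- \<theta> * \<Lambda> x)"
    by (rule chernoff_lower[OF half_gt_zero[OF assms]]) (rule that)
  obtain n0 :: nat where n0: "real n0 \<ge> 2 * K / (\<theta> * \<delta>)" using real_arch_simple by blast
  have "real n * (\<beta> - \<delta>) \<le> D n s x" if "n \<ge> n0" "x \<noteq> 0" for n s x
  proof -
    have unit: "real n * (\<beta> - \<delta>) \<le> D n s x" if x: "norm x = 1" for x
    proof -
      let ?a = "real n * (\<beta> - \<delta> / 2)"
      have \<Lambda>x: "\<Lambda> x = 0" using x by (simp add: \<Lambda>_def)
      have x0: "x \<noteq> 0" using unit_nonzero[OF x] .
      have "(Q ^^ n) (\<lambda>t y. - \<theta> * \<Lambda> y + \<theta> * ?a) s x
          \<le> (Q ^^ n) (\<lambda>t y. exp (- \<theta> * (\<Lambda> y - ?a))) s x"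
      proof (rule Qn_mono[OF x0])
        fix y
        show "- \<theta> * \<Lambda> y + \<theta> * ?a \<le> exp (- \<theta> * (\<Lambda> y - ?a))"
          using exp_ge_add_one_self[of "- \<theta> * (\<Lambda> y - ?a)"] by (simp add: algebra_simps)
      qed
      also have "\<dots> \<le> K" using tk(3)[OF x0, of n s] by (simp add: \<Lambda>x)
      finally have "- \<theta> * D n s x + \<theta> * ?a \<le> K"
        unfolding Qn_add Qn_cmult by (simp add: D_def \<Lambda>x)
      moreover have "K \<le> \<theta> * (real n * \<delta> / 2)"
      proof -
        have "real n \<ge> 2 * K / (\<theta> * \<delta>)" using n0 \<open>n \<ge> n0\<close> by linarith
        then show ?thesis using tk assms by (simp add: field_simps)
      qed
      ultimately have "\<theta> * (?a - real n * \<delta> / 2) \<le> \<theta> * D n s x"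
        by (simp add: algebra_simps)
      then have "?a - real n * \<delta> / 2 \<le> D n s x" using tk by simp
      then show ?thesis by (simp add: algebra_simps)
    qed
    show ?thesis
      using unit[of "(1 / norm x) *\<^sub>R x"] D_scale[of "1 / norm x" x n s] that by simp
  qed
  then show ?thesis by blast
qed

lemma D_uniform:
  assumes "\<epsilon> > 0"
  shows "\<forall>\<^sub>F n in sequentially. \<forall>s x. x \<noteq> 0 \<longrightarrow> \<bar>D n s x - real n * \<beta>\<bar> \<le> real n * \<epsilon>"
proof -
  obtain n1 where n1: "\<And>n s x. n \<ge> n1 \<Longrightarrow> x \<noteq> 0 \<Longrightarrow> D n s x \<le> real n * (\<beta> + \<epsilon>)"
    using upper_growth[OF assms] by blast
  obtain n2 where n2: "\<And>n s x. n \<ge> n2 \<Longrightarrow> x \<noteq> 0 \<Longrightarrow> real n * (\<beta> - \<epsilon>) \<le> D n s x"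
    using lower_growth[OF assms] by blast
  show ?thesis
  proof (rule eventually_sequentiallyI[of "max n1 n2"], intro allI impI)
    fix n s and x :: "real^'d" assume "max n1 n2 \<le> n" "x \<noteq> 0"
    then show "\<bar>D n s x - real n * \<beta>\<bar> \<le> real n * \<epsilon>"
      using n1[of n x s] n2[of n x s] by (simp add: algebra_simps abs_le_iff)
  qed
qed

lemma expectation_eq_D:
  assumes "norm x = 1"
  shows "(\<integral>\<omega>. ln (norm (lrds M n \<omega> *v x)) \<partial>P) = (\<Sum>s\<in>UNIV. stat s * D n s x)"
  using integral_eq_Q[of "\<lambda>_. \<Lambda>" n x] assms by (simp add: D_def \<Lambda>_def)

lemma expectation_uniform:
  assumes "\<epsilon> > 0"
  shows "\<forall>\<^sub>F n in sequentially. \<forall>x. norm x = 1 \<longrightarrow>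
    \<bar>(\<integral>\<omega>. ln (norm (lrds M n \<omega> *v x)) \<partial>P) - real n * \<beta>\<bar> \<le> real n * \<epsilon>"
  using D_uniform[OF assms]
proof (rule eventually_mono, intro allI impI)
  fix n and x :: "real^'d"
  assume D: "\<forall>s x. x \<noteq> 0 \<longrightarrow> \<bar>D n s x - real n * \<beta>\<bar> \<le> real n * \<epsilon>" and x: "norm x = 1"
  have "(\<Sum>s\<in>UNIV. stat s * D n s x) - real n * \<beta> = (\<Sum>s\<in>UNIV. stat s * (D n s x - real n * \<beta>))"
    using sum_stat by (simp add: right_diff_distrib sum_subtractf flip: sum_distrib_right)
  also have "\<bar>\<dots>\<bar> \<le> (\<Sum>s\<in>UNIV. \<bar>stat s * (D n s x - real n * \<beta>)\<bar>)"
    by (rule sum_abs)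
  also have "\<dots> \<le> (\<Sum>s\<in>UNIV. stat s * (real n * \<epsilon>))"
  proof (rule sum_mono)
    fix s
    have "\<bar>D n s x - real n * \<beta>\<bar> \<le> real n * \<epsilon>" using D unit_nonzero[OF x] by blast
    then show "\<bar>stat s * (D n s x - real n * \<beta>)\<bar> \<le> stat s * (real n * \<epsilon>)"
      using stat_pos[of s] by (simp add: abs_mult)
  qed
  also have "\<dots> = real n * \<epsilon>"
    by (simp add: sum_stat flip: sum_distrib_right)
  finally show "\<bar>(\<integral>\<omega>. ln (norm (lrds M n \<omega> *v x)) \<partial>P) - real n * \<beta>\<bar> \<le> real n * \<epsilon>"
    unfolding expectation_eq_D[OF x] .
qed

lemma abs_scaled_le:
  fixes a \<beta> \<epsilon> :: real
  assumes "\<bar>a - real n * \<beta>\<bar> \<le> real n * \<epsilon>" "n > 0"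
  shows "\<bar>1 / real n * a - \<beta>\<bar> \<le> \<epsilon>"
proof -
  have "real n * \<bar>1 / real n * a - \<beta>\<bar> = \<bar>real n * (1 / real n * a - \<beta>)\<bar>"
    by (simp add: abs_mult)
  also have "real n * (1 / real n * a - \<beta>) = a - real n * \<beta>"
    using assms(2) by (simp add: right_diff_distrib)
  finally have "real n * \<bar>1 / real n * a - \<beta>\<bar> \<le> real n * \<epsilon>" using assms(1) by simp
  then show ?thesis using assms(2) by simp
qed

text \<open>The norm is bounded above by \<open>upper_growth\<close> and below by the growth of any one unit
  vector.\<close>

theorem lyapunov_eq_\<beta>: "lyapunov_exponent P M = \<beta>"
  unfolding lyapunov_exponent_def
proof (rule limI, rule LIMSEQ_I)
  fix r :: real assume "r > 0"
  obtain e :: "real^'d" where e: "norm e = 1" using unit_vector_exists by blast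
  obtain n1 where n1: "\<And>n. n \<ge> n1 \<Longrightarrow>
      (\<integral>\<omega>. ln (opnorm (lrds M n \<omega>)) \<partial>P) \<le> real n * (\<beta> + r / 2)"
    using upper_growth[of "r / 2"] \<open>r > 0\<close> by auto
  obtain n2 where n2: "\<And>n. n \<ge> n2 \<Longrightarrow>
      \<bar>(\<integral>\<omega>. ln (norm (lrds M n \<omega> *v e)) \<partial>P) - real n * \<beta>\<bar> \<le> real n * (r / 2)"
    using expectation_uniform[of "r / 2"] \<open>r > 0\<close> e unfolding eventually_sequentially by (metis half_gt_zero)
  have "norm (1 / real n * (\<integral>\<omega>. ln (opnorm (lrds M n \<omega>)) \<partial>P) - \<beta>) < r"
    if n: "n \<ge> Suc (max n1 n2)" for n
  proof -
    have "(\<integral>\<omega>. ln (norm (lrds M n \<omega> *v e)) \<partial>P) \<le> (\<integral>\<omega>. ln (opnorm (lrds M n \<omega>)) \<partial>P)"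
    proof (rule integral_mono)
      show "integrable P (\<lambda>\<omega>. ln (norm (lrds M n \<omega> *v e)))"
        by (rule integrable_lrds[of "\<lambda>B. ln (norm (B *v e))"])
      show "integrable P (\<lambda>\<omega>. ln (opnorm (lrds M n \<omega>)))"
        by (rule integrable_lrds[of "\<lambda>B. ln (opnorm B)"])
      show "ln (norm (lrds M n \<omega> *v e)) \<le> ln (opnorm (lrds M n \<omega>))" for \<omega>
        using opnorm_bound[of "lrds M n \<omega>" e] e opnorm_lrds_pos[of n \<omega>] unit_nonzero[OF e]
        by (subst ln_le_cancel_iff) auto
    qed
    then have "\<bar>(\<integral>\<omega>. ln (opnorm (lrds M n \<omega>)) \<partial>P) - real n * \<beta>\<bar> \<le> real n * (r / 2)"
    proof -
      have "(\<integral>\<omega>. ln (opnorm (lrds M n \<omega>)) \<partial>P) \<le> real n * \<beta> + real n * (r / 2)"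
        using n1[of n] n by (simp add: distrib_left)
      moreover have "\<bar>(\<integral>\<omega>. ln (norm (lrds M n \<omega> *v e)) \<partial>P) - real n * \<beta>\<bar> \<le> real n * (r / 2)"
        using n by (intro n2) simp
      ultimately show ?thesis
        using \<open>(\<integral>\<omega>. ln (norm (lrds M n \<omega> *v e)) \<partial>P) \<le> (\<integral>\<omega>. ln (opnorm (lrds M n \<omega>)) \<partial>P)\<close>
        by linarith
    qed
    from abs_scaled_le[OF this] n \<open>r > 0\<close> show ?thesis by simp
  qed
  then show "\<exists>no. \<forall>n\<ge>no. norm (1 / real n * (\<integral>\<omega>. ln (opnorm (lrds M n \<omega>)) \<partial>P) - \<beta>) < r"
    by blast
qed

theorem expectation_uniform_limit:
  "uniform_limit {x. norm x = 1}
    (\<lambda>n x. (1 / real n) * (\<integral>\<omega>. ln (norm (lrds M n \<omega> *v x)) \<partial>P)) (\<lambda>x. \<beta>) sequentially"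
proof (rule uniform_limitI)
  fix e :: real assume "e > 0"
  then have "\<forall>\<^sub>F n in sequentially. \<forall>x. norm x = 1 \<longrightarrow>
    \<bar>(\<integral>\<omega>. ln (norm (lrds M n \<omega> *v x)) \<partial>P) - real n * \<beta>\<bar> \<le> real n * (e / 2)"
    by (intro expectation_uniform) simp
  then show "\<forall>\<^sub>F n in sequentially. \<forall>x\<in>{x. norm x = 1}.
      dist (1 / real n * (\<integral>\<omega>. ln (norm (lrds M n \<omega> *v x)) \<partial>P)) \<beta> < e"
    using eventually_gt_at_top[of 0]
  proof eventually_elim
    case (elim n)
    show ?case
    proof
      fix x :: "real^'d" assume "x \<in> {x. norm x = 1}"
      then have "\<bar>(\<integral>\<omega>. ln (norm (lrds M n \<omega> *v x)) \<partial>P) - real n * \<beta>\<bar> \<le> real n * (e / 2)"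
        using elim by blast
      from abs_scaled_le[OF this] elim \<open>e > 0\<close>
      show "dist (1 / real n * (\<integral>\<omega>. ln (norm (lrds M n \<omega> *v x)) \<partial>P)) \<beta> < e"
        by (simp add: dist_real_def)
    qed
  qed
qed

section \<open>Almost sure growth\<close>

text \<open>The bound is the same for all unit vectors. This is what later allows the vector to vary with
  \<open>n\<close>.\<close>

lemma one_sided_tail:
  assumes \<sigma>: "\<bar>\<sigma>\<bar> = 1" and "\<epsilon> > 0"
  obtains K r where "0 < r" "r < 1"
    "\<And>n x. norm x = 1 \<Longrightarrow>
      measure P {\<omega>. \<sigma> * (\<Lambda> (lrds M n \<omega> *v x) - real n * \<beta>) \<ge> real n * \<epsilon>} \<le> K * r ^ n"
proof -
  have "\<forall>\<^sub>F n in sequentially. n > 0 \<and> (\<forall>s x. x \<noteq> 0 \<longrightarrow> \<bar>D n s x - real n * \<beta>\<bar> \<le> real n * (\<epsilon> / 3))"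
    using \<open>\<epsilon> > 0\<close> by (intro eventually_conj eventually_gt_at_top D_uniform) simp
  then obtain N where N: "N > 0"
    "\<And>s x. x \<noteq> 0 \<Longrightarrow> \<bar>D N s x - real N * \<beta>\<bar> \<le> real N * (\<epsilon> / 3)"
    unfolding eventually_sequentially by blast
  have drift: "\<sigma> * D N s x \<le> real N * (\<sigma> * \<beta> + \<epsilon> / 3)" if "x \<noteq> 0" for s x
  proof -
    have "\<sigma> * (D N s x - real N * \<beta>) \<le> \<bar>\<sigma>\<bar> * \<bar>D N s x - real N * \<beta>\<bar>"
      by (metis abs_ge_self abs_mult)
    then show ?thesis using N(2)[OF that, of s] \<sigma> by (simp add: algebra_simps)
  qed
  have "\<epsilon> / 3 > 0" using \<open>\<epsilon> > 0\<close> by simp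
  obtain \<theta> K where tk: "\<theta> > 0" "K > 0"
    "\<And>n s x. x \<noteq> 0 \<Longrightarrow> (Q ^^ n) (\<lambda>t y. exp (\<theta> * (\<sigma> * \<Lambda> y))) s x
      \<le> K * exp (\<theta> * (\<sigma> * \<Lambda> x + real n * ((\<sigma> * \<beta> + \<epsilon> / 3) + \<epsilon> / 3)))"
    by (rule chernoff[OF \<sigma> \<open>N > 0\<close> \<open>\<epsilon> / 3 > 0\<close> drift]) (assumption, rule that)
  define r where "r = exp (- (\<theta> * \<epsilon> / 3))"
  have "measure P {\<omega>. \<sigma> * (\<Lambda> (lrds M n \<omega> *v x) - real n * \<beta>) \<ge> real n * \<epsilon>} \<le> K * r ^ n"
    if x: "norm x = 1" for n x
  proof -
    define c where "c = \<theta> * (real n * (\<sigma> * \<beta> + \<epsilon>))"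
    let ?F = "\<lambda>(t :: 's) y. exp (\<theta> * (\<sigma> * \<Lambda> y))"
    let ?E = "{\<omega>. \<sigma> * (\<Lambda> (lrds M n \<omega> *v x) - real n * \<beta>) \<ge> real n * \<epsilon>}"
    have int: "integrable P (\<lambda>\<omega>. exp (- c) * ?F (\<omega> n) (lrds M n \<omega> *v x))"
      by (rule integrable_lrds[of "\<lambda>B. exp (- c) * exp (\<theta> * (\<sigma> * \<Lambda> (B *v x)))"])
    have "(\<lambda>\<omega>. \<sigma> * (\<Lambda> (lrds M n \<omega> *v x) - real n * \<beta>)) \<in> borel_measurable P"
      using integrable_lrds[of "\<lambda>B. \<sigma> * (\<Lambda> (B *v x) - real n * \<beta>)" n]
      by (rule borel_measurable_integrable)
    then have "{\<omega>\<in>space P. \<sigma> * (\<Lambda> (lrds M n \<omega> *v x) - real n * \<beta>) \<ge> real n * \<epsilon>} \<in> sets P"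
      by measurable
    then have E: "?E \<in> sets P" by simp
    have "measure P ?E = (\<integral>\<omega>. indicator ?E \<omega> \<partial>P)" using E by simp
    also have "\<dots> \<le> (\<integral>\<omega>. exp (- c) * ?F (\<omega> n) (lrds M n \<omega> *v x) \<partial>P)"
    proof (rule integral_mono[OF _ int])
      show "integrable P (indicator ?E :: _ \<Rightarrow> real)"
        using E by (intro integrable_real_indicator) (auto simp: less_top[symmetric])
      fix \<omega>
      show "indicator ?E \<omega> \<le> exp (- c) * ?F (\<omega> n) (lrds M n \<omega> *v x)"
      proof (cases "\<omega> \<in> ?E")
        case True
        then have "real n * (\<sigma> * \<beta> + \<epsilon>) \<le> \<sigma> * \<Lambda> (lrds M n \<omega> *v x)"
          by (simp add: algebra_simps)
        then have "c \<le> \<theta> * (\<sigma> * \<Lambda> (lrds M n \<omega> *v x))"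
          unfolding c_def using tk(1) by (intro mult_left_mono) auto
        then show ?thesis using True by (simp flip: exp_add)
      qed simp
    qed
    also have "\<dots> \<le> K * r ^ n"
    proof (rule integral_le_of_Q[of n "\<lambda>t y. exp (- c) * ?F t y"])
      fix s
      have "(Q ^^ n) (\<lambda>t y. exp (- c) * ?F t y) s x
          \<le> exp (- c) * (K * exp (\<theta> * (\<sigma> * \<Lambda> x + real n * ((\<sigma> * \<beta> + \<epsilon> / 3) + \<epsilon> / 3))))"
        unfolding Qn_cmult using tk(3)[OF unit_nonzero[OF x]] by (intro mult_left_mono) auto
      also have "\<dots> = K * (exp (- c) * exp (\<theta> * (real n * ((\<sigma> * \<beta> + \<epsilon> / 3) + \<epsilon> / 3))))"
        using x by (simp add: \<Lambda>_def)
      also have "exp (- c) * exp (\<theta> * (real n * ((\<sigma> * \<beta> + \<epsilon> / 3) + \<epsilon> / 3))) = r ^ n"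
        unfolding r_def exp_of_nat_mult[symmetric] exp_add[symmetric] c_def
        by (simp add: algebra_simps)
      finally show "(Q ^^ n) (\<lambda>t y. exp (- c) * ?F t y) s x \<le> K * r ^ n" .
    qed
    finally show ?thesis .
  qed
  moreover have "0 < r" "r < 1" using tk \<open>\<epsilon> > 0\<close> by (auto simp: r_def)
  ultimately show ?thesis using that by blast
qed

lemma eventually_below:
  assumes \<sigma>: "\<bar>\<sigma>\<bar> = 1" and "\<epsilon> > 0" and Y: "\<And>n. norm (Y n) = 1"
  shows "AE \<omega> in P. \<forall>\<^sub>F n in sequentially.
    \<sigma> * (\<Lambda> (lrds M n \<omega> *v Y n) - real n * \<beta>) < real n * \<epsilon>"
proof -
  obtain K r where r: "0 < r" "r < 1" and tail: "\<And>n x. norm x = 1 \<Longrightarrow>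
      measure P {\<omega>. \<sigma> * (\<Lambda> (lrds M n \<omega> *v x) - real n * \<beta>) \<ge> real n * \<epsilon>} \<le> K * r ^ n"
    by (rule one_sided_tail[OF \<sigma> \<open>\<epsilon> > 0\<close>]) (rule that)
  let ?E = "\<lambda>n. {\<omega>. \<sigma> * (\<Lambda> (lrds M n \<omega> *v Y n) - real n * \<beta>) \<ge> real n * \<epsilon>}"
  have E: "?E n \<in> sets P" for n
  proof -
    have "(\<lambda>\<omega>. \<sigma> * (\<Lambda> (lrds M n \<omega> *v Y n) - real n * \<beta>)) \<in> borel_measurable P"
      using integrable_lrds[of "\<lambda>B. \<sigma> * (\<Lambda> (B *v Y n) - real n * \<beta>)" n]
      by (rule borel_measurable_integrable)
    then have "{\<omega>\<in>space P. \<sigma> * (\<Lambda> (lrds M n \<omega> *v Y n) - real n * \<beta>) \<ge> real n * \<epsilon>} \<in> sets P"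
      by measurable
    then show ?thesis by simp
  qed
  have "summable (\<lambda>n. measure P (?E n))"
  proof (rule summable_comparison_test'[where N = 0])
    show "summable (\<lambda>n. K * r ^ n)"
      using r by (intro summable_mult summable_geometric) auto
    show "norm (measure P (?E n)) \<le> K * r ^ n" for n
      using tail[OF Y[of n], of n] by simp
  qed
  then have "AE \<omega> in P. \<forall>\<^sub>F n in sequentially. \<omega> \<in> space P - ?E n"
    using E by (intro borel_cantelli_AE1) (auto simp: less_top[symmetric])
  then show ?thesis by (rule AE_mp) (simp add: not_le)
qed

lemma AE_unit_growth:
  assumes Y: "\<And>n. norm (Y n) = 1"
  shows "AE \<omega> in P. (\<lambda>n. 1 / real n * \<Lambda> (lrds M n \<omega> *v Y n)) \<longlonglongrightarrow> \<beta>"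
proof -
  let ?L = "\<lambda>n \<omega>. \<Lambda> (lrds M n \<omega> *v Y n) - real n * \<beta>"
  have "AE \<omega> in P. \<forall>k::nat. (\<forall>\<^sub>F n in sequentially. 1 * ?L n \<omega> < real n * (1 / real (Suc k)))
      \<and> (\<forall>\<^sub>F n in sequentially. - 1 * ?L n \<omega> < real n * (1 / real (Suc k)))"
    unfolding AE_all_countable
  proof
    fix k :: nat
    show "AE \<omega> in P. (\<forall>\<^sub>F n in sequentially. 1 * ?L n \<omega> < real n * (1 / real (Suc k)))
      \<and> (\<forall>\<^sub>F n in sequentially. - 1 * ?L n \<omega> < real n * (1 / real (Suc k)))"
      by (rule AE_conjI) (rule eventually_below[OF _ _ Y]; simp)+
  qed
  then show ?thesis
  proof (rule AE_mp, intro AE_I2 impI)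
    fix \<omega>
    assume ev: "\<forall>k::nat. (\<forall>\<^sub>F n in sequentially. 1 * ?L n \<omega> < real n * (1 / real (Suc k)))
      \<and> (\<forall>\<^sub>F n in sequentially. - 1 * ?L n \<omega> < real n * (1 / real (Suc k)))"
    show "(\<lambda>n. 1 / real n * \<Lambda> (lrds M n \<omega> *v Y n)) \<longlonglongrightarrow> \<beta>"
    proof (rule tendstoI)
      fix e :: real assume "e > 0"
      then obtain k where k: "1 / real (Suc k) < e"
        using reals_Archimedean[of e] by (auto simp: inverse_eq_divide)
      have "\<forall>\<^sub>F n in sequentially. 1 * ?L n \<omega> < real n * (1 / real (Suc k))"
        "\<forall>\<^sub>F n in sequentially. - 1 * ?L n \<omega> < real n * (1 / real (Suc k))"
        using ev by blast+
      then show "\<forall>\<^sub>F n in sequentially. dist (1 / real n * \<Lambda> (lrds M n \<omega> *v Y n)) \<beta> < e"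
        using eventually_gt_at_top[of 0]
      proof eventually_elim
        case (elim n)
        have "\<bar>?L n \<omega>\<bar> \<le> real n * (1 / real (Suc k))"
        proof (rule abs_leI)
          show "?L n \<omega> \<le> real n * (1 / real (Suc k))"
            using elim(1) by (simp only: mult_1 less_imp_le)
          show "- ?L n \<omega> \<le> real n * (1 / real (Suc k))"
            using elim(2) by (simp only: mult_minus1 less_imp_le)
        qed
        from abs_scaled_le[OF this elim(3)] k show ?case by (simp add: dist_real_def)
      qed
    qed
  qed
qed

text \<open>Normalizing turns \<open>X\<close> into a deterministic sequence of unit vectors, and the
  correction \<open>ln \<parallel>X n\<parallel> / n\<close> vanishes because the limit of \<open>X\<close> is
  nonzero.\<close>

theorem AE_growth:
  assumes X: "X \<longlonglongrightarrow> x" and "x \<noteq> 0"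
  shows "AE \<omega> in P. (\<lambda>n. (1 / real n) * ln (norm (lrds M n \<omega> *v X n))) \<longlonglongrightarrow> \<beta>"
proof -
  obtain e :: "real^'d" where e: "norm e = 1" using unit_vector_exists by blast
  define Y where "Y n = (if X n = 0 then e else (1 / norm (X n)) *\<^sub>R X n)" for n
  have Y: "norm (Y n) = 1" for n using e by (simp add: Y_def)
  have nz: "\<forall>\<^sub>F n in sequentially. X n \<noteq> 0"
    using tendsto_imp_eventually_ne[OF X \<open>x \<noteq> 0\<close>] .
  have small: "(\<lambda>n. 1 / real n * ln (norm (X n))) \<longlonglongrightarrow> 0 * ln (norm x)"
    using \<open>x \<noteq> 0\<close> by (intro tendsto_mult lim_1_over_n tendsto_ln tendsto_norm X) auto
  from AE_unit_growth[of Y, OF Y] show ?thesis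
  proof (rule AE_mp, intro AE_I2 impI)
    fix \<omega>
    assume lim: "(\<lambda>n. 1 / real n * \<Lambda> (lrds M n \<omega> *v Y n)) \<longlonglongrightarrow> \<beta>"
    have "(\<lambda>n. 1 / real n * \<Lambda> (lrds M n \<omega> *v Y n) + 1 / real n * ln (norm (X n)))
        \<longlonglongrightarrow> \<beta> + 0 * ln (norm x)"
      by (intro tendsto_add lim small)
    moreover have "\<forall>\<^sub>F n in sequentially.
      1 / real n * \<Lambda> (lrds M n \<omega> *v Y n) + 1 / real n * ln (norm (X n))
      = (1 / real n) * ln (norm (lrds M n \<omega> *v X n))"
      using nz
    proof (rule eventually_mono)
      fix n assume n: "X n \<noteq> 0"
      then have "X n = norm (X n) *\<^sub>R Y n" by (simp add: Y_def)
      then have "norm (lrds M n \<omega> *v X n) = norm (X n) * norm (lrds M n \<omega> *v Y n)"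
        by (metis abs_norm_cancel matrix_vector_mult_scaleR norm_scaleR)
      moreover have "Y n \<noteq> 0" using Y[of n] by auto
      ultimately have "ln (norm (lrds M n \<omega> *v X n)) = ln (norm (X n)) + \<Lambda> (lrds M n \<omega> *v Y n)"
        using n by (simp add: \<Lambda>_def ln_mult)
      then show "1 / real n * \<Lambda> (lrds M n \<omega> *v Y n) + 1 / real n * ln (norm (X n))
        = (1 / real n) * ln (norm (lrds M n \<omega> *v X n))"
        by (simp add: distrib_left add.commute)
    qed
    ultimately show "(\<lambda>n. (1 / real n) * ln (norm (lrds M n \<omega> *v X n))) \<longlonglongrightarrow> \<beta>"
      using Lim_transform_eventually by fastforce
  qed
qed

end

section \<open>Functions and measurability on projective space\<close>

lemma space_proj_space: "space proj_space = proj_points"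
  unfolding proj_space_def by (rule space_measure_of) auto

lemma sets_proj_space:
  "sets proj_space = sigma_sets proj_points {U. U \<subseteq> proj_points \<and> open {x. x \<noteq> 0 \<and> span {x} \<in> U}}"
  unfolding proj_space_def by (rule sets_measure_of) auto

lemma span_in_proj_points: "x \<noteq> 0 \<Longrightarrow> span {x} \<in> proj_points"
  by (auto simp: proj_points_def)

lemma span_scale: "c \<noteq> 0 \<Longrightarrow> span {c *\<^sub>R x} = span {x}" for x :: "'a :: real_vector"
  using span_image_scale[of "{x}" "\<lambda>_. c"] by simp

lemma unit_rep_span:
  assumes "x \<noteq> 0"
  obtains c where "c \<noteq> 0" "unit_rep (span {x}) = c *\<^sub>R x"
proof -
  have "unit_rep (span {x}) \<in> span {x}" "norm (unit_rep (span {x})) = 1"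
    using unit_rep[OF span_in_proj_points[OF assms]] by auto
  then obtain c where "unit_rep (span {x}) = c *\<^sub>R x" by (auto simp: span_singleton)
  moreover from this \<open>norm (unit_rep (span {x})) = 1\<close> have "c \<noteq> 0" by auto
  ultimately show ?thesis using that by blast
qed

lemma unit_rep_nonzero: "L \<in> proj_points \<Longrightarrow> unit_rep L \<noteq> 0"
  using unit_rep(2)[of L] by auto

lemma span_unit_rep:
  assumes "L \<in> proj_points"
  shows "span {unit_rep L} = L"
proof -
  obtain x where x: "L = span {x}" "x \<noteq> 0" using assms by (auto simp: proj_points_def)
  obtain c where "c \<noteq> 0" "unit_rep (span {x}) = c *\<^sub>R x"
    by (rule unit_rep_span[OF x(2)]) (rule that)
  then show ?thesis by (simp add: x span_scale)
qed

text \<open>Continuous functions on projective space, written as functions of nonzero vectors.\<close>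

definition projective :: "(real^'d \<Rightarrow> real) \<Rightarrow> bool" where
  "projective f \<longleftrightarrow> continuous_on (- {0}) f \<and> (\<forall>c x. c \<noteq> 0 \<longrightarrow> x \<noteq> 0 \<longrightarrow> f (c *\<^sub>R x) = f x)"

lemma projective_scale: "projective f \<Longrightarrow> c \<noteq> 0 \<Longrightarrow> x \<noteq> 0 \<Longrightarrow> f (c *\<^sub>R x) = f x"
  by (simp add: projective_def)

lemma projective_unit_rep_span:
  assumes "projective f" "x \<noteq> 0"
  shows "f (unit_rep (span {x})) = f x"
proof -
  obtain c where "c \<noteq> 0" "unit_rep (span {x}) = c *\<^sub>R x"
    by (rule unit_rep_span[OF assms(2)]) (rule that)
  then show ?thesis using projective_scale[OF assms(1)] assms(2) by simp
qed

lemma projective_bounded: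
  assumes "projective f"
  obtains b where "\<And>x. x \<noteq> 0 \<Longrightarrow> \<bar>f x\<bar> \<le> b"
proof -
  have "compact (f ` sphere 0 1)"
    using assms by (intro compact_continuous_image compact_sphere)
      (auto simp: projective_def elim!: continuous_on_subset)
  then have "bounded (f ` sphere 0 1)" by (rule compact_imp_bounded)
  then obtain b where b: "\<forall>y\<in>f ` sphere 0 1. norm y \<le> b"
    unfolding bounded_iff by blast
  have "\<bar>f x\<bar> \<le> b" if "x \<noteq> 0" for x
  proof -
    have "f x = f ((1 / norm x) *\<^sub>R x)"
      using projective_scale[OF assms, of "1 / norm x" x] that by simp
    moreover have "(1 / norm x) *\<^sub>R x \<in> sphere 0 1" using that by simp
    ultimately show ?thesis using b by (metis imageI real_norm_def)
  qed
  then show ?thesis using that by blast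
qed

text \<open>The Borel sets of projective space are generated by sets whose cones are open, so continuity on
  nonzero vectors suffices.\<close>

lemma projective_measurable:
  assumes "projective f"
  shows "(\<lambda>L. f (unit_rep L)) \<in> borel_measurable proj_space"
proof (rule borel_measurableI)
  fix S :: "real set" assume "open S"
  let ?U = "{L \<in> proj_points. f (unit_rep L) \<in> S}"
  have "{x. x \<noteq> 0 \<and> span {x} \<in> ?U} = {x. x \<noteq> 0 \<and> f x \<in> S}"
    using projective_unit_rep_span[OF assms] span_in_proj_points by auto
  also have "\<dots> = (- {0}) \<inter> f -` S" by auto
  finally have "open {x. x \<noteq> 0 \<and> span {x} \<in> ?U}"
    using assms \<open>open S\<close> unfolding projective_def
    by (metis continuous_open_preimage open_Compl closed_singleton)
  then have "?U \<in> sets proj_space"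
    unfolding sets_proj_space by (intro sigma_sets.Basic) auto
  then show "(\<lambda>L. f (unit_rep L)) -` S \<inter> space proj_space \<in> sets proj_space"
    by (simp add: space_proj_space vimage_def Int_def conj_commute)
qed

lemma image_span: "(*v) B ` span {x} = span {B *v x}" for B :: "real^'d^'d"
  using linear_span_image[OF matrix_vector_mul_linear, of B "{x}"] by simp

lemma image_measurable:
  fixes B :: "real^'d^'d"
  assumes inj: "\<And>x. B *v x = 0 \<longleftrightarrow> x = 0"
  shows "(\<lambda>L. (*v) B ` L) \<in> measurable proj_space proj_space"
  unfolding proj_space_def
proof (rule measurable_measure_of)
  have pts: "(*v) B ` L \<in> proj_points" if L: "L \<in> proj_points" for L :: "(real^'d) set"
  proof -
    obtain x where "L = span {x}" "x \<noteq> 0" using L by (auto simp: proj_points_def)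
    then show ?thesis using span_in_proj_points[of "B *v x"] by (simp add: image_span inj)
  qed
  then show "(\<lambda>L. (*v) B ` L) \<in> space (sigma proj_points
      {U. U \<subseteq> proj_points \<and> open {x. x \<noteq> 0 \<and> span {x} \<in> U}}) \<rightarrow> proj_points"
    using space_proj_space unfolding proj_space_def by auto
  fix U :: "(real^'d) set set"
  assume U: "U \<in> {U. U \<subseteq> proj_points \<and> open {x. x \<noteq> 0 \<and> span {x} \<in> U}}"
  let ?V = "{L \<in> proj_points. (*v) B ` L \<in> U}"
  have "{x. x \<noteq> 0 \<and> span {x} \<in> ?V} = (*v) B -` {x. x \<noteq> 0 \<and> span {x} \<in> U}"
    using span_in_proj_points by (auto simp: image_span inj)
  moreover have "open ((*v) B -` {x. x \<noteq> 0 \<and> span {x} \<in> U})"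
    using U by (intro continuous_open_vimage) (auto intro: linear_continuous_at)
  ultimately have "?V \<in> sets proj_space"
    unfolding sets_proj_space by (intro sigma_sets.Basic) auto
  then show "(\<lambda>L. (*v) B ` L) -` U \<inter> space (sigma proj_points
      {U. U \<subseteq> proj_points \<and> open {x. x \<noteq> 0 \<and> span {x} \<in> U}}) \<in> sets (sigma proj_points
      {U. U \<subseteq> proj_points \<and> open {x. x \<noteq> 0 \<and> span {x} \<in> U}})"
    unfolding proj_space_def[symmetric] space_proj_space by (simp add: vimage_def Int_def conj_commute)
qed auto

context markov_cocycle
begin

lemma projective_comp_A: "projective f \<Longrightarrow> projective (\<lambda>x. f (A s *v x))"
  unfolding projective_def
proof (intro conjI allI impI; (elim conjE)?)
  assume f: "continuous_on (- {0}) f" "\<forall>c x. c \<noteq> 0 \<longrightarrow> x \<noteq> 0 \<longrightarrow> f (c *\<^sub>R x) = f x"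
  have "continuous_on (- {0}) (\<lambda>x. A s *v x)" by (intro linear_continuous_on) simp
  then show "continuous_on (- {0}) (\<lambda>x. f (A s *v x))"
    by (rule continuous_on_compose2[OF f(1)]) auto
  show "f (A s *v (c *\<^sub>R x)) = f (A s *v x)" if "c \<noteq> 0" "x \<noteq> 0" for c x
    using f(2) that by (simp add: matrix_vector_mult_scaleR)
qed

lemma projective_sum:
  "(\<And>t. projective (f t)) \<Longrightarrow> projective (\<lambda>x. \<Sum>t\<in>S. a t * f t x)"
  unfolding projective_def by (auto intro!: continuous_intros)

lemma projective_add: "projective f \<Longrightarrow> projective g \<Longrightarrow> projective (\<lambda>x. f x + g x)"
  unfolding projective_def by (auto intro!: continuous_intros)

definition growth :: "'s \<Rightarrow> real^'d \<Rightarrow> real" where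
  "growth s x = \<Lambda> (A s *v x) - \<Lambda> x"

lemma projective_growth: "projective (growth s)"
  unfolding projective_def growth_def
proof (intro conjI allI impI)
  have "continuous_on (- {0}) (\<lambda>x. A s *v x)" by (intro linear_continuous_on) simp
  then show "continuous_on (- {0}) (\<lambda>x. \<Lambda> (A s *v x) - \<Lambda> x)"
    unfolding \<Lambda>_def by (intro continuous_intros) auto
  show "\<Lambda> (A s *v (c *\<^sub>R x)) - \<Lambda> (c *\<^sub>R x) = \<Lambda> (A s *v x) - \<Lambda> x"
    if "c \<noteq> 0" "x \<noteq> 0" for c x
    using that by (simp add: matrix_vector_mult_scaleR \<Lambda>_scale)
qed

lemma D_Suc: "D (Suc n) s x = growth s x + Q (D n) s x"
proof -
  have "D (Suc n) s x = (\<Sum>t\<in>UNIV. trans_prob s t * ((Q ^^ n) (\<lambda>_. \<Lambda>) t (A s *v x))) - \<Lambda> x"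
    unfolding D_def Qn_Suc ..
  also have "\<dots> = (\<Sum>t\<in>UNIV. trans_prob s t * (D n t (A s *v x) + \<Lambda> (A s *v x))) - \<Lambda> x"
    by (simp add: D_def)
  also have "\<dots> = Q (D n) s x + (\<Sum>t\<in>UNIV. trans_prob s t) * \<Lambda> (A s *v x) - \<Lambda> x"
    by (simp add: Q_def distrib_left sum.distrib sum_distrib_right)
  finally show ?thesis by (simp add: sum_trans_prob growth_def)
qed

lemma projective_Q: "(\<And>t. projective (F t)) \<Longrightarrow> projective (Q F s)"
  unfolding Q_def[abs_def] by (intro projective_sum projective_comp_A)

lemma projective_D: "projective (D n s)"
proof (induction n arbitrary: s)
  case 0
  show ?case by (simp add: projective_def D_def)
next
  case (Suc n)
  have "D (Suc n) s = (\<lambda>x. growth s x + Q (D n) s x)" by (rule ext) (rule D_Suc)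
  then show ?case
    using projective_add[OF projective_growth projective_Q[of "D n"]] Suc by simp
qed

lemma skew_product_measurable: "skew_product M \<in> measurable (P \<Otimes>\<^sub>M proj_space) (P \<Otimes>\<^sub>M proj_space)"
proof -
  have "(\<lambda>z. (*v) (A (fst z 0)) ` snd z) \<in> measurable (P \<Otimes>\<^sub>M proj_space) proj_space"
  proof (rule measurable_compose_countable[where f = "\<lambda>s z. (*v) (A s) ` snd z" and g = "\<lambda>z. fst z 0"])
    show "(\<lambda>z. (*v) (A s) ` snd z) \<in> measurable (P \<Otimes>\<^sub>M proj_space) proj_space" for s
      by (rule measurable_compose[OF measurable_snd image_measurable]) simp
    show "(\<lambda>z. fst z 0) \<in> measurable (P \<Otimes>\<^sub>M proj_space) (count_space UNIV)"
      by measurable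
  qed
  then have "(\<lambda>z. (shift (fst z), (*v) (A (fst z 0)) ` snd z))
      \<in> measurable (P \<Otimes>\<^sub>M proj_space) (P \<Otimes>\<^sub>M proj_space)"
    by measurable
  moreover have "skew_product M = (\<lambda>z. (shift (fst z), (*v) (A (fst z 0)) ` snd z))"
    by (auto simp: skew_product_def normalized_rds_def M_eq_A fun_eq_iff)
  ultimately show ?thesis by simp
qed

end

locale markovian_invariant = markov_cocycle P M
  for P :: "(nat \<Rightarrow> 's::finite) measure" and M :: "(nat \<Rightarrow> 's) \<Rightarrow> real^'d^'d" +
  fixes \<nu> :: "((nat \<Rightarrow> 's) \<times> (real^'d) set) measure" and \<rho> :: "'s \<Rightarrow> (real^'d) set measure"
  assumes invariant: "invariant_measure P M \<nu>"
    and prob_\<rho>: "prob_space (\<rho> s)" and sets_\<rho>: "sets (\<rho> s) = sets proj_space"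
    and disintegration: "E \<in> sets P \<Longrightarrow> B \<in> sets proj_space \<Longrightarrow>
      emeasure \<nu> (E \<times> B) = (\<integral>\<^sup>+\<omega>\<in>E. emeasure (\<rho> (\<omega> 0)) B \<partial>P)"
begin

sublocale \<nu>: prob_space \<nu>
  using invariant by (simp add: invariant_measure_def)

lemma sets_\<nu> [measurable_cong]: "sets \<nu> = sets (P \<Otimes>\<^sub>M proj_space)"
  using invariant by (simp add: invariant_measure_def)

lemma space_\<nu>: "space \<nu> = UNIV \<times> proj_points"
  using sets_eq_imp_space_eq[OF sets_\<nu>] by (simp add: space_pair_measure space_proj_space)

lemma emeasure_rectangle:
  assumes E: "E \<in> sets P" "E \<subseteq> {\<omega>. \<omega> 0 = s}" and B: "B \<in> sets proj_space"
  shows "emeasure \<nu> (E \<times> B) = emeasure P E * emeasure (\<rho> s) B"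
proof -
  have "emeasure \<nu> (E \<times> B) = (\<integral>\<^sup>+\<omega>. emeasure (\<rho> s) B * indicator E \<omega> \<partial>P)"
    unfolding disintegration[OF E(1) B]
    using E(2) by (intro nn_integral_cong) (auto simp: indicator_def)
  also have "\<dots> = emeasure (\<rho> s) B * emeasure P E"
    using E(1) by (simp add: nn_integral_cmult_indicator)
  finally show ?thesis by (simp add: mult.commute)
qed

lemma projective_integrable:
  assumes "\<And>s t. projective (G s t)"
  shows "integrable \<nu> (\<lambda>z. G (fst z 0) (fst z (Suc 0)) (unit_rep (snd z)))"
proof -
  have "\<forall>s t. \<exists>b. \<forall>x. x \<noteq> 0 \<longrightarrow> \<bar>G s t x\<bar> \<le> b"
    using projective_bounded[OF assms] by metis
  then obtain b where b: "\<And>s t x. x \<noteq> 0 \<Longrightarrow> \<bar>G s t x\<bar> \<le> b s t" by metis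
  define m where "m = Max (range (\<lambda>(s, t). b s t))"
  have m: "b s t \<le> m" for s t
    unfolding m_def by (rule Max_ge) (auto intro!: image_eqI[of _ _ "(s, t)"])
  show ?thesis
  proof (rule \<nu>.integrable_const_bound[where B = m])
    show "AE z in \<nu>. norm (G (fst z 0) (fst z (Suc 0)) (unit_rep (snd z))) \<le> m"
    proof (rule AE_I2)
      fix z assume "z \<in> space \<nu>"
      then have "unit_rep (snd z) \<noteq> 0" by (auto simp: space_\<nu> unit_rep_nonzero)
      from b[OF this] m show "norm (G (fst z 0) (fst z (Suc 0)) (unit_rep (snd z))) \<le> m"
        by (metis order_trans real_norm_def)
    qed
    have "(\<lambda>z. G s t (unit_rep (snd z))) \<in> borel_measurable (P \<Otimes>\<^sub>M proj_space)" for s t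
      by (rule measurable_compose[OF measurable_snd projective_measurable[OF assms]])
    note Gm = this
    have coord: "(\<lambda>z. fst z i) \<in> measurable (P \<Otimes>\<^sub>M proj_space) (count_space UNIV)" for i
      by measurable
    have "(\<lambda>z. G (fst z 0) t (unit_rep (snd z))) \<in> borel_measurable (P \<Otimes>\<^sub>M proj_space)" for t
      by (rule measurable_compose_countable[where f = "\<lambda>s z. G s t (unit_rep (snd z))" and g = "\<lambda>z. fst z 0"])
        (rule Gm coord)+
    note Gm' = this
    have "(\<lambda>z. G (fst z 0) (fst z (Suc 0)) (unit_rep (snd z))) \<in> borel_measurable (P \<Otimes>\<^sub>M proj_space)"
      by (rule measurable_compose_countable[where f = "\<lambda>t z. G (fst z 0) t (unit_rep (snd z))"
          and g = "\<lambda>z. fst z (Suc 0)"]) (rule Gm' coord)+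
    then show "(\<lambda>z. G (fst z 0) (fst z (Suc 0)) (unit_rep (snd z))) \<in> borel_measurable \<nu>"
      by (simp add: measurable_cong_sets[OF sets_\<nu> refl])
  qed
qed

lemma integral_rectangle:
  assumes E: "E \<in> sets P" "E \<subseteq> {\<omega>. \<omega> 0 = s}" and f: "projective f"
  shows "(\<integral>z. indicator E (fst z) * f (unit_rep (snd z)) \<partial>\<nu>)
    = measure P E * (\<integral>L. f (unit_rep L) \<partial>\<rho> s)"
proof -
  let ?f = "\<lambda>L. f (unit_rep L)"
  note [measurable] = E(1) projective_measurable[OF f]
  have snd_m: "snd \<in> measurable \<nu> proj_space"
    by (simp add: measurable_cong_sets[OF sets_\<nu> refl])
  have ind: "(\<lambda>z. indicator E (fst z) :: real) \<in> borel_measurable \<nu>"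
    by measurable
  let ?N = "distr (density \<nu> (\<lambda>z. indicator E (fst z))) proj_space snd"
  let ?R = "density (\<rho> s) (\<lambda>_. emeasure P E)"
  have "?N = ?R"
  proof (rule measure_eqI)
    show "sets ?N = sets ?R" by (simp add: sets_\<rho>)
    fix B assume "B \<in> sets ?N"
    then have B: "B \<in> sets proj_space" by simp
    have EB: "E \<times> B \<in> sets \<nu>" using E B by (simp add: sets_\<nu>)
    have "emeasure ?N B = emeasure (density \<nu> (\<lambda>z. indicator E (fst z))) (snd -` B \<inter> space \<nu>)"
      using B snd_m by (subst emeasure_distr) auto
    also have "\<dots> = (\<integral>\<^sup>+z. indicator E (fst z) * indicator (snd -` B \<inter> space \<nu>) z \<partial>\<nu>)"
      using B snd_m by (subst emeasure_density) (auto intro: measurable_sets)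
    also have "\<dots> = (\<integral>\<^sup>+z. indicator (E \<times> B) z \<partial>\<nu>)"
      by (intro nn_integral_cong) (auto simp: indicator_def)
    also have "\<dots> = emeasure P E * emeasure (\<rho> s) B"
      using EB emeasure_rectangle[OF E B] by simp
    also have "\<dots> = emeasure ?R B"
      using B by (subst emeasure_density_const) (auto simp: sets_\<rho>)
    finally show "emeasure ?N B = emeasure ?R B" .
  qed
  have "(\<integral>z. indicator E (fst z) * ?f (snd z) \<partial>\<nu>)
      = (\<integral>z. ?f (snd z) \<partial>density \<nu> (\<lambda>z. ennreal (indicator E (fst z))))"
    using ind snd_m by (subst integral_density) auto
  also have "\<dots> = (\<integral>L. ?f L \<partial>?N)"
    using snd_m by (subst integral_distr) (auto simp: ennreal_indicator)
  also have "\<dots> = (\<integral>L. ?f L \<partial>density (\<rho> s) (\<lambda>_. ennreal (measure P E)))"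
    unfolding \<open>?N = ?R\<close> by (simp add: emeasure_eq_measure)
  also have "\<dots> = measure P E * (\<integral>L. ?f L \<partial>\<rho> s)"
    by (subst integral_density) (auto simp: measurable_cong_sets[OF sets_\<rho> refl])
  finally show ?thesis .
qed

text \<open>Under a Markovian measure the projective point depends on \<open>\<omega>\<close> through
  \<open>\<omega> 0\<close> alone, so conditionally on \<open>\<omega> 0\<close> it is independent of the next
  symbol.\<close>

lemma integral_next_symbol_\<nu>:
  assumes G: "\<And>s t. projective (G s t)"
  shows "(\<integral>z. G (fst z 0) (fst z (Suc 0)) (unit_rep (snd z)) \<partial>\<nu>)
    = (\<Sum>s\<in>UNIV. \<Sum>t\<in>UNIV. stat s * trans_prob s t * (\<integral>L. G s t (unit_rep L) \<partial>\<rho> s))"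
proof -
  let ?E = "\<lambda>s t. {\<omega>. \<omega> 0 = s \<and> \<omega> (Suc 0) = t}"
  have E: "?E s t \<in> sets P" for s t
  proof -
    have "{\<omega>\<in>space P. \<omega> 0 = s \<and> \<omega> (Suc 0) = t} \<in> sets P" by measurable
    then show ?thesis by simp
  qed
  have eq: "G (fst z 0) (fst z (Suc 0)) (unit_rep (snd z))
      = (\<Sum>s\<in>UNIV. \<Sum>t\<in>UNIV. indicator (?E s t) (fst z) * G s t (unit_rep (snd z)))" for z
  proof -
    have "(\<Sum>s\<in>UNIV. \<Sum>t\<in>UNIV. indicator (?E s t) (fst z) * G s t (unit_rep (snd z)))
        = (\<Sum>s\<in>UNIV. if s = fst z 0 then
            (\<Sum>t\<in>UNIV. if t = fst z (Suc 0) then G s t (unit_rep (snd z)) else 0) else 0)"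
      by (intro sum.cong refl) (auto simp: indicator_def intro!: sum.cong sum.neutral)
    then show ?thesis by simp
  qed
  have int: "integrable \<nu> (\<lambda>z. indicator (?E s t) (fst z) * G s t (unit_rep (snd z)))" for s t
  proof -
    let ?H = "\<lambda>s' t' x. if s' = s \<and> t' = t then G s t x else 0"
    have "projective (?H s' t')" for s' t'
    proof (cases "s' = s \<and> t' = t")
      case True
      then show ?thesis using G[of s t] by simp
    next
      case False
      then have "?H s' t' = (\<lambda>x. 0)" by auto
      then show ?thesis by (simp add: projective_def)
    qed
    have "integrable \<nu> (\<lambda>z. ?H (fst z 0) (fst z (Suc 0)) (unit_rep (snd z)))"
      by (rule projective_integrable[of ?H]) fact
    moreover have "(\<lambda>z. ?H (fst z 0) (fst z (Suc 0)) (unit_rep (snd z)))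
        = (\<lambda>z. indicator (?E s t) (fst z) * G s t (unit_rep (snd z)))"
      by (auto simp: indicator_def fun_eq_iff)
    ultimately show ?thesis by (simp only:)
  qed
  have "(\<integral>z. G (fst z 0) (fst z (Suc 0)) (unit_rep (snd z)) \<partial>\<nu>)
    = (\<Sum>s\<in>UNIV. \<Sum>t\<in>UNIV. \<integral>z. indicator (?E s t) (fst z) * G s t (unit_rep (snd z)) \<partial>\<nu>)"
  proof -
    have "(\<integral>z. G (fst z 0) (fst z (Suc 0)) (unit_rep (snd z)) \<partial>\<nu>)
      = (\<integral>z. (\<Sum>s\<in>UNIV. \<Sum>t\<in>UNIV. indicator (?E s t) (fst z) * G s t (unit_rep (snd z))) \<partial>\<nu>)"
      by (rule Bochner_Integration.integral_cong[OF refl eq])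
    also have "\<dots> = (\<Sum>s\<in>UNIV. \<integral>z. (\<Sum>t\<in>UNIV. indicator (?E s t) (fst z) * G s t (unit_rep (snd z))) \<partial>\<nu>)"
      by (rule Bochner_Integration.integral_sum) (intro Bochner_Integration.integrable_sum int)
    also have "\<dots> = (\<Sum>s\<in>UNIV. \<Sum>t\<in>UNIV. \<integral>z. indicator (?E s t) (fst z) * G s t (unit_rep (snd z)) \<partial>\<nu>)"
      by (intro sum.cong refl Bochner_Integration.integral_sum int)
    finally show ?thesis .
  qed
  also have "\<dots> = (\<Sum>s\<in>UNIV. \<Sum>t\<in>UNIV. stat s * trans_prob s t * (\<integral>L. G s t (unit_rep L) \<partial>\<rho> s))"
    by (intro sum.cong refl, subst integral_rectangle[OF E _ G])
      (auto simp: measure_two_coordinates)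
  finally show ?thesis .
qed

definition I :: "('s \<Rightarrow> real^'d \<Rightarrow> real) \<Rightarrow> real" where
  "I F = (\<integral>z. F (fst z 0) (unit_rep (snd z)) \<partial>\<nu>)"

text \<open>Invariance under the skew product says that the joint law of the first symbol and the projective
  point is stationary for \<open>Q\<close>: a step of the skew product reveals the next symbol, and
  integrating it out is an application of \<open>Q\<close>.\<close>

lemma I_Q:
  assumes F: "\<And>t. projective (F t)"
  shows "I (Q F) = I F"
proof -
  have FA: "projective (\<lambda>x. F t (A s *v x))" for s t
    by (rule projective_comp_A) (rule F)
  have F_int: "integrable (\<rho> s) (\<lambda>L. F t (A s *v unit_rep L))" for s t
  proof -
    interpret \<rho>: prob_space "\<rho> s" by (rule prob_\<rho>)
    obtain b where b: "\<And>x. x \<noteq> 0 \<Longrightarrow> \<bar>F t (A s *v x)\<bar> \<le> b"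
      by (rule projective_bounded[OF FA[of t s]]) (rule that)
    have sp: "space (\<rho> s) = proj_points"
      using sets_eq_imp_space_eq[OF sets_\<rho>] space_proj_space by metis
    show ?thesis
    proof (rule \<rho>.integrable_const_bound[where B = b])
      show "AE L in \<rho> s. norm (F t (A s *v unit_rep L)) \<le> b"
        using b unit_rep_nonzero by (intro AE_I2) (auto simp: sp)
      show "(\<lambda>L. F t (A s *v unit_rep L)) \<in> borel_measurable (\<rho> s)"
        using projective_measurable[OF FA] by (simp add: measurable_cong_sets[OF sets_\<rho> refl])
    qed
  qed
  have "I F = (\<integral>z. F (fst z 0) (unit_rep (snd z)) \<partial>distr \<nu> \<nu> (skew_product M))"
    unfolding I_def using invariant by (simp add: invariant_measure_def)
  also have "\<dots> = (\<integral>z. F (fst (skew_product M z) 0) (unit_rep (snd (skew_product M z))) \<partial>\<nu>)"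
  proof (rule integral_distr)
    show "skew_product M \<in> measurable \<nu> \<nu>"
      using skew_product_measurable by (simp add: measurable_cong_sets[OF sets_\<nu> sets_\<nu>])
    show "(\<lambda>z. F (fst z 0) (unit_rep (snd z))) \<in> borel_measurable \<nu>"
      using projective_integrable[of "\<lambda>s t. F s"] F by (intro borel_measurable_integrable) auto
  qed
  also have "\<dots> = (\<integral>z. F (fst z (Suc 0)) (A (fst z 0) *v unit_rep (snd z)) \<partial>\<nu>)"
  proof (rule Bochner_Integration.integral_cong[OF refl])
    fix z assume "z \<in> space \<nu>"
    then obtain \<omega> L where z: "z = (\<omega>, L)" and L: "L \<in> proj_points" by (auto simp: space_\<nu>)
    have "normalized_rds M 1 \<omega> L = span {A (\<omega> 0) *v unit_rep L}"
      using image_span[of "A (\<omega> 0)" "unit_rep L"] span_unit_rep[OF L]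
      by (simp add: normalized_rds_def M_eq_A)
    then show "F (fst (skew_product M z) 0) (unit_rep (snd (skew_product M z)))
        = F (fst z (Suc 0)) (A (fst z 0) *v unit_rep (snd z))"
      using projective_unit_rep_span[OF F] unit_rep_nonzero[OF L]
      by (simp add: z skew_product_def shift_def)
  qed
  also have "\<dots> = (\<Sum>s\<in>UNIV. \<Sum>t\<in>UNIV. stat s * trans_prob s t * (\<integral>L. F t (A s *v unit_rep L) \<partial>\<rho> s))"
    by (rule integral_next_symbol_\<nu>[of "\<lambda>s t x. F t (A s *v x)"]) (rule FA)
  also have "\<dots> = (\<Sum>s\<in>UNIV. \<Sum>t'\<in>UNIV. stat s * trans_prob s t' * (\<integral>L. Q F s (unit_rep L) \<partial>\<rho> s))"
  proof (rule sum.cong[OF refl])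
    fix s
    have Q_int: "(\<integral>L. Q F s (unit_rep L) \<partial>\<rho> s) = (\<Sum>t\<in>UNIV. trans_prob s t * (\<integral>L. F t (A s *v unit_rep L) \<partial>\<rho> s))"
      unfolding Q_def by (simp add: Bochner_Integration.integral_sum F_int)
    have "(\<Sum>t'\<in>UNIV. stat s * trans_prob s t' * a) = stat s * a" for a
      by (simp add: sum_trans_prob flip: sum_distrib_left sum_distrib_right)
    then show "(\<Sum>t\<in>UNIV. stat s * trans_prob s t * (\<integral>L. F t (A s *v unit_rep L) \<partial>\<rho> s))
        = (\<Sum>t'\<in>UNIV. stat s * trans_prob s t' * (\<integral>L. Q F s (unit_rep L) \<partial>\<rho> s))"
      by (simp only: Q_int) (simp only: sum_distrib_left mult.assoc)
  qed
  also have "\<dots> = I (Q F)"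
    unfolding I_def by (rule integral_next_symbol_\<nu>[symmetric]) (intro projective_Q F)
  finally show ?thesis by simp
qed

lemma I_D: "I (D n) = real n * I growth"
proof (induction n)
  case 0
  show ?case by (simp add: I_def D_def)
next
  case (Suc n)
  have "I (D (Suc n)) = I growth + I (Q (D n))"
    unfolding I_def D_Suc
    by (rule Bochner_Integration.integral_add)
      (rule projective_integrable[of "\<lambda>s t. growth s"] projective_integrable[of "\<lambda>s t. Q (D n) s"];
        intro projective_growth projective_Q projective_D)+
  then show ?case using I_Q[of "D n"] projective_D Suc by (simp add: distrib_right)
qed

text \<open>By stationarity the integral of \<open>D n\<close> is \<open>n\<close> times the integral of the
  one-step growth, whereas \<open>D n / n\<close> tends to \<open>\<beta>\<close> uniformly.\<close>

lemma furstenberg_formula: "(\<integral>(\<omega>, L). ln (norm (M \<omega> *v unit_rep L)) \<partial>\<nu>) = \<beta>"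
proof -
  have "\<bar>I growth - \<beta>\<bar> \<le> \<epsilon>" if "\<epsilon> > 0" for \<epsilon>
  proof -
    have "\<forall>\<^sub>F n in sequentially. n > 0 \<and> (\<forall>s x. x \<noteq> 0 \<longrightarrow> \<bar>D n s x - real n * \<beta>\<bar> \<le> real n * \<epsilon>)"
      using that by (intro eventually_conj eventually_gt_at_top D_uniform)
    then obtain n where n: "n > 0"
      "\<And>s x. x \<noteq> 0 \<Longrightarrow> \<bar>D n s x - real n * \<beta>\<bar> \<le> real n * \<epsilon>"
      unfolding eventually_sequentially by blast
    let ?D = "\<lambda>z. D n (fst z 0) (unit_rep (snd z))"
    have int: "integrable \<nu> ?D"
      by (rule projective_integrable[of "\<lambda>s t. D n s"]) (rule projective_D)
    have "I (D n) - real n * \<beta> = (\<integral>z. ?D z - real n * \<beta> \<partial>\<nu>)"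
      unfolding I_def using int by (simp add: \<nu>.prob_space)
    also have "\<bar>\<dots>\<bar> \<le> (\<integral>z. \<bar>?D z - real n * \<beta>\<bar> \<partial>\<nu>)"
      by (rule integral_abs_bound)
    also have "\<dots> \<le> (\<integral>z. real n * \<epsilon> \<partial>\<nu>)"
    proof (rule integral_mono)
      show "integrable \<nu> (\<lambda>z. \<bar>?D z - real n * \<beta>\<bar>)" using int by simp
      show "\<bar>?D z - real n * \<beta>\<bar> \<le> real n * \<epsilon>" if "z \<in> space \<nu>" for z
        using that n(2)[of "unit_rep (snd z)" "fst z 0"] unit_rep_nonzero[of "snd z"]
        by (auto simp: space_\<nu>)
    qed simp
    also have "\<dots> = real n * \<epsilon>" by (simp add: \<nu>.prob_space)
    finally have "\<bar>real n * I growth - real n * \<beta>\<bar> \<le> real n * \<epsilon>"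
      unfolding I_D .
    from abs_scaled_le[OF this n(1)] n(1) show ?thesis by simp
  qed
  then have "\<bar>I growth - \<beta>\<bar> \<le> 0" by (rule field_le_epsilon) simp
  moreover have "(\<integral>(\<omega>, L). ln (norm (M \<omega> *v unit_rep L)) \<partial>\<nu>) = I growth"
    unfolding I_def
    by (rule Bochner_Integration.integral_cong)
      (auto simp: space_\<nu> growth_def \<Lambda>_def M_eq_A unit_rep(2))
  ultimately show ?thesis by simp
qed

end

section \<open>Weak compactness of laws on a cube\<close>

text \<open>The function of Schoenberg's space-filling curve: it has period 2, is 0 on \<open>[0, 1/3]\<close>
  and 1 on \<open>[2/3, 1]\<close>. Truncating a cosine gives continuity and periodicity for free.\<close>

definition fold_tent :: "real \<Rightarrow> real" where
  "fold_tent t = max 0 (min 1 (1 / 2 - cos (pi * t)))"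

lemma fold_tent_bounds: "0 \<le> fold_tent t" "fold_tent t \<le> 1"
  by (auto simp: fold_tent_def)

lemma fold_tent_shift: "fold_tent (2 * real n + t) = fold_tent t"
proof -
  have "cos (pi * (2 * real n + t)) = cos (2 * real n * pi + pi * t)"
    by (simp add: algebra_simps)
  also have "\<dots> = cos (pi * t)"
    by (simp add: cos_add cos_2npi sin_2npi)
  finally show ?thesis by (simp add: fold_tent_def)
qed

lemma fold_tent_0:
  assumes "0 \<le> t" "t \<le> 1 / 3"
  shows "fold_tent t = 0"
proof -
  have "pi * t \<le> pi / 3" using assms(2) by (simp add: field_simps)
  then have "cos (pi / 3) \<le> cos (pi * t)"
    using assms by (intro cos_monotone_0_pi_le) auto
  then show ?thesis by (simp add: fold_tent_def cos_60)
qed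

lemma fold_tent_1:
  assumes "2 / 3 \<le> t" "t \<le> 1"
  shows "fold_tent t = 1"
proof -
  have "2 * pi / 3 \<le> pi * t" "pi * t \<le> pi" using assms by (simp_all add: field_simps)
  then have "cos (pi * t) \<le> cos (2 * pi / 3)"
    by (intro cos_monotone_0_pi_le) auto
  moreover have "cos (2 * pi / 3) = - (1 / 2)"
    using cos_pi_minus[of "pi / 3"] by (simp add: cos_60)
  ultimately show ?thesis by (simp add: fold_tent_def)
qed

text \<open>The point of the Cantor set with ternary digits \<open>2 * b i\<close>.\<close>

definition cantor_code :: "(nat \<Rightarrow> real) \<Rightarrow> real" where
  "cantor_code b = (\<Sum>i. 2 * b i / 3 ^ Suc i)"

lemma cantor_code_summable:
  assumes "\<And>i. b i \<in> {0, 1 :: real}"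
  shows "summable (\<lambda>i. 2 * b i / 3 ^ Suc i)"
proof (rule summable_comparison_test'[where N = 0])
  show "summable (\<lambda>i. 2 / 3 * (1 / 3 :: real) ^ i)"
    by (intro summable_mult summable_geometric) simp
  show "norm (2 * b i / 3 ^ Suc i) \<le> 2 / 3 * (1 / 3 :: real) ^ i" for i
    using assms[of i] by (auto simp: power_one_over field_simps)
qed

lemma cantor_code_bounds:
  assumes "\<And>i. b i \<in> {0, 1 :: real}"
  shows "0 \<le> cantor_code b" "cantor_code b \<le> 1"
proof -
  have b: "0 \<le> b i" "b i \<le> 1" for i using assms[of i] by auto
  show "0 \<le> cantor_code b"
    unfolding cantor_code_def using b by (intro suminf_nonneg cantor_code_summable assms) simp
  have "(\<lambda>i. 2 / 3 * (1 / 3 :: real) ^ i) sums (2 / 3 * (1 / (1 - 1 / 3)))"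
    by (intro sums_mult geometric_sums) simp
  then have s: "(\<lambda>i. 2 / 3 * (1 / 3 :: real) ^ i) sums 1" by simp
  have "cantor_code b \<le> (\<Sum>i. 2 / 3 * (1 / 3 :: real) ^ i)"
    unfolding cantor_code_def
  proof (intro suminf_le cantor_code_summable assms)
    show "2 * b i / 3 ^ Suc i \<le> 2 / 3 * (1 / 3 :: real) ^ i" for i
      using b[of i] by (simp add: power_one_over field_simps)
  qed (use s in \<open>simp add: sums_iff\<close>)
  then show "cantor_code b \<le> 1" using s by (simp add: sums_iff)
qed

lemma cantor_code_rec:
  assumes "\<And>i. b i \<in> {0, 1 :: real}"
  shows "3 * cantor_code b = 2 * b 0 + cantor_code (\<lambda>i. b (Suc i))"
proof -
  have s: "summable (\<lambda>i. 2 * b (Suc i) / 3 ^ Suc i)"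
    using cantor_code_summable[of "\<lambda>i. b (Suc i)"] assms by simp
  have "cantor_code b = 2 * b 0 / 3 + (\<Sum>i. 2 * b (Suc i) / 3 ^ Suc (Suc i))"
    unfolding cantor_code_def using suminf_split_head[OF cantor_code_summable[of b]] assms by simp
  also have "(\<Sum>i. 2 * b (Suc i) / 3 ^ Suc (Suc i)) = (\<Sum>i. 2 * b (Suc i) / 3 ^ Suc i / 3)"
    by simp
  also have "\<dots> = cantor_code (\<lambda>i. b (Suc i)) / 3"
    unfolding cantor_code_def by (rule suminf_divide[OF s])
  finally show ?thesis by simp
qed

text \<open>Multiplication by \<open>3 ^ m\<close> moves the digit with index \<open>m\<close> to the front:
  the digits before it become an even integer, which the period of \<open>fold_tent\<close> ignores, and the
  position of the remainder in the first or last third of the unit interval shows the digit.\<close>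

lemma fold_tent_decodes:
  assumes "\<And>i. b i \<in> {0, 1 :: real}"
  shows "fold_tent (3 ^ m * cantor_code b) = b m"
  using assms
proof (induction m arbitrary: b)
  case 0
  let ?c = "cantor_code (\<lambda>i. b (Suc i))"
  have c: "0 \<le> ?c" "?c \<le> 1" using cantor_code_bounds[of "\<lambda>i. b (Suc i)"] 0 by simp_all
  have r: "3 * cantor_code b = 2 * b 0 + ?c" by (rule cantor_code_rec[OF 0])
  from 0[of 0] show ?case
  proof
    assume b0: "b 0 = 0"
    then show ?thesis using r c by (simp add: fold_tent_0)
  next
    assume "b 0 \<in> {1}"
    then show ?thesis using r c by (simp add: fold_tent_1)
  qed
next
  case (Suc m)
  let ?c = "cantor_code (\<lambda>i. b (Suc i))"
  have IH: "fold_tent (3 ^ m * ?c) = b (Suc m)" using Suc.IH[of "\<lambda>i. b (Suc i)"] Suc.prems by simp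
  have r: "3 * cantor_code b = 2 * b 0 + ?c" by (rule cantor_code_rec[OF Suc.prems])
  have "3 ^ Suc m * cantor_code b = 3 ^ m * (3 * cantor_code b)" by simp
  also have "\<dots> = 2 * real (3 ^ m * nat \<lfloor>b 0\<rfloor>) + 3 ^ m * ?c"
    unfolding r using Suc.prems[of 0] by (auto simp: algebra_simps)
  finally show ?case using IH by (simp only: fold_tent_shift)
qed

definition bin_digit :: "nat \<Rightarrow> real \<Rightarrow> real" where
  "bin_digit k u = real_of_int \<lfloor>2 ^ Suc k * u\<rfloor> - 2 * real_of_int \<lfloor>2 ^ k * u\<rfloor>"

lemma bin_digit_cases: "bin_digit k u \<in> {0, 1}"
proof -
  let ?y = "2 ^ k * u"
  have "\<lfloor>2 * ?y\<rfloor> = 2 * \<lfloor>?y\<rfloor> \<or> \<lfloor>2 * ?y\<rfloor> = 2 * \<lfloor>?y\<rfloor> + 1" by linarith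
  then show ?thesis by (auto simp: bin_digit_def mult.assoc)
qed

lemma bin_digit_sums:
  assumes "0 \<le> u" "u < 1"
  shows "(\<lambda>k. (1 / 2) ^ Suc k * bin_digit k u) sums u"
proof -
  define f where "f k = real_of_int \<lfloor>2 ^ k * u\<rfloor> / 2 ^ k" for k
  have f0: "f 0 = 0" using assms by (simp add: f_def floor_eq_iff)
  have "f \<longlonglongrightarrow> u"
  proof (rule LIMSEQ_I)
    fix r :: real assume "r > 0"
    then obtain n0 where n0: "(1 / 2 :: real) ^ n0 < r"
      using real_arch_pow_inv[of r "1 / 2"] by auto
    have "norm (f n - u) < r" if "n \<ge> n0" for n
    proof -
      have "\<bar>real_of_int \<lfloor>2 ^ n * u\<rfloor> - 2 ^ n * u\<bar> \<le> 1" by linarith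
      then have "\<bar>real_of_int \<lfloor>2 ^ n * u\<rfloor> - 2 ^ n * u\<bar> / 2 ^ n \<le> 1 / 2 ^ n"
        by (rule divide_right_mono) simp
      moreover have "f n - u = (real_of_int \<lfloor>2 ^ n * u\<rfloor> - 2 ^ n * u) / 2 ^ n"
        unfolding f_def by (simp add: diff_divide_distrib)
      ultimately have "\<bar>f n - u\<bar> \<le> (1 / 2) ^ n"
        by (simp add: power_one_over)
      also have "\<dots> \<le> (1 / 2) ^ n0" using that by (intro power_decreasing) auto
      finally show ?thesis using n0 by simp
    qed
    then show "\<exists>no. \<forall>n\<ge>no. norm (f n - u) < r" by blast
  qed
  then have "(\<lambda>k. f (Suc k) - f k) sums (u - f 0)" by (rule telescope_sums)
  moreover have "f (Suc k) - f k = (1 / 2) ^ Suc k * bin_digit k u" for k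
  proof -
    have "a / 2 ^ Suc k - b / 2 ^ k = (1 / 2) ^ Suc k * (a - 2 * b)" for a b :: real
      by (simp add: power_one_over field_simps)
    then show ?thesis by (simp only: f_def bin_digit_def)
  qed
  ultimately show ?thesis by (simp add: f0)
qed

text \<open>Schoenberg's curve: coordinate \<open>j\<close> reads its binary digits from the ternary digits of
  \<open>t\<close> whose index encodes a pair with first component \<open>j\<close>.\<close>

definition cube_curve :: "real \<Rightarrow> real^'n::finite" where
  "cube_curve t = (\<chi> j. \<Sum>k. (1 / 2) ^ Suc k * fold_tent (3 ^ prod_encode (to_nat j, k) * t))"

text \<open>A measurable right inverse of \<open>cube_curve\<close> on the half-open unit cube, which
  interleaves the binary digits of the coordinates.\<close>

definition cube_address :: "real^'n::finite \<Rightarrow> real" where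
  "cube_address x = cantor_code (\<lambda>i. bin_digit (snd (prod_decode i)) (x $ from_nat (fst (prod_decode i))))"

lemma half_powers_sums: "(\<lambda>k. (1 / 2 :: real) ^ Suc k) sums 1"
  by (rule power_half_series)

lemma cube_curve_term_bound:
  "norm ((1 / 2) ^ Suc k * fold_tent t) \<le> (1 / 2 :: real) ^ Suc k"
  using fold_tent_bounds[of t] by (simp add: mult_left_le)

lemma cube_curve_summable: "summable (\<lambda>k. (1 / 2) ^ Suc k * fold_tent (c k * t))"
  by (rule summable_comparison_test'[where N = 0 and g = "\<lambda>k. (1 / 2 :: real) ^ Suc k"])
    (rule sums_summable[OF half_powers_sums], rule cube_curve_term_bound)

lemma continuous_cube_curve: "continuous_on UNIV (cube_curve :: real \<Rightarrow> real^'n::finite)"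
  unfolding cube_curve_def
proof (rule continuous_on_vec_lambda)
  fix j :: 'n
  let ?f = "\<lambda>k t. (1 / 2) ^ Suc k * fold_tent (3 ^ prod_encode (to_nat j, k) * t)"
  show "continuous_on UNIV (\<lambda>t. \<Sum>k. ?f k t)"
  proof (rule uniform_limit_theorem)
    show "uniform_limit UNIV (\<lambda>n t. \<Sum>k<n. ?f k t) (\<lambda>t. \<Sum>k. ?f k t) sequentially"
      by (rule Weierstrass_m_test[where M = "\<lambda>k. (1 / 2) ^ Suc k"])
        (rule cube_curve_term_bound, rule sums_summable[OF half_powers_sums])
    show "\<forall>\<^sub>F n in sequentially. continuous_on UNIV (\<lambda>t. \<Sum>k<n. ?f k t)"
      unfolding fold_tent_def by (intro always_eventually allI continuous_intros)
  qed simp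
qed

lemma cube_curve_bounds: "0 \<le> cube_curve t $ j" "cube_curve t $ j \<le> 1"
proof -
  let ?f = "\<lambda>k. (1 / 2) ^ Suc k * fold_tent (3 ^ prod_encode (to_nat j, k) * t)"
  have s: "summable ?f" by (rule cube_curve_summable)
  show "0 \<le> cube_curve t $ j"
  proof -
    have "0 \<le> suminf ?f"
      by (rule suminf_nonneg[OF s]) (use fold_tent_bounds in simp)
    then show ?thesis unfolding cube_curve_def by (simp only: vec_lambda_beta)
  qed
  have "suminf ?f \<le> (\<Sum>k. (1 / 2 :: real) ^ Suc k)"
  proof (rule suminf_le[OF _ s])
    show "?f k \<le> (1 / 2 :: real) ^ Suc k" for k
      using fold_tent_bounds by (intro mult_left_le) auto
    show "summable (\<lambda>k. (1 / 2 :: real) ^ Suc k)"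
      by (rule sums_summable[OF half_powers_sums])
  qed
  also have "\<dots> = 1" by (rule sums_unique[OF half_powers_sums, symmetric])
  finally show "cube_curve t $ j \<le> 1"
    unfolding cube_curve_def by (simp only: vec_lambda_beta)
qed

lemma cube_curve_address:
  assumes "\<And>j. 0 \<le> x $ j" "\<And>j. x $ j < 1"
  shows "cube_curve (cube_address x) = x"
proof (subst vec_eq_iff, intro allI)
  fix j
  let ?b = "\<lambda>i. bin_digit (snd (prod_decode i)) (x $ from_nat (fst (prod_decode i)))"
  have "fold_tent (3 ^ prod_encode (to_nat j, k) * cube_address x) = bin_digit k (x $ j)" for k
    unfolding cube_address_def using fold_tent_decodes[of ?b] bin_digit_cases by simp
  then show "cube_curve (cube_address x) $ j = x $ j"
    using sums_unique[OF bin_digit_sums[of "x $ j"]] assms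
    by (simp only: cube_curve_def vec_lambda_beta)
qed

lemma cube_address_bounds: "0 \<le> cube_address x" "cube_address x \<le> 1"
  unfolding cube_address_def by (rule cantor_code_bounds, rule bin_digit_cases)+

lemma cube_address_measurable [measurable]: "cube_address \<in> borel_measurable borel"
proof -
  have "(\<lambda>x :: real^'n. x $ j) \<in> borel_measurable borel" for j
    by (intro borel_measurable_continuous_onI continuous_intros)
  note [measurable] = this
  have "(\<lambda>x :: real^'n. bin_digit k (x $ j)) \<in> borel_measurable borel" for k j
    unfolding bin_digit_def by measurable
  note [measurable] = this
  show ?thesis
    unfolding cube_address_def[abs_def] cantor_code_def by measurable
qed

text \<open>The laws of the addresses live on the unit interval, so Helly's theorem provides a weak limit
  \<open>m\<close> on the line. A continuous function of a point of the cube is a continuous function of its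
  address, by way of \<open>cube_curve\<close>.\<close>

theorem cube_laws_compact:
  fixes Y :: "nat \<Rightarrow> 'b \<Rightarrow> real^'n::finite"
  assumes N: "\<And>n. prob_space (N n)" and Y: "\<And>n. Y n \<in> borel_measurable (N n)"
    and cube: "\<And>n z j. 0 \<le> Y n z $ j" "\<And>n z j. Y n z $ j < 1"
  obtains r m where "strict_mono (r :: nat \<Rightarrow> nat)" "real_distribution m"
    "\<And>f :: real^'n \<Rightarrow> real. \<And>B. continuous_on UNIV f \<Longrightarrow> (\<And>t. \<bar>f (cube_curve t)\<bar> \<le> B) \<Longrightarrow>
      (\<lambda>n. \<integral>z. f (Y (r n) z) \<partial>N (r n)) \<longlonglongrightarrow> (\<integral>t. f (cube_curve t) \<partial>m)"
proof -
  define \<mu> where "\<mu> n = distr (N n) borel (\<lambda>z. cube_address (Y n z))" for n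
  have addr: "(\<lambda>z. cube_address (Y n z)) \<in> borel_measurable (N n)" for n
    by (rule measurable_compose[OF Y]) measurable
  have \<mu>: "real_distribution (\<mu> n)" for n
    unfolding \<mu>_def real_distribution_def real_distribution_axioms_def
    using prob_space.prob_space_distr[OF N addr] by simp
  have "tight \<mu>"
    unfolding tight_def
  proof (intro conjI allI impI)
    fix e :: real assume "e > 0"
    have "measure (\<mu> n) {- 1<..1} = 1" for n
    proof -
      have "measure (\<mu> n) {- 1<..1}
          = measure (N n) ((\<lambda>z. cube_address (Y n z)) -` {- 1<..1} \<inter> space (N n))"
        unfolding \<mu>_def by (rule measure_distr[OF addr]) simp
      also have "(\<lambda>z. cube_address (Y n z)) -` {- 1<..1} \<inter> space (N n) = space (N n)"
      proof -
        have "cube_address (Y n z) \<in> {- 1<..1}" for z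
          using cube_address_bounds[of "Y n z"] by simp
        then show ?thesis by auto
      qed
      finally show ?thesis using prob_space.prob_space[OF N] by simp
    qed
    then show "\<exists>a b. a < b \<and> (\<forall>n. 1 - e < measure (\<mu> n) {a<..b})"
      using \<open>e > 0\<close> by (intro exI[of _ "- 1"] exI[of _ 1]) simp
  qed (rule \<mu>)
  then obtain r m where r: "strict_mono (r :: nat \<Rightarrow> nat)" and m: "real_distribution m"
    and conv: "weak_conv_m (\<mu> \<circ> id \<circ> r) m"
    using tight_imp_convergent_subsubsequence[of \<mu> id] by (auto simp: strict_mono_def)
  have "(\<lambda>n. \<integral>z. f (Y (r n) z) \<partial>N (r n)) \<longlonglongrightarrow> (\<integral>t. f (cube_curve t) \<partial>m)"
    if f: "continuous_on UNIV f" and B: "\<And>t. \<bar>f (cube_curve t)\<bar> \<le> B" for f :: "real^'n \<Rightarrow> real" and B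
  proof -
    have fc: "continuous_on UNIV (\<lambda>t. f (cube_curve t))"
      by (rule continuous_on_compose2[OF f continuous_cube_curve]) simp
    have "(\<lambda>n. \<integral>t. f (cube_curve t) \<partial>(\<mu> \<circ> id \<circ> r) n) \<longlonglongrightarrow> (\<integral>t. f (cube_curve t) \<partial>m)"
    proof (rule weak_conv_imp_integral_bdd_continuous_conv[OF _ m conv])
      show "real_distribution ((\<mu> \<circ> id \<circ> r) n)" for n using \<mu> by simp
      show "isCont (\<lambda>t. f (cube_curve t)) t" for t
        using fc by (simp add: continuous_on_eq_continuous_at)
      show "norm (f (cube_curve t)) \<le> B" for t using B by simp
    qed
    moreover have "(\<integral>t. f (cube_curve t) \<partial>(\<mu> \<circ> id \<circ> r) n) = (\<integral>z. f (Y (r n) z) \<partial>N (r n))" for n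
    proof -
      have "(\<integral>t. f (cube_curve t) \<partial>\<mu> (r n)) = (\<integral>z. f (cube_curve (cube_address (Y (r n) z))) \<partial>N (r n))"
        unfolding \<mu>_def by (rule integral_distr[OF addr]) (rule borel_measurable_continuous_onI[OF fc])
      also have "\<dots> = (\<integral>z. f (Y (r n) z) \<partial>N (r n))"
        by (simp add: cube_curve_address cube)
      finally show ?thesis by simp
    qed
    ultimately show ?thesis by simp
  qed
  with r m show ?thesis by (rule that)
qed

section \<open>Existence of a Markovian invariant measure\<close>

text \<open>Uniqueness of measures for countably additive set functions that are not presented as measures,
  such as combinations of preimages.\<close>

lemma countably_additive_eqI:
  fixes f g :: "'a set \<Rightarrow> real"
  assumes G: "Int_stable G" "G \<subseteq> Pow \<Omega>"
    and f: "\<And>E. range E \<subseteq> sigma_sets \<Omega> G \<Longrightarrow> disjoint_family E \<Longrightarrow> (\<lambda>i::nat. f (E i)) sums f (\<Union>i. E i)"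
    and g: "\<And>E. range E \<subseteq> sigma_sets \<Omega> G \<Longrightarrow> disjoint_family E \<Longrightarrow> (\<lambda>i::nat. g (E i)) sums g (\<Union>i. E i)"
    and eq: "f \<Omega> = g \<Omega>" "\<And>E. E \<in> G \<Longrightarrow> f E = g E"
    and "A \<in> sigma_sets \<Omega> G"
  shows "f A = g A"
proof -
  have h_empty: "h {} = 0"
    if h: "\<And>E. range E \<subseteq> sigma_sets \<Omega> G \<Longrightarrow> disjoint_family E \<Longrightarrow> (\<lambda>i::nat. h (E i)) sums h (\<Union>i. E i)"
    for h :: "'a set \<Rightarrow> real"
  proof -
    have "(\<lambda>i::nat. h {}) sums h (\<Union>i::nat. {})"
      by (rule h) (auto simp: disjoint_family_on_def intro: sigma_sets.Empty)
    then have "(\<lambda>i::nat. h {}) \<longlonglongrightarrow> 0" by (intro summable_LIMSEQ_zero sums_summable)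
    then show ?thesis by (simp add: LIMSEQ_const_iff)
  qed
  have h_compl: "h (\<Omega> - E) = h \<Omega> - h E"
    if h: "\<And>E. range E \<subseteq> sigma_sets \<Omega> G \<Longrightarrow> disjoint_family E \<Longrightarrow> (\<lambda>i::nat. h (E i)) sums h (\<Union>i. E i)"
      and E: "E \<in> sigma_sets \<Omega> G"
    for h :: "'a set \<Rightarrow> real" and E
  proof -
    let ?B = "\<lambda>i::nat. if i = 0 then E else if i = 1 then \<Omega> - E else {}"
    have "E \<subseteq> \<Omega>" using sigma_sets_into_sp[OF G(2) E] .
    have "(\<lambda>i. h (?B i)) sums h (\<Union>i. ?B i)"
      by (rule h) (use E in \<open>auto simp: disjoint_family_on_def intro: sigma_sets.Empty sigma_sets.Compl\<close>)
    moreover have "(\<Union>i. ?B i) = \<Omega>"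
    proof
      show "(\<Union>i. ?B i) \<subseteq> \<Omega>" using \<open>E \<subseteq> \<Omega>\<close> by auto
      have "?B 0 \<union> ?B 1 \<subseteq> (\<Union>i. ?B i)" by blast
      then show "\<Omega> \<subseteq> (\<Union>i. ?B i)" by auto
    qed
    moreover have "(\<lambda>i. h (?B i)) sums (\<Sum>i\<in>{0, 1}. h (?B i))"
      by (rule sums_finite) (use h_empty[OF h] in auto)
    ultimately have "h \<Omega> = h E + h (\<Omega> - E)"
      using sums_unique2 by fastforce
    then show ?thesis by simp
  qed
  show ?thesis
    using G \<open>A \<in> sigma_sets \<Omega> G\<close>
  proof (induction rule: sigma_sets_induct_disjoint)
    case (basic E)
    then show ?case by (rule eq(2))
  next
    case empty
    show ?case using h_empty[OF f] h_empty[OF g] by simp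
  next
    case (compl E)
    then show ?case using h_compl[OF f] h_compl[OF g] eq(1) by simp
  next
    case (union E)
    then have "(\<lambda>i. f (E i)) sums f (\<Union>i. E i)" "(\<lambda>i. f (E i)) sums g (\<Union>i. E i)"
      using f[of E] g[of E] by simp_all
    then show ?case by (rule sums_unique2)
  qed
qed

lemma cylinder_Cons: "\<omega> \<in> cylinder (s # w) \<longleftrightarrow> \<omega> 0 = s \<and> shift \<omega> \<in> cylinder w"
  by (simp add: cylinder_def shift_def All_less_Suc2)

lemma Int_stable_cylinders: "Int_stable (insert {} (range (cylinder :: 's list \<Rightarrow> (nat \<Rightarrow> 's) set)))"
proof -
  have nested: "cylinder w \<inter> cylinder w' \<in> insert {} (range cylinder)"
    if "length w \<le> length w'" for w w' :: "'s list"
  proof (cases "\<forall>i<length w. w ! i = w' ! i")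
    case True
    then have "cylinder w \<inter> cylinder w' = cylinder w'"
      using that by (auto simp: cylinder_def)
    then show ?thesis by auto
  next
    case False
    then obtain i where i: "i < length w" "w ! i \<noteq> w' ! i" by auto
    have "cylinder w \<inter> cylinder w' = {}"
    proof -
      have False if "\<omega> \<in> cylinder w" "\<omega> \<in> cylinder w'" for \<omega>
      proof -
        have "\<omega> i = w ! i" "\<omega> i = w' ! i"
          using that i \<open>length w \<le> length w'\<close> by (auto simp: cylinder_def)
        with i show False by simp
      qed
      then show ?thesis by blast
    qed
    then show ?thesis by simp
  qed
  have "cylinder w \<inter> cylinder w' \<in> insert {} (range cylinder)" for w w' :: "'s list"
    using nested[of w w'] nested[of w' w] by (metis Int_commute nat_le_linear)
  then show ?thesis
    unfolding Int_stable_def by blast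
qed

lemma sets_seq_space_cylinders:
  "sets seq_space = sigma_sets UNIV (insert {} (range (cylinder :: 's::finite list \<Rightarrow> _)))"
proof
  let ?S = "sigma_sets UNIV (insert {} (range (cylinder :: 's list \<Rightarrow> _)))"
  interpret sigma_algebra UNIV ?S by (rule sigma_algebra_sigma_sets) auto
  have coord: "{\<omega>. \<omega> i \<in> A} \<in> ?S" for i and A :: "'s set"
  proof -
    let ?W = "{w. length w = Suc i \<and> w ! i \<in> A}"
    have "finite ?W"
      using finite_lists_length_eq[of "UNIV :: 's set" "Suc i"] by (rule rev_finite_subset) auto
    then have "(\<Union>w\<in>?W. cylinder w) \<in> ?S"
      by (rule finite_UN) (auto intro: sigma_sets.Basic)
    moreover have "(\<Union>w\<in>?W. cylinder w) = {\<omega>. \<omega> i \<in> A}"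
    proof (intro equalityI subsetI)
      fix \<omega> assume "\<omega> \<in> {\<omega>. \<omega> i \<in> A}"
      then have "map \<omega> [0..<Suc i] \<in> ?W" "\<omega> \<in> cylinder (map \<omega> [0..<Suc i])"
        by (auto simp: cylinder_def nth_append less_Suc_eq)
      then show "\<omega> \<in> (\<Union>w\<in>?W. cylinder w)" by blast
    qed (auto simp: cylinder_def)
    ultimately show ?thesis by simp
  qed
  show "sets seq_space \<subseteq> ?S"
    unfolding seq_space_def sets_PiM_single
    by (simp, rule sigma_sets_subset) (auto simp: coord)
  have cyl: "cylinder w \<in> sets seq_space" for w :: "'s list"
  proof -
    have [measurable]: "(\<lambda>\<omega>. \<omega> i) \<in> measurable seq_space (count_space (UNIV :: 's set))" for i
      unfolding seq_space_def by measurable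
    have "{\<omega>\<in>space seq_space. \<forall>i\<in>{..<length w}. \<omega> i = w ! i} \<in> sets seq_space" by measurable
    then show ?thesis by (simp add: cylinder_def Ball_def seq_space_def space_PiM)
  qed
  have "sigma_sets (space seq_space) (insert {} (range (cylinder :: 's list \<Rightarrow> _))) \<subseteq> sets seq_space"
    using cyl by (intro sets.sigma_sets_subset) auto
  then show "?S \<subseteq> sets seq_space" by (simp add: seq_space_def space_PiM)
qed

context markov_shift
begin

text \<open>The identity for cylinders is \<open>measure_cylinder_Cons\<close>; both sides are countably
  additive in \<open>E\<close>.\<close>

lemma measure_prepend_symbol:
  assumes "E \<in> sets P"
  shows "measure P {\<omega>. \<omega> 0 = s \<and> \<omega> (Suc 0) = t \<and> shift \<omega> \<in> E}
    = stat s * trans_prob s t / stat t * measure P {\<omega> \<in> E. \<omega> 0 = t}"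
proof -
  let ?G = "insert {} (range (cylinder :: 's list \<Rightarrow> _))"
  let ?f = "\<lambda>E. measure P {\<omega>. \<omega> 0 = s \<and> \<omega> (Suc 0) = t \<and> shift \<omega> \<in> E}"
  let ?g = "\<lambda>E. stat s * trans_prob s t / stat t * measure P {\<omega> \<in> E. \<omega> 0 = t}"
  have S: "sets P = sigma_sets UNIV ?G" using sets_P sets_seq_space_cylinders by simp
  have f_sets: "{\<omega>. \<omega> 0 = s \<and> \<omega> (Suc 0) = t \<and> shift \<omega> \<in> E} \<in> sets P" if "E \<in> sets P" for E
  proof -
    note [measurable] = that
    have "{\<omega>\<in>space P. \<omega> 0 = s \<and> \<omega> (Suc 0) = t \<and> shift \<omega> \<in> E} \<in> sets P" by measurable
    then show ?thesis by simp
  qed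
  have g_sets: "{\<omega> \<in> E. \<omega> 0 = t} \<in> sets P" if "E \<in> sets P" for E
  proof -
    have "{\<omega>\<in>space P. \<omega> 0 = t} \<in> sets P" by measurable
    then have "E \<inter> {\<omega>. \<omega> 0 = t} \<in> sets P" using that by auto
    then show ?thesis by (simp add: Int_def)
  qed
  show ?thesis
  proof (rule countably_additive_eqI[OF Int_stable_cylinders, of UNIV ?f ?g])
    show "?G \<subseteq> Pow UNIV" by simp
    show "E \<in> sigma_sets UNIV ?G" using assms S by simp
    show "(\<lambda>i::nat. ?f (F i)) sums ?f (\<Union>i. F i)"
      if "range F \<subseteq> sigma_sets UNIV ?G" "disjoint_family F" for F
    proof -
      let ?F = "\<lambda>i. {\<omega>. \<omega> 0 = s \<and> \<omega> (Suc 0) = t \<and> shift \<omega> \<in> F i}"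
      have "(\<lambda>i. measure P (?F i)) sums measure P (\<Union>i. ?F i)"
        by (rule finite_measure_UNION)
          (use that S f_sets in \<open>auto simp: disjoint_family_on_def\<close>)
      moreover have "(\<Union>i. ?F i) = {\<omega>. \<omega> 0 = s \<and> \<omega> (Suc 0) = t \<and> shift \<omega> \<in> (\<Union>i. F i)}" by auto
      ultimately show ?thesis by simp
    qed
    show "(\<lambda>i::nat. ?g (F i)) sums ?g (\<Union>i. F i)"
      if "range F \<subseteq> sigma_sets UNIV ?G" "disjoint_family F" for F
    proof -
      let ?F = "\<lambda>i. {\<omega> \<in> F i. \<omega> 0 = t}"
      have "(\<lambda>i. measure P (?F i)) sums measure P (\<Union>i. ?F i)"
        by (rule finite_measure_UNION)
          (use that S g_sets in \<open>auto simp: disjoint_family_on_def\<close>)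
      moreover have "(\<Union>i. ?F i) = {\<omega> \<in> (\<Union>i. F i). \<omega> 0 = t}" by auto
      ultimately show ?thesis by (intro sums_mult) simp
    qed
    show all: "?f UNIV = ?g UNIV"
    proof -
      have l: "{\<omega>. \<omega> 0 = s \<and> \<omega> (Suc 0) = t \<and> shift \<omega> \<in> UNIV} = {\<omega>. \<omega> 0 = s \<and> \<omega> (Suc 0) = t}"
        and r: "{\<omega> \<in> UNIV. \<omega> 0 = t} = {\<omega>. \<omega> 0 = t}" by simp_all
      show ?thesis
        unfolding l r measure_two_coordinates measure_coordinate using stat_pos[of t] by simp
    qed
    show "?f F = ?g F" if F: "F \<in> ?G" for F
    proof (cases "F = {}")
      case True
      then show ?thesis by simp
    next
      case False
      then obtain v where v: "F = cylinder v" using F by auto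
      show ?thesis
      proof (cases v)
        case Nil
        then have "F = UNIV" by (simp add: v cylinder_def)
        then show ?thesis using all by (simp only:)
      next
        case (Cons a w)
        have 3: "F = cylinder (a # w)" using v Cons by simp
        show ?thesis
        proof (cases "a = t")
          case True
          have "{\<omega>. \<omega> 0 = s \<and> \<omega> (Suc 0) = t \<and> shift \<omega> \<in> F} = cylinder (s # t # w)"
            unfolding 3 True by (rule set_eqI) (auto simp: cylinder_Cons shift_def)
          moreover have "{\<omega> \<in> F. \<omega> 0 = t} = cylinder (t # w)"
            unfolding 3 True by (auto simp: cylinder_Cons)
          ultimately show ?thesis using measure_cylinder_Cons[of s t w] by simp
        next
          case False
          then have none: "{\<omega>. \<omega> 0 = s \<and> \<omega> (Suc 0) = t \<and> shift \<omega> \<in> F} = {}" "{\<omega> \<in> F. \<omega> 0 = t} = {}"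
            unfolding 3 by (auto simp: cylinder_Cons shift_def)
          show ?thesis unfolding none by simp
        qed
      qed
    qed
  qed
qed

end

context markov_cocycle
begin

lemma measurable_image_A: "(\<lambda>L. (*v) (A s) ` L) \<in> measurable proj_space proj_space"
  by (rule image_measurable) simp

lemma image_A_sets:
  assumes "B \<in> sets proj_space"
  shows "{L \<in> proj_points. (*v) (A s) ` L \<in> B} \<in> sets proj_space"
  using measurable_sets[OF measurable_image_A assms, of s]
  by (simp add: space_proj_space vimage_def Int_def conj_commute)

text \<open>The measure is the law of \<open>(\<omega>, y (\<omega> 0))\<close>, where \<open>\<omega>\<close>
  has law \<open>P\<close> and, independently, \<open>y\<close> has independent components \<open>y s\<close>
  with law \<open>\<rho> s\<close>. It suffices to test invariance on rectangles \<open>E \<times> B\<close>.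
  The preimage under the skew product splits according to the symbol \<open>s\<close> that is shifted away and
  the next symbol \<open>t\<close>, and \<open>measure_prepend_symbol\<close> reduces the sum over
  \<open>s\<close> to stationarity of \<open>\<rho>\<close>.\<close>

lemma invariant_from_stationary:
  fixes \<rho> :: "'s \<Rightarrow> (real^'d) set measure"
  assumes prob_\<rho>: "\<And>s. prob_space (\<rho> s)" and sets_\<rho>: "\<And>s. sets (\<rho> s) = sets proj_space"
    and stationary: "\<And>t B. B \<in> sets proj_space \<Longrightarrow> stat t * measure (\<rho> t) B
      = (\<Sum>s\<in>UNIV. stat s * trans_prob s t * measure (\<rho> s) {L \<in> proj_points. (*v) (A s) ` L \<in> B})"
  shows "\<exists>\<nu>. invariant_measure P M \<nu> \<and> markovian_disintegration P \<nu>"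
proof -
  define Y where "Y = Pi\<^sub>M UNIV \<rho>"
  interpret \<rho>: product_prob_space \<rho> UNIV
    using prob_\<rho> by (intro product_prob_spaceI)
  interpret Y: prob_space Y unfolding Y_def by (rule \<rho>.prob_space_axioms)
  interpret PY: pair_prob_space P Y ..
  have space_\<rho>: "space (\<rho> s) = proj_points" for s
    using sets_eq_imp_space_eq[OF sets_\<rho>] space_proj_space by metis
  define h where "h = (\<lambda>z :: (nat \<Rightarrow> 's) \<times> ('s \<Rightarrow> (real^'d) set). (fst z, snd z (fst z 0)))"
  have comp: "(\<lambda>y. y s) \<in> measurable Y proj_space" for s
  proof -
    have "(\<lambda>y. y s) \<in> measurable Y (\<rho> s)" unfolding Y_def by measurable
    then show ?thesis using measurable_cong_sets[OF refl sets_\<rho>] by blast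
  qed
  have "(\<lambda>z. snd z (fst z 0)) \<in> measurable (P \<Otimes>\<^sub>M Y) proj_space"
  proof (rule measurable_compose_countable[where f = "\<lambda>s z. snd z s" and g = "\<lambda>z. fst z 0"])
    show "(\<lambda>z. snd z s) \<in> measurable (P \<Otimes>\<^sub>M Y) proj_space" for s
      by (rule measurable_compose[OF measurable_snd comp])
    show "(\<lambda>z. fst z 0) \<in> measurable (P \<Otimes>\<^sub>M Y) (count_space UNIV)" by measurable
  qed
  then have h: "h \<in> measurable (P \<Otimes>\<^sub>M Y) (P \<Otimes>\<^sub>M proj_space)"
    unfolding h_def by measurable
  define \<nu> where "\<nu> = distr (P \<Otimes>\<^sub>M Y) (P \<Otimes>\<^sub>M proj_space) h"
  interpret \<nu>: prob_space \<nu>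
    unfolding \<nu>_def by (rule PY.prob_space_distr[OF h])
  have sets_\<nu>: "sets \<nu> = sets (P \<Otimes>\<^sub>M proj_space)" by (simp add: \<nu>_def)
  have space_\<nu>: "space \<nu> = UNIV \<times> proj_points"
    by (simp add: \<nu>_def space_pair_measure space_proj_space)
  have Es: "E \<inter> {\<omega>. \<omega> 0 = s} \<in> sets P" if "E \<in> sets P" for E s
  proof -
    have "{\<omega>\<in>space P. \<omega> 0 = s} \<in> sets P" by measurable
    then show ?thesis using that by auto
  qed
  have rect: "measure \<nu> (E \<times> B) = (\<Sum>s\<in>UNIV. measure P (E \<inter> {\<omega>. \<omega> 0 = s}) * measure (\<rho> s) B)"
    if E: "E \<in> sets P" and B: "B \<in> sets proj_space" for E B
  proof -
    let ?C = "\<lambda>s. {y \<in> space Y. y s \<in> B}"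
    have C: "?C s \<in> sets Y" for s
      using measurable_sets[OF comp B, of s] by (simp add: vimage_def Int_def conj_commute)
    have C_measure: "measure Y (?C s) = measure (\<rho> s) B" for s
      using \<rho>.emeasure_PiM_Collect_single[of s B] B unfolding Y_def
      by (simp add: measure_def sets_\<rho>)
    have "measure \<nu> (E \<times> B) = measure (P \<Otimes>\<^sub>M Y) (h -` (E \<times> B) \<inter> space (P \<Otimes>\<^sub>M Y))"
      unfolding \<nu>_def using E B by (intro measure_distr h) auto
    also have "h -` (E \<times> B) \<inter> space (P \<Otimes>\<^sub>M Y) = (\<Union>s\<in>UNIV. (E \<inter> {\<omega>. \<omega> 0 = s}) \<times> ?C s)"
      by (auto simp: h_def space_pair_measure)
    also have "measure (P \<Otimes>\<^sub>M Y) \<dots> = (\<Sum>s\<in>UNIV. measure (P \<Otimes>\<^sub>M Y) ((E \<inter> {\<omega>. \<omega> 0 = s}) \<times> ?C s))"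
      by (rule PY.finite_measure_finite_Union)
        (use Es[OF E] C in \<open>auto simp: disjoint_family_on_def\<close>)
    also have "\<dots> = (\<Sum>s\<in>UNIV. measure P (E \<inter> {\<omega>. \<omega> 0 = s}) * measure Y (?C s))"
      using Es[OF E] C by (intro sum.cong refl) (simp add: measure_def Y.emeasure_pair_measure_Times enn2real_mult)
    finally show ?thesis by (simp only: C_measure)
  qed
  have single: "measure \<nu> (E \<times> B) = measure P E * measure (\<rho> s) B"
    if E: "E \<in> sets P" "E \<subseteq> {\<omega>. \<omega> 0 = s}" and B: "B \<in> sets proj_space" for E B s
  proof -
    have "measure P (E \<inter> {\<omega>. \<omega> 0 = s'}) * measure (\<rho> s') B
        = (if s' = s then measure P E * measure (\<rho> s) B else 0)" for s'
    proof (cases "s' = s")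
      case True
      then have "E \<inter> {\<omega>. \<omega> 0 = s'} = E" using E(2) by auto
      then show ?thesis using True by simp
    next
      case False
      then have "E \<inter> {\<omega>. \<omega> 0 = s'} = {}" using E(2) by auto
      then show ?thesis using False by simp
    qed
    then show ?thesis unfolding rect[OF E(1) B] by simp
  qed
  have T: "skew_product M \<in> measurable \<nu> \<nu>"
    using skew_product_measurable by (simp add: measurable_cong_sets[OF sets_\<nu> sets_\<nu>])
  interpret \<nu>T: prob_space "distr \<nu> \<nu> (skew_product M)"
    by (rule \<nu>.prob_space_distr[OF T])
  let ?G = "{E \<times> B | E B. E \<in> sets P \<and> B \<in> sets (proj_space :: (real^'d) set measure)}"
  let ?\<Omega> = "UNIV \<times> proj_points :: ((nat \<Rightarrow> 's) \<times> (real^'d) set) set"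
  have whole: "?\<Omega> \<in> ?G"
  proof -
    have "UNIV \<in> sets P" using sets.top[of P] by simp
    moreover have "proj_points \<in> sets (proj_space :: (real^'d) set measure)"
      using sets.top[of "proj_space :: (real^'d) set measure"] by (simp add: space_proj_space)
    ultimately show ?thesis
      by (intro CollectI exI[of _ UNIV] exI[of _ proj_points] conjI refl)
  qed
  have "distr \<nu> \<nu> (skew_product M) = \<nu>"
  proof (rule measure_eqI_generator_eq[where E = "?G"
        and \<Omega> = "?\<Omega>" and A = "\<lambda>_. ?\<Omega>"])
    show "Int_stable ?G"
      by (rule Int_stable_pair_measure_generator)
    show "?G \<subseteq> Pow (?\<Omega>)"
      using sets.sets_into_space space_proj_space by fastforce
    show "sets (distr \<nu> \<nu> (skew_product M))
        = sigma_sets (?\<Omega>) ?G"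
      "sets \<nu> = sigma_sets (?\<Omega>) ?G"
      by (simp_all add: sets_\<nu> sets_pair_measure space_proj_space)
    show "range (\<lambda>_::nat. ?\<Omega>) \<subseteq> ?G"
      by (rule image_subsetI) (rule whole)
    show "emeasure (distr \<nu> \<nu> (skew_product M)) (?\<Omega>) \<noteq> \<infinity>" for i :: nat
      using \<nu>T.emeasure_eq_measure by simp
    fix X assume "X \<in> ?G"
    then obtain E and B :: "(real^'d) set set" where X: "X = E \<times> B" and E: "E \<in> sets P" and B: "B \<in> sets proj_space"
      unfolding mem_Collect_eq by (elim exE conjE) (rule that)
    let ?E = "\<lambda>s. {\<omega>. \<omega> 0 = s \<and> shift \<omega> \<in> E}"
    let ?B = "\<lambda>s. {L \<in> proj_points. (*v) (A s) ` L \<in> B}"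
    have E_sets: "?E s \<in> sets P" for s
    proof -
      note [measurable] = E
      have "{\<omega>\<in>space P. \<omega> 0 = s \<and> shift \<omega> \<in> E} \<in> sets P" by measurable
      then show ?thesis by simp
    qed
    have E_split: "measure P (?E s) = (\<Sum>t\<in>UNIV. stat s * trans_prob s t / stat t * measure P (E \<inter> {\<omega>. \<omega> 0 = t}))" for s
    proof -
      have part: "{\<omega>. \<omega> 0 = s \<and> \<omega> (Suc 0) = t \<and> shift \<omega> \<in> E} \<in> sets P" for t
      proof -
        note [measurable] = E
        have "{\<omega>\<in>space P. \<omega> 0 = s \<and> \<omega> (Suc 0) = t \<and> shift \<omega> \<in> E} \<in> sets P" by measurable
        then show ?thesis by simp
      qed
      have "?E s = (\<Union>t\<in>UNIV. {\<omega>. \<omega> 0 = s \<and> \<omega> (Suc 0) = t \<and> shift \<omega> \<in> E})" by auto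
      then have "measure P (?E s) = (\<Sum>t\<in>UNIV. measure P {\<omega>. \<omega> 0 = s \<and> \<omega> (Suc 0) = t \<and> shift \<omega> \<in> E})"
        using part by (simp only:) (rule finite_measure_finite_Union, auto simp: disjoint_family_on_def)
      then show ?thesis
        unfolding measure_prepend_symbol[OF E] by (simp add: Int_def)
    qed
    have "measure (distr \<nu> \<nu> (skew_product M)) X = measure \<nu> (skew_product M -` X \<inter> space \<nu>)"
      using E B by (intro measure_distr T) (simp add: X sets_\<nu>)
    also have "skew_product M -` X \<inter> space \<nu> = (\<Union>s\<in>UNIV. ?E s \<times> ?B s)"
      by (auto simp: X skew_product_def normalized_rds_def M_eq_A space_\<nu>)
    also have "measure \<nu> \<dots> = (\<Sum>s\<in>UNIV. measure \<nu> (?E s \<times> ?B s))"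
      by (rule \<nu>.finite_measure_finite_Union)
        (use E_sets image_A_sets[OF B] in \<open>auto simp: disjoint_family_on_def sets_\<nu>\<close>)
    also have "\<dots> = (\<Sum>s\<in>UNIV. measure P (?E s) * measure (\<rho> s) (?B s))"
      using E_sets image_A_sets[OF B] by (intro sum.cong refl single) auto
    also have "\<dots> = (\<Sum>s\<in>UNIV. \<Sum>t\<in>UNIV. measure P (E \<inter> {\<omega>. \<omega> 0 = t}) / stat t
        * (stat s * trans_prob s t * measure (\<rho> s) (?B s)))"
      unfolding E_split sum_distrib_right by (intro sum.cong refl) (simp add: mult_ac)
    also have "\<dots> = (\<Sum>t\<in>UNIV. measure P (E \<inter> {\<omega>. \<omega> 0 = t}) / stat t
        * (\<Sum>s\<in>UNIV. stat s * trans_prob s t * measure (\<rho> s) (?B s)))"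
      by (subst sum.swap) (simp add: sum_distrib_left)
    also have "\<dots> = (\<Sum>t\<in>UNIV. measure P (E \<inter> {\<omega>. \<omega> 0 = t}) * measure (\<rho> t) B)"
    proof (rule sum.cong[OF refl])
      fix t
      show "measure P (E \<inter> {\<omega>. \<omega> 0 = t}) / stat t
          * (\<Sum>s\<in>UNIV. stat s * trans_prob s t * measure (\<rho> s) (?B s))
        = measure P (E \<inter> {\<omega>. \<omega> 0 = t}) * measure (\<rho> t) B"
        using stat_pos[of t] by (simp add: stationary[OF B, symmetric])
    qed
    also have "\<dots> = measure \<nu> X" unfolding X by (rule rect[OF E B, symmetric])
    finally show "emeasure (distr \<nu> \<nu> (skew_product M)) X = emeasure \<nu> X"
      by (simp add: \<nu>T.emeasure_eq_measure \<nu>.emeasure_eq_measure)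
  qed auto
  moreover have "distr \<nu> P fst = P"
  proof (rule measure_eqI)
    fix E assume "E \<in> sets (distr \<nu> P fst)"
    then have E: "E \<in> sets P" by simp
    have "fst \<in> measurable \<nu> P" by (simp add: measurable_cong_sets[OF sets_\<nu> refl])
    then have "emeasure (distr \<nu> P fst) E = emeasure \<nu> (fst -` E \<inter> space \<nu>)"
      using E by (rule emeasure_distr)
    also have "fst -` E \<inter> space \<nu> = E \<times> proj_points" by (auto simp: space_\<nu>)
    also have "emeasure \<nu> \<dots> = ennreal (\<Sum>s\<in>UNIV. measure P (E \<inter> {\<omega>. \<omega> 0 = s}) * measure (\<rho> s) proj_points)"
      using rect[OF E, of proj_points] sets.top[of "proj_space :: (real^'d) set measure"]
      by (simp add: \<nu>.emeasure_eq_measure space_proj_space)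
    also have "(\<Sum>s\<in>UNIV. measure P (E \<inter> {\<omega>. \<omega> 0 = s}) * measure (\<rho> s) proj_points)
        = (\<Sum>s\<in>UNIV. measure P (E \<inter> {\<omega>. \<omega> 0 = s}))"
      using \<rho>.M.prob_space by (simp add: space_\<rho>)
    also have "\<dots> = measure P (\<Union>s\<in>UNIV. E \<inter> {\<omega>. \<omega> 0 = s})"
      using Es[OF E] by (intro finite_measure_finite_Union[symmetric]) (auto simp: disjoint_family_on_def)
    also have "(\<Union>s\<in>UNIV. E \<inter> {\<omega>. \<omega> 0 = s}) = E" by auto
    finally show "emeasure (distr \<nu> P fst) E = emeasure P E" by (simp add: emeasure_eq_measure)
  qed simp
  ultimately have "invariant_measure P M \<nu>"
    unfolding invariant_measure_def using \<nu>.prob_space_axioms sets_\<nu> by simp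
  moreover have "markovian_disintegration P \<nu>"
    unfolding markovian_disintegration_def
  proof (intro exI[of _ \<rho>] conjI allI ballI)
    fix E and B :: "(real^'d) set set" assume E: "E \<in> sets P" and B: "B \<in> sets proj_space"
    have "(\<integral>\<^sup>+\<omega>\<in>E. emeasure (\<rho> (\<omega> 0)) B \<partial>P)
        = (\<integral>\<^sup>+\<omega>. (\<Sum>s\<in>UNIV. emeasure (\<rho> s) B * indicator (E \<inter> {\<omega>. \<omega> 0 = s}) \<omega>) \<partial>P)"
    proof (rule nn_integral_cong)
      fix \<omega>
      have "(\<Sum>s\<in>UNIV. emeasure (\<rho> s) B * indicator (E \<inter> {\<omega>. \<omega> 0 = s}) \<omega>)
          = (\<Sum>s\<in>UNIV. if s = \<omega> 0 then emeasure (\<rho> s) B * indicator E \<omega> else 0)"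
        by (intro sum.cong refl) (auto simp: indicator_def)
      then show "emeasure (\<rho> (\<omega> 0)) B * indicator E \<omega>
          = (\<Sum>s\<in>UNIV. emeasure (\<rho> s) B * indicator (E \<inter> {\<omega>. \<omega> 0 = s}) \<omega>)" by simp
    qed
    also have "\<dots> = (\<Sum>s\<in>UNIV. emeasure (\<rho> s) B * emeasure P (E \<inter> {\<omega>. \<omega> 0 = s}))"
    proof -
      have "(\<integral>\<^sup>+\<omega>. (\<Sum>s\<in>UNIV. emeasure (\<rho> s) B * indicator (E \<inter> {\<omega>. \<omega> 0 = s}) \<omega>) \<partial>P)
          = (\<Sum>s\<in>UNIV. \<integral>\<^sup>+\<omega>. emeasure (\<rho> s) B * indicator (E \<inter> {\<omega>. \<omega> 0 = s}) \<omega> \<partial>P)"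
        using Es[OF E] by (intro nn_integral_sum) simp
      also have "\<dots> = (\<Sum>s\<in>UNIV. emeasure (\<rho> s) B * emeasure P (E \<inter> {\<omega>. \<omega> 0 = s}))"
        by (intro sum.cong refl nn_integral_cmult_indicator Es[OF E])
      finally show ?thesis .
    qed
    also have "\<dots> = ennreal (\<Sum>s\<in>UNIV. measure P (E \<inter> {\<omega>. \<omega> 0 = s}) * measure (\<rho> s) B)"
      by (simp add: \<rho>.M.emeasure_eq_measure emeasure_eq_measure mult.commute flip: ennreal_mult' sum_ennreal)
    finally show "emeasure \<nu> (E \<times> B) = (\<integral>\<^sup>+\<omega>\<in>E. emeasure (\<rho> (\<omega> 0)) B \<partial>P)"
      by (simp add: \<nu>.emeasure_eq_measure rect[OF E B])
  qed (use prob_\<rho> sets_\<rho> in auto)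
  ultimately show ?thesis by blast
qed

end

lemma projective_const: "projective (\<lambda>x. c)"
  by (simp add: projective_def)

lemma projective_sgn:
  assumes "projective f" "x \<noteq> 0"
  shows "f (sgn x) = f x"
  using projective_scale[OF assms(1), of "inverse (norm x)" x] assms(2) by (simp add: sgn_div_norm)

lemma continuous_norm_times_projective:
  assumes f: "projective f"
  shows "continuous_on UNIV (\<lambda>x :: real^'d. norm x * f x)"
proof -
  obtain b where b: "\<And>x. x \<noteq> 0 \<Longrightarrow> \<bar>f x\<bar> \<le> b"
    by (rule projective_bounded[OF f]) (rule that)
  have "isCont (\<lambda>x. norm x * f x) x" for x
  proof (cases "x = 0")
    case True
    have "((\<lambda>x. norm x * f x) \<longlongrightarrow> 0) (at 0)"
    proof (rule Lim_null_comparison)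
      show "\<forall>\<^sub>F x in at 0. norm (norm x * f x) \<le> norm x * b"
        using b by (intro eventually_at_filter[THEN iffD2] always_eventually)
          (auto simp: abs_mult intro: mult_left_mono)
      show "((\<lambda>x. norm x * b) \<longlongrightarrow> 0) (at 0)"
        by (intro tendsto_mult_left_zero tendsto_norm_zero tendsto_ident_at)
    qed
    then show ?thesis using True by (simp add: isCont_def)
  next
    case False
    have "continuous_on (- {0}) (\<lambda>x. norm x * f x)"
      using f by (intro continuous_intros) (simp add: projective_def)
    moreover have "open (- {0 :: real^'d})" by (simp add: open_Compl)
    ultimately show ?thesis using False by (simp add: continuous_on_eq_continuous_at)
  qed
  then show ?thesis by (simp add: continuous_on_eq_continuous_at)
qed

lemma infdist_cone:
  fixes S :: "'a :: euclidean_space set"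
  assumes S: "closed S" "S \<noteq> {}" and cone: "\<And>c x. c \<noteq> 0 \<Longrightarrow> x \<in> S \<Longrightarrow> c *\<^sub>R x \<in> S" and "c \<noteq> 0"
  shows "infdist (c *\<^sub>R x) S = \<bar>c\<bar> * infdist x S"
proof -
  have le: "infdist (a *\<^sub>R z) S \<le> \<bar>a\<bar> * infdist z S" if "a \<noteq> 0" for a z
  proof -
    obtain y where y: "y \<in> S" "infdist z S = dist z y"
      by (rule infdist_attains_inf[OF S]) (rule that)
    have "infdist (a *\<^sub>R z) S \<le> dist (a *\<^sub>R z) (a *\<^sub>R y)"
      using y cone \<open>a \<noteq> 0\<close> by (intro infdist_le) simp
    also have "\<dots> = \<bar>a\<bar> * dist z y"
      by (simp add: dist_norm flip: scaleR_right_diff_distrib)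
    finally show ?thesis by (simp add: y)
  qed
  have "infdist x S \<le> \<bar>1 / c\<bar> * infdist (c *\<^sub>R x) S"
    using le[of "1 / c" "c *\<^sub>R x"] \<open>c \<noteq> 0\<close> by simp
  then have "\<bar>c\<bar> * infdist x S \<le> infdist (c *\<^sub>R x) S"
    using \<open>c \<noteq> 0\<close> by (simp add: field_simps)
  with le[OF \<open>c \<noteq> 0\<close>, of x] show ?thesis by simp
qed

text \<open>The functions are truncated multiples of the distance to the complement of the open cone, divided
  by the norm. The distance to a cone is homogeneous of degree one, so the quotient is a function of the
  direction.\<close>

lemma projective_indicator_limit:
  fixes U :: "(real^'d) set set"
  assumes U: "open {x. x \<noteq> 0 \<and> span {x} \<in> U}"
  obtains f where "\<And>n::nat. projective (f n)" "\<And>n x. 0 \<le> f n x" "\<And>n x. f n x \<le> 1"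
    "\<And>x. x \<noteq> 0 \<Longrightarrow> (\<lambda>n. f n x) \<longlonglongrightarrow> indicator U (span {x})"
proof -
  let ?V = "{x. x \<noteq> 0 \<and> span {x} \<in> U}"
  define S where "S = - ?V"
  have S: "closed S" "S \<noteq> {}" using U by (auto simp: S_def closed_Compl)
  have cone: "c *\<^sub>R x \<in> S" if "c \<noteq> 0" "x \<in> S" for c x
    using that by (auto simp: S_def span_scale)
  define f where "f n x = min 1 (real n * infdist x S / norm x)" for n x
  have "projective (f n)" for n
    unfolding projective_def f_def
  proof (intro conjI allI impI)
    show "continuous_on (- {0}) (\<lambda>x. min 1 (real n * infdist x S / norm x))"
      by (intro continuous_intros) auto
    show "min 1 (real n * infdist (c *\<^sub>R x) S / norm (c *\<^sub>R x)) = min 1 (real n * infdist x S / norm x)"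
      if "c \<noteq> 0" "x \<noteq> 0" for c x
      using that by (simp add: infdist_cone[OF S cone])
  qed
  moreover have "0 \<le> f n x" "f n x \<le> 1" for n x
    by (auto simp: f_def infdist_nonneg)
  moreover have "(\<lambda>n. f n x) \<longlonglongrightarrow> indicator U (span {x})" if x: "x \<noteq> 0" for x
  proof (cases "span {x} \<in> U")
    case True
    then have "x \<notin> S" using x by (simp add: S_def)
    then have pos: "infdist x S > 0"
      using in_closed_iff_infdist_zero[OF S, of x] infdist_nonneg[of x S] by linarith
    obtain n0 :: nat where n0: "real n0 \<ge> norm x / infdist x S" using real_arch_simple by blast
    have "f n x = 1" if "n \<ge> n0" for n
    proof -
      have "real n \<ge> norm x / infdist x S" using n0 \<open>n \<ge> n0\<close> by linarith
      then have "1 \<le> real n * infdist x S / norm x" using pos x by (simp add: field_simps)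
      then show ?thesis by (simp add: f_def)
    qed
    then have "\<forall>\<^sub>F n in sequentially. f n x = 1" by (rule eventually_sequentiallyI)
    then show ?thesis using True by (simp add: tendsto_eventually)
  next
    case False
    then have "x \<in> S" by (simp add: S_def)
    then have "infdist x S = 0" by simp
    then show ?thesis using False by (simp add: f_def)
  qed
  ultimately show ?thesis by (rule that)
qed

text \<open>A state of the chain as a point of the cube \<open>[0, 1)\<close> of dimension \<open>CARD('d) +
  CARD('s)\<close>. The symbol is stored as a multiple of a coordinate vector, so functions of the state
  become linear, hence continuous, in that part.\<close>

definition encode :: "real^'d::finite \<Rightarrow> 's::finite \<Rightarrow> real^('d + 's)" where
  "encode x s = (\<chi> j. case j of Inl i \<Rightarrow> (sgn x $ i + 1) / 4 | Inr t \<Rightarrow> if t = s then 1 / 2 else 0)"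

definition direction :: "real^('d::finite + 's::finite) \<Rightarrow> real^'d" where
  "direction y = (\<chi> i. 4 * y $ Inl i - 1)"

definition weight :: "'s \<Rightarrow> real^('d::finite + 's::finite) \<Rightarrow> real" where
  "weight s y = 2 * y $ Inr s"

lemma encode_bounds: "0 \<le> encode x s $ j" "encode x s $ j < 1"
proof -
  have "norm (sgn x) \<le> 1" by (simp add: norm_sgn)
  then have "\<bar>sgn x $ i\<bar> \<le> 1" for i using component_le_norm_cart[of "sgn x" i] by linarith
  note abs_le = this
  have "0 \<le> (sgn x $ i + 1) / 4" for i
    using abs_le[of i] by (simp add: abs_le_iff)
  moreover have "(sgn x $ i + 1) / 4 < 1" for i
    using abs_le[of i] by (simp add: abs_le_iff)
  ultimately show "0 \<le> encode x s $ j" "encode x s $ j < 1"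
    by (auto simp: encode_def split: sum.splits)
qed

lemma direction_encode [simp]: "direction (encode x s) = sgn x"
  by (simp add: direction_def encode_def vec_eq_iff add_divide_distrib)

lemma weight_encode [simp]: "weight t (encode x s) = (if t = s then 1 else 0)"
  by (simp add: weight_def encode_def)

lemma continuous_direction: "continuous_on UNIV direction"
  unfolding direction_def by (intro continuous_on_vec_lambda continuous_intros)

lemma continuous_weight: "continuous_on UNIV (weight s)"
  unfolding weight_def by (intro continuous_intros)

text \<open>On codes this is \<open>f\<close> restricted to the states with symbol \<open>s\<close>. The norm
  is 1 there; its purpose is to make the function continuous at points with direction 0.\<close>

definition weighted :: "'s \<Rightarrow> (real^'d \<Rightarrow> real) \<Rightarrow> real^('d::finite + 's::finite) \<Rightarrow> real" where
  "weighted s f y = weight s y * (norm (direction y) * f (direction y))"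

lemma continuous_weighted:
  assumes "projective f"
  shows "continuous_on UNIV (weighted s f)"
  unfolding weighted_def[abs_def]
  by (intro continuous_on_mult continuous_weight
      continuous_on_compose2[OF continuous_norm_times_projective[OF assms] continuous_direction]) simp

lemma weighted_encode:
  assumes "projective f" "x \<noteq> 0"
  shows "weighted s f (encode x u) = (if u = s then f x else 0)"
  using projective_sgn[OF assms] assms(2) by (auto simp: weighted_def norm_sgn)

lemma weight_curve: "0 \<le> weight s (cube_curve t)" "weight s (cube_curve t) \<le> 2"
  using cube_curve_bounds[of t "Inr s"] by (simp_all add: weight_def)

lemma weighted_curve_bounded:
  fixes f :: "real^'d \<Rightarrow> real"
  assumes "projective f"
  obtains B where "\<And>t. \<bar>weighted s f (cube_curve t :: real^('d::finite + 's::finite))\<bar> \<le> B"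
proof -
  obtain b where b: "\<And>x. x \<noteq> 0 \<Longrightarrow> \<bar>f x\<bar> \<le> b"
    by (rule projective_bounded[OF assms]) (rule that)
  have b0: "b \<ge> 0" using b[of "axis undefined 1"] by (smt (verit) axis_eq_0_iff abs_ge_zero)
  have "\<bar>weighted s f (cube_curve t :: real^('d + 's))\<bar> \<le> 2 * (3 * real CARD('d) * b)" for t
  proof -
    let ?y = "cube_curve t :: real^('d + 's)"
    have "norm (direction ?y) \<le> (\<Sum>i\<in>UNIV. \<bar>direction ?y $ i\<bar>)" by (rule norm_le_l1_cart)
    also have "\<dots> \<le> (\<Sum>i\<in>(UNIV :: 'd set). 3)"
    proof (rule sum_mono)
      show "\<bar>direction ?y $ i\<bar> \<le> 3" for i
        using cube_curve_bounds[of t "Inl i :: 'd + 's"] by (simp add: direction_def abs_le_iff)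
    qed
    finally have d: "norm (direction ?y) \<le> 3 * real CARD('d)" by simp
    have le: "norm (direction ?y) * \<bar>f (direction ?y)\<bar> \<le> 3 * real CARD('d) * b"
    proof (cases "direction ?y = 0")
      case True
      then show ?thesis using b0 by simp
    next
      case False
      then show ?thesis using b[OF False] d b0 by (intro mult_mono) auto
    qed
    have "weight s ?y * (norm (direction ?y) * \<bar>f (direction ?y)\<bar>) \<le> 2 * (3 * real CARD('d) * b)"
      by (rule mult_mono[OF weight_curve(2) le]) simp_all
    then show ?thesis by (simp add: weighted_def abs_mult abs_of_nonneg[OF weight_curve(1)])
  qed
  then show ?thesis by (rule that)
qed

context markov_cocycle
begin

definition base :: "real^'d" where "base = axis undefined 1"

lemma norm_base [simp]: "norm base = 1" and base_nonzero [simp]: "base \<noteq> 0"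
  by (simp_all add: base_def)

lemma prefix_measurable: "(\<lambda>\<omega>. map \<omega> [0..<n]) \<in> measurable P (count_space UNIV)"
proof (subst measurable_count_space_eq_countable)
  show "(\<lambda>\<omega>. map \<omega> [0..<n]) \<in> space P \<rightarrow> UNIV \<and>
    (\<forall>w\<in>UNIV. (\<lambda>\<omega>. map \<omega> [0..<n]) -` {w} \<inter> space P \<in> sets P)"
  proof (intro conjI ballI)
    fix w :: "'s list"
    have "(\<lambda>\<omega>. map \<omega> [0..<n]) -` {w} \<inter> space P = (if length w = n then cylinder w else {})"
      by (auto simp: cylinder_iff_prefix)
    then show "(\<lambda>\<omega>. map \<omega> [0..<n]) -` {w} \<inter> space P \<in> sets P" by simp
  qed auto
qed auto

lemma state_eq_prefix:
  "F (\<omega> i) (lrds M i \<omega> *v x)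
    = (\<lambda>w. F (w ! i) (lrds M i (\<lambda>k. w ! k) *v x)) (map \<omega> [0..<Suc i])"
proof -
  have "lrds M i \<omega> = lrds M i (\<lambda>k. map \<omega> [0..<Suc i] ! k)"
    by (rule lrds_cong[OF first_coordinate]) (simp add: nth_append)
  moreover have "map \<omega> [0..<Suc i] ! i = \<omega> i" by (simp add: nth_append)
  ultimately show ?thesis by (simp only:)
qed

lemma integrable_state: "integrable P (\<lambda>\<omega>. (F :: 's \<Rightarrow> real^'d \<Rightarrow> real) (\<omega> i) (lrds M i \<omega> *v x))"
  by (subst state_eq_prefix) (rule integral_prefix(1)[of "\<lambda>w. F (w ! i) (lrds M i (\<lambda>k. w ! k) *v x)" "Suc i"])

lemma measurable_state: "(\<lambda>\<omega>. encode (lrds M i \<omega> *v x) (\<omega> i)) \<in> borel_measurable P"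
proof -
  have "(\<lambda>\<omega>. encode (lrds M i \<omega> *v x) (\<omega> i))
      = (\<lambda>\<omega>. (\<lambda>w. encode (lrds M i (\<lambda>k. w ! k) *v x) (w ! i)) (map \<omega> [0..<Suc i]))"
    by (rule ext) (rule state_eq_prefix[of "\<lambda>s y. encode y s"])
  also have "\<dots> \<in> borel_measurable P"
    by (rule measurable_compose[OF prefix_measurable]) simp
  finally show ?thesis .
qed

definition visits :: "nat \<Rightarrow> 's \<Rightarrow> (real^'d \<Rightarrow> real) \<Rightarrow> real" where
  "visits i s f = (\<integral>\<omega>. (if \<omega> i = s then f (lrds M i \<omega> *v base) else 0) \<partial>P)"

text \<open>The Krylov-Bogoliubov averages along the orbit of \<open>base\<close>.\<close>

definition occupation :: "nat \<Rightarrow> 's \<Rightarrow> (real^'d \<Rightarrow> real) \<Rightarrow> real" where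
  "occupation n s f = (\<Sum>i\<le>n. visits i s f) / real (Suc n)"

text \<open>One step of the chain, by \<open>integral_eq_Q\<close> applied to a function that is supported on
  the symbol \<open>t\<close>.\<close>

lemma visits_Suc: "visits (Suc i) t f = (\<Sum>s\<in>UNIV. trans_prob s t * visits i s (\<lambda>x. f (A s *v x)))"
proof -
  let ?F = "\<lambda>u y. if u = t then f y else 0"
  have "visits (Suc i) t f = (\<Sum>s\<in>UNIV. stat s * (Q ^^ i) (Q ?F) s base)"
    unfolding visits_def integral_eq_Q[of ?F] by (simp add: funpow_swap1)
  also have "\<dots> = (\<integral>\<omega>. Q ?F (\<omega> i) (lrds M i \<omega> *v base) \<partial>P)"
    by (rule integral_eq_Q[symmetric])
  also have "\<dots> = (\<integral>\<omega>. (\<Sum>s\<in>UNIV. trans_prob s t *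
      (if \<omega> i = s then f (A s *v (lrds M i \<omega> *v base)) else 0)) \<partial>P)"
  proof (rule Bochner_Integration.integral_cong[OF refl])
    fix \<omega>
    have "Q ?F u y = trans_prob u t * f (A u *v y)" for u y
    proof -
      have "Q ?F u y = (\<Sum>t'\<in>UNIV. if t' = t then trans_prob u t * f (A u *v y) else 0)"
        unfolding Q_def by (rule sum.cong) auto
      then show ?thesis by simp
    qed
    moreover have "(\<Sum>s\<in>UNIV. trans_prob s t * (if u = s then f (A s *v y) else 0))
        = trans_prob u t * f (A u *v y)" for u y
    proof -
      have "(\<Sum>s\<in>UNIV. trans_prob s t * (if u = s then f (A s *v y) else 0))
          = (\<Sum>s\<in>UNIV. if s = u then trans_prob u t * f (A u *v y) else 0)"
        by (rule sum.cong) auto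
      then show ?thesis by simp
    qed
    ultimately show "Q ?F (\<omega> i) (lrds M i \<omega> *v base) = (\<Sum>s\<in>UNIV. trans_prob s t *
      (if \<omega> i = s then f (A s *v (lrds M i \<omega> *v base)) else 0))" by (simp only:)
  qed
  also have "\<dots> = (\<Sum>s\<in>UNIV. trans_prob s t * visits i s (\<lambda>x. f (A s *v x)))"
  proof -
    have int: "integrable P (\<lambda>\<omega>. if \<omega> i = s then f (A s *v (lrds M i \<omega> *v base)) else 0)" for s
      by (rule integrable_state[of "\<lambda>u y. if u = s then f (A s *v y) else 0"])
    show ?thesis
      unfolding visits_def by (subst Bochner_Integration.integral_sum) (simp_all add: int)
  qed
  finally show ?thesis .
qed

lemma visits_bound:
  assumes "\<And>x. x \<noteq> 0 \<Longrightarrow> \<bar>f x\<bar> \<le> b"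
  shows "\<bar>visits i s f\<bar> \<le> b"
proof -
  have b: "b \<ge> 0" using assms[of base] by (simp add: order_trans[OF abs_ge_zero])
  have "\<bar>visits i s f\<bar> \<le> (\<integral>\<omega>. \<bar>if \<omega> i = s then f (lrds M i \<omega> *v base) else 0\<bar> \<partial>P)"
    unfolding visits_def by (rule integral_abs_bound)
  also have "\<dots> \<le> (\<integral>\<omega>. b \<partial>P)"
  proof (rule integral_mono)
    show "integrable P (\<lambda>\<omega>. \<bar>if \<omega> i = s then f (lrds M i \<omega> *v base) else 0\<bar>)"
      by (rule integrable_state[of "\<lambda>u y. \<bar>if u = s then f y else 0\<bar>"])
  qed (use assms b in auto)
  finally show ?thesis by simp
qed

text \<open>The sum telescopes, which leaves two bounded terms divided by \<open>n + 1\<close>.\<close>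

lemma occupation_stationary:
  assumes "projective f"
  shows "(\<lambda>n. occupation n t f - (\<Sum>s\<in>UNIV. trans_prob s t * occupation n s (\<lambda>x. f (A s *v x))))
    \<longlonglongrightarrow> 0"
proof -
  obtain b where b: "\<And>x. x \<noteq> 0 \<Longrightarrow> \<bar>f x\<bar> \<le> b"
    by (rule projective_bounded[OF assms]) (rule that)
  have eq: "occupation n t f - (\<Sum>s\<in>UNIV. trans_prob s t * occupation n s (\<lambda>x. f (A s *v x)))
      = (visits 0 t f - visits (Suc n) t f) / real (Suc n)" for n
  proof -
    have "(\<Sum>s\<in>UNIV. trans_prob s t * occupation n s (\<lambda>x. f (A s *v x)))
        = (\<Sum>s\<in>UNIV. \<Sum>i\<le>n. trans_prob s t * visits i s (\<lambda>x. f (A s *v x))) / real (Suc n)"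
      by (simp add: occupation_def sum_divide_distrib sum_distrib_left)
    also have "\<dots> = (\<Sum>i\<le>n. visits (Suc i) t f) / real (Suc n)"
      unfolding visits_Suc by (subst sum.swap) simp
    finally have "occupation n t f - (\<Sum>s\<in>UNIV. trans_prob s t * occupation n s (\<lambda>x. f (A s *v x)))
        = ((\<Sum>i\<le>n. visits i t f) - (\<Sum>i\<le>n. visits (Suc i) t f)) / real (Suc n)"
      by (simp add: occupation_def diff_divide_distrib)
    moreover have "(\<Sum>i\<le>n. visits i t f) - (\<Sum>i\<le>n. visits (Suc i) t f) = visits 0 t f - visits (Suc n) t f"
      by (induction n) simp_all
    ultimately show ?thesis by simp
  qed
  show ?thesis
    unfolding eq
  proof (rule Lim_null_comparison)
    have "\<bar>visits 0 t f - visits (Suc n) t f\<bar> \<le> 2 * b" for n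
      using visits_bound[of f b 0 t, OF b] visits_bound[of f b "Suc n" t, OF b] by linarith
    then have "norm ((visits 0 t f - visits (Suc n) t f) / real (Suc n)) \<le> 2 * b * (1 / real (Suc n))" for n
      by (simp add: divide_right_mono)
    then show "\<forall>\<^sub>F n in sequentially.
        norm ((visits 0 t f - visits (Suc n) t f) / real (Suc n)) \<le> 2 * b * (1 / real (Suc n))" by simp
    show "(\<lambda>n. 2 * b * (1 / real (Suc n))) \<longlonglongrightarrow> 0"
      using tendsto_mult_right_zero[OF LIMSEQ_Suc[OF lim_1_over_n[where 'a = real]], of "2 * b"] .
  qed
qed

lemma occupation_one: "occupation n s (\<lambda>x. 1) = stat s"
proof -
  have "visits i s (\<lambda>x. 1) = stat s" for i
  proof -
    have "{\<omega>\<in>space P. \<omega> i = s} \<in> sets P" by measurable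
    then have E: "{\<omega>. \<omega> i = s} \<in> sets P" by simp
    have "visits i s (\<lambda>x. 1) = (\<integral>\<omega>. indicator {\<omega>. \<omega> i = s} \<omega> \<partial>P)"
      unfolding visits_def by (rule Bochner_Integration.integral_cong) (auto simp: indicator_def)
    then show ?thesis using E by (simp add: measure_coordinate)
  qed
  then show ?thesis by (simp add: occupation_def)
qed

text \<open>The averages over time are expectations at a uniformly distributed random time, so
  \<open>cube_laws_compact\<close> applies to them.\<close>

lemma occupation_law:
  assumes "projective f"
  defines "U \<equiv> \<lambda>n. uniform_count_measure {..n}"
  defines "Y \<equiv> \<lambda>z. encode (lrds M (fst z) (snd z) *v base) (snd z (fst z))"
  shows "Y \<in> borel_measurable (U n \<Otimes>\<^sub>M P)"
    and "(\<integral>z. weighted s f (Y z) \<partial>(U n \<Otimes>\<^sub>M P)) = occupation n s f"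
proof -
  interpret U: prob_space "U n"
    unfolding U_def by (rule prob_space_uniform_count_measure) auto
  interpret UP: pair_prob_space "U n" P ..
  have id: "(\<lambda>i. i) \<in> measurable (U n) (count_space UNIV)"
    by (simp add: U_def measurable_def space_uniform_count_measure sets_uniform_count_measure)
  show Y: "Y \<in> borel_measurable (U n \<Otimes>\<^sub>M P)"
    unfolding Y_def
  proof (rule measurable_compose_countable[where g = fst and
        f = "\<lambda>i z. encode (lrds M i (snd z) *v base) (snd z i)"])
    show "(\<lambda>z. encode (lrds M i (snd z) *v base) (snd z i)) \<in> borel_measurable (U n \<Otimes>\<^sub>M P)" for i
      by (rule measurable_compose[OF measurable_snd measurable_state])
    show "fst \<in> measurable (U n \<Otimes>\<^sub>M P) (count_space UNIV)"
      by (rule measurable_compose[OF measurable_fst id])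
  qed
  obtain b where b: "\<And>x. x \<noteq> 0 \<Longrightarrow> \<bar>f x\<bar> \<le> b"
    by (rule projective_bounded[OF assms(1)]) (rule that)
  have b0: "b \<ge> 0" using b[of base] by (simp add: order_trans[OF abs_ge_zero])
  have wY: "weighted s f (Y z) = (if snd z (fst z) = s then f (lrds M (fst z) (snd z) *v base) else 0)" for z
    unfolding Y_def using assms(1) by (subst weighted_encode) auto
  have int: "integrable (U n \<Otimes>\<^sub>M P) (\<lambda>z. weighted s f (Y z))"
  proof (rule UP.integrable_const_bound[where B = b])
    show "AE z in U n \<Otimes>\<^sub>M P. norm (weighted s f (Y z)) \<le> b"
      using b b0 by (intro AE_I2) (simp add: wY)
    show "(\<lambda>z. weighted s f (Y z)) \<in> borel_measurable (U n \<Otimes>\<^sub>M P)"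
      by (rule measurable_compose[OF Y borel_measurable_continuous_onI[OF continuous_weighted[OF assms(1)]]])
  qed
  have "(\<integral>z. weighted s f (Y z) \<partial>(U n \<Otimes>\<^sub>M P)) = (\<integral>i. (\<integral>\<omega>. weighted s f (Y (i, \<omega>)) \<partial>P) \<partial>U n)"
    by (rule UP.integral_fst'[OF int, symmetric])
  also have "\<dots> = (\<integral>i. visits i s f \<partial>U n)"
    by (simp only: wY fst_conv snd_conv visits_def)
  also have "\<dots> = occupation n s f"
    by (simp add: U_def integral_uniform_count_measure occupation_def)
  finally show "(\<integral>z. weighted s f (Y z) \<partial>(U n \<Otimes>\<^sub>M P)) = occupation n s f" .
qed

text \<open>A weak limit of the occupation laws inherits asymptotic stationarity, because weighted projective
  functions are continuous.\<close>

lemma stationary_functional: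
  obtains m where "real_distribution m"
    "\<And>s. (\<integral>t. weighted s (\<lambda>x. 1) (cube_curve t :: real^('d + 's)) \<partial>m) = stat s"
    "\<And>f u. projective f \<Longrightarrow> (\<integral>t. weighted u f (cube_curve t :: real^('d + 's)) \<partial>m)
      = (\<Sum>s\<in>UNIV. trans_prob s u * (\<integral>t. weighted s (\<lambda>x. f (A s *v x)) (cube_curve t :: real^('d + 's)) \<partial>m))"
proof -
  let ?N = "\<lambda>n. uniform_count_measure {..n::nat} \<Otimes>\<^sub>M P"
  let ?Y = "\<lambda>z. encode (lrds M (fst z) (snd z) *v base) (snd z (fst z))"
  have N: "prob_space (?N n)" for n
  proof -
    interpret U: prob_space "uniform_count_measure {..n}"
      by (rule prob_space_uniform_count_measure) auto
    interpret UP: pair_prob_space "uniform_count_measure {..n}" P ..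
    show ?thesis by (rule UP.prob_space_axioms)
  qed
  obtain r m where r: "strict_mono (r :: nat \<Rightarrow> nat)" and m: "real_distribution m" and lim:
    "\<And>(g :: real^('d + 's) \<Rightarrow> real) B. continuous_on UNIV g \<Longrightarrow> (\<And>t. \<bar>g (cube_curve t)\<bar> \<le> B) \<Longrightarrow>
      (\<lambda>n. \<integral>z. g (?Y z) \<partial>?N (r n)) \<longlonglongrightarrow> (\<integral>t. g (cube_curve t) \<partial>m)"
  proof (rule cube_laws_compact[of ?N "\<lambda>n. ?Y", OF N occupation_law(1)[OF projective_const] encode_bounds])
    fix r m
    assume r: "strict_mono (r :: nat \<Rightarrow> nat)" "real_distribution m" and lim:
      "\<And>(g :: real^('d + 's) \<Rightarrow> real) B. continuous_on UNIV g \<Longrightarrow> (\<And>t. \<bar>g (cube_curve t)\<bar> \<le> B) \<Longrightarrow>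
        (\<lambda>n. \<integral>z. g (?Y z) \<partial>?N (r n)) \<longlonglongrightarrow> (\<integral>t. g (cube_curve t) \<partial>m)"
    show thesis by (rule that[OF r lim])
  qed
  let ?K = "\<lambda>s f. \<integral>t. weighted s f (cube_curve t :: real^('d + 's)) \<partial>m"
  have K: "(\<lambda>n. occupation (r n) s f) \<longlonglongrightarrow> ?K s f" if f: "projective f" for s f
  proof -
    obtain B where B: "\<And>t. \<bar>weighted s f (cube_curve t :: real^('d + 's))\<bar> \<le> B"
      by (rule weighted_curve_bounded[OF f]) (rule that)
    show ?thesis
      using lim[OF continuous_weighted[OF f] B] unfolding occupation_law(2)[OF f] .
  qed
  have "?K s (\<lambda>x. 1) = stat s" for s
    using K[OF projective_const, of s 1] by (simp add: occupation_one LIMSEQ_const_iff)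
  moreover have "?K u f = (\<Sum>s\<in>UNIV. trans_prob s u * ?K s (\<lambda>x. f (A s *v x)))"
    if f: "projective f" for f u
  proof -
    have "(\<lambda>n. occupation (r n) u f - (\<Sum>s\<in>UNIV. trans_prob s u * occupation (r n) s (\<lambda>x. f (A s *v x))))
        \<longlonglongrightarrow> ?K u f - (\<Sum>s\<in>UNIV. trans_prob s u * ?K s (\<lambda>x. f (A s *v x)))"
      by (intro tendsto_diff tendsto_sum tendsto_mult tendsto_const K f projective_comp_A)
    moreover have "(\<lambda>n. occupation (r n) u f - (\<Sum>s\<in>UNIV. trans_prob s u * occupation (r n) s (\<lambda>x. f (A s *v x))))
        \<longlonglongrightarrow> 0"
      using LIMSEQ_subseq_LIMSEQ[OF occupation_stationary[OF f] r] by (simp add: o_def)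
    ultimately have "?K u f - (\<Sum>s\<in>UNIV. trans_prob s u * ?K s (\<lambda>x. f (A s *v x))) = 0"
      by (rule LIMSEQ_unique)
    then show ?thesis by simp
  qed
  ultimately show ?thesis using m by (intro that)
qed

text \<open>The vector \<open>base\<close> is a default value at \<open>0\<close>, which spans no point of
  projective space.\<close>

lemma measurable_span_default: "(\<lambda>x. span {if x = 0 then base else x}) \<in> measurable borel proj_space"
  unfolding proj_space_def
proof (rule measurable_measure_of)
  show "(\<lambda>x. span {if x = 0 then base else x}) \<in> space borel \<rightarrow> proj_points"
    using span_in_proj_points[OF base_nonzero] span_in_proj_points by auto
  fix U :: "(real^'d) set set"
  assume U: "U \<in> {U. U \<subseteq> proj_points \<and> open {x. x \<noteq> 0 \<and> span {x} \<in> U}}"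
  have "(\<lambda>x. span {if x = 0 then base else x}) -` U \<inter> space borel
      = {x. x \<noteq> 0 \<and> span {x} \<in> U} \<union> (if span {base} \<in> U then {0} else {})"
    by (auto split: if_splits)
  also have "\<dots> \<in> sets borel" using U by auto
  finally show "(\<lambda>x. span {if x = 0 then base else x}) -` U \<inter> space borel \<in> sets borel" .
qed auto

text \<open>The limit law on the line, with density proportional to \<open>weighted s\<close> along the curve,
  is pushed to projective space. Points of direction 0 have weight 0, so the default value in
  \<open>measurable_span_default\<close> has no effect.\<close>

lemma stationary_laws:
  obtains \<rho> :: "'s \<Rightarrow> (real^'d) set measure"
  where "\<And>s. prob_space (\<rho> s)" "\<And>s. sets (\<rho> s) = sets proj_space"
    "\<And>f u. projective f \<Longrightarrow> stat u * (\<integral>L. f (unit_rep L) \<partial>\<rho> u)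
      = (\<Sum>s\<in>UNIV. stat s * trans_prob s u * (\<integral>L. f (A s *v unit_rep L) \<partial>\<rho> s))"
proof -
  obtain m where m: "real_distribution m"
    and one: "\<And>s. (\<integral>t. weighted s (\<lambda>x. 1) (cube_curve t :: real^('d + 's)) \<partial>m) = stat s"
    and stationary: "\<And>f u. projective f \<Longrightarrow> (\<integral>t. weighted u f (cube_curve t :: real^('d + 's)) \<partial>m)
      = (\<Sum>s\<in>UNIV. trans_prob s u * (\<integral>t. weighted s (\<lambda>x. f (A s *v x)) (cube_curve t :: real^('d + 's)) \<partial>m))"
    by (rule stationary_functional) (rule that)
  interpret m: real_distribution m by (rule m)
  let ?x = "\<lambda>t. direction (cube_curve t :: real^('d + 's))"
  let ?w = "\<lambda>s t. weighted s (\<lambda>x. 1) (cube_curve t :: real^('d + 's)) / stat s"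
  define \<rho> where "\<rho> s = distr (density m (\<lambda>t. ennreal (?w s t))) proj_space
      (\<lambda>t. span {if ?x t = 0 then base else ?x t})" for s
  have weighted_m: "(\<lambda>t. weighted s f (cube_curve t :: real^('d + 's))) \<in> borel_measurable m"
    if "projective f" for s f
    using borel_measurable_continuous_onI[OF continuous_on_compose2[OF
        continuous_weighted[OF that] continuous_cube_curve subset_UNIV], of s] by simp
  have int_m: "integrable m (\<lambda>t. weighted s f (cube_curve t :: real^('d + 's)))"
    if f: "projective f" for s f
  proof -
    obtain B where B: "\<And>t. \<bar>weighted s f (cube_curve t :: real^('d + 's))\<bar> \<le> B"
      by (rule weighted_curve_bounded[OF f]) (rule that)
    show ?thesis
      by (rule m.integrable_const_bound[where B = B]) (use B weighted_m[OF f] in auto)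
  qed
  have w_nonneg: "?w s t \<ge> 0" for s t
    using weight_curve(1)[of s t] stat_pos[of s]
    by (auto simp: weighted_def intro!: divide_nonneg_pos mult_nonneg_nonneg)
  have w_m: "?w s \<in> borel_measurable m" for s
    using weighted_m[OF projective_const] by (intro borel_measurable_divide) auto
  have "?x \<in> borel_measurable borel"
    by (intro borel_measurable_continuous_onI
        continuous_on_compose2[OF continuous_direction continuous_cube_curve]) simp
  then have dir_m: "(\<lambda>t. span {if ?x t = 0 then base else ?x t}) \<in> measurable m proj_space"
    using measurable_compose[OF _ measurable_span_default] measurable_cong_sets[OF m.events_eq_borel refl]
    by blast
  have dir_d: "(\<lambda>t. span {if ?x t = 0 then base else ?x t})
      \<in> measurable (density m (\<lambda>t. ennreal (?w s t))) proj_space" for s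
    using dir_m by simp
  have prob: "prob_space (\<rho> s)" for s
    unfolding \<rho>_def
  proof (rule prob_space.prob_space_distr[OF prob_spaceI dir_d])
    have "emeasure (density m (\<lambda>t. ennreal (?w s t))) (space m) = (\<integral>\<^sup>+t. ennreal (?w s t) \<partial>m)"
      using w_m by (subst emeasure_density) (auto intro!: nn_integral_cong)
    also have "\<dots> = ennreal (\<integral>t. ?w s t \<partial>m)"
      using int_m[OF projective_const] w_nonneg by (intro nn_integral_eq_integral) auto
    also have "(\<integral>t. ?w s t \<partial>m) = 1" using one[of s] stat_pos[of s] by simp
    finally show "emeasure (density m (\<lambda>t. ennreal (?w s t))) (space (density m (\<lambda>t. ennreal (?w s t)))) = 1"
      by simp
  qed
  have law: "stat s * (\<integral>L. f (unit_rep L) \<partial>\<rho> s) = (\<integral>t. weighted s f (cube_curve t :: real^('d + 's)) \<partial>m)"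
    if f: "projective f" for s f
  proof -
    have f_m: "(\<lambda>L. f (unit_rep L)) \<in> borel_measurable proj_space" by (rule projective_measurable[OF f])
    have "(\<integral>L. f (unit_rep L) \<partial>\<rho> s)
        = (\<integral>t. f (unit_rep (span {if ?x t = 0 then base else ?x t})) \<partial>density m (\<lambda>t. ennreal (?w s t)))"
      unfolding \<rho>_def by (rule integral_distr[OF dir_d f_m])
    also have "\<dots> = (\<integral>t. ?w s t *\<^sub>R f (unit_rep (span {if ?x t = 0 then base else ?x t})) \<partial>m)"
      by (rule integral_density[OF measurable_compose[OF dir_m f_m] w_m]) (simp add: w_nonneg)
    also have "\<dots> = (\<integral>t. weighted s f (cube_curve t :: real^('d + 's)) / stat s \<partial>m)"
    proof (rule Bochner_Integration.integral_cong[OF refl])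
      fix t
      show "?w s t *\<^sub>R f (unit_rep (span {if ?x t = 0 then base else ?x t}))
          = weighted s f (cube_curve t :: real^('d + 's)) / stat s"
        by (cases "?x t = 0") (simp_all add: weighted_def projective_unit_rep_span[OF f])
    qed
    finally show ?thesis using stat_pos[of s] by simp
  qed
  have "stat u * (\<integral>L. f (unit_rep L) \<partial>\<rho> u)
      = (\<Sum>s\<in>UNIV. stat s * trans_prob s u * (\<integral>L. f (A s *v unit_rep L) \<partial>\<rho> s))"
    if f: "projective f" for f u
    unfolding law[OF f] stationary[OF f] law[OF projective_comp_A[OF f], symmetric]
    by (simp add: mult_ac)
  moreover have "sets (\<rho> s) = sets proj_space" for s by (simp add: \<rho>_def)
  ultimately show ?thesis using prob by (intro that)
qed

text \<open>Stationarity passes from continuous functions to open cones by dominated convergence, and from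
  these to all Borel sets because the open cones are stable under intersection.\<close>

theorem markovian_invariant_measure_exists:
  "\<exists>\<nu>. invariant_measure P M \<nu> \<and> markovian_disintegration P \<nu>"
proof -
  obtain \<rho> :: "'s \<Rightarrow> (real^'d) set measure" where prob: "\<And>s. prob_space (\<rho> s)"
    and sets: "\<And>s. sets (\<rho> s) = sets proj_space"
    and stationary: "\<And>f u. projective f \<Longrightarrow> stat u * (\<integral>L. f (unit_rep L) \<partial>\<rho> u)
      = (\<Sum>s\<in>UNIV. stat s * trans_prob s u * (\<integral>L. f (A s *v unit_rep L) \<partial>\<rho> s))"
    by (rule stationary_laws) (rule that)
  interpret \<rho>: prob_space "\<rho> s" for s by (rule prob)
  have space: "space (\<rho> s) = proj_points" for s
    using sets_eq_imp_space_eq[OF sets] space_proj_space by metis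
  let ?G = "{U. U \<subseteq> proj_points \<and> open {x :: real^'d. x \<noteq> 0 \<and> span {x} \<in> U}}"
  let ?B = "\<lambda>s B. {L \<in> proj_points. (*v) (A s) ` L \<in> B}"
  let ?f = "\<lambda>t B. stat t * measure (\<rho> t) B"
  let ?g = "\<lambda>t B. \<Sum>s\<in>UNIV. stat s * trans_prob s t * measure (\<rho> s) (?B s B)"
  have image_pts: "(*v) (A s) ` L = span {A s *v unit_rep L}" "A s *v unit_rep L \<noteq> 0"
    if L: "L \<in> proj_points" for s L
    using image_span[of "A s" "unit_rep L"] span_unit_rep[OF L] unit_rep_nonzero[OF L] by auto
  have "?f t B = ?g t B" if B: "B \<in> sets proj_space" for t B
  proof (rule countably_additive_eqI[where f = "?f t" and g = "?g t" and G = ?G and \<Omega> = proj_points])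
    show "Int_stable ?G"
      unfolding Int_stable_def
    proof (intro ballI CollectI conjI)
      fix U V assume UV: "U \<in> ?G" "V \<in> ?G"
      then show "U \<inter> V \<subseteq> proj_points" by auto
      have "{x :: real^'d. x \<noteq> 0 \<and> span {x} \<in> U \<inter> V}
          = {x. x \<noteq> 0 \<and> span {x} \<in> U} \<inter> {x. x \<noteq> 0 \<and> span {x} \<in> V}" by auto
      then show "open {x :: real^'d. x \<noteq> 0 \<and> span {x} \<in> U \<inter> V}"
        using UV by (simp only: mem_Collect_eq open_Int)
    qed
    show "?G \<subseteq> Pow proj_points" by auto
    show "B \<in> sigma_sets proj_points ?G" using B by (simp only: sets_proj_space)
    show "(\<lambda>i::nat. ?f t (E i)) sums ?f t (\<Union>i. E i)"
      if "range E \<subseteq> sigma_sets proj_points ?G" "disjoint_family E" for E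
      using that by (intro sums_mult \<rho>.finite_measure_UNION) (simp_all add: sets sets_proj_space)
    show "(\<lambda>i::nat. ?g t (E i)) sums ?g t (\<Union>i. E i)"
      if E: "range E \<subseteq> sigma_sets proj_points ?G" "disjoint_family E" for E
    proof (intro sums_sum sums_mult)
      fix s
      have "(\<lambda>i. measure (\<rho> s) (?B s (E i))) sums measure (\<rho> s) (\<Union>i. ?B s (E i))"
      proof (rule \<rho>.finite_measure_UNION)
        have "E i \<in> sets proj_space" for i using E(1) sets_proj_space by blast
        then show "range (\<lambda>i. ?B s (E i)) \<subseteq> sets (\<rho> s)"
          using image_A_sets by (auto simp: sets)
        show "disjoint_family (\<lambda>i. ?B s (E i))"
          using E(2) by (auto simp: disjoint_family_on_def)
      qed
      moreover have "(\<Union>i. ?B s (E i)) = ?B s (\<Union>i. E i)" by auto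
      ultimately show "(\<lambda>i. measure (\<rho> s) (?B s (E i))) sums measure (\<rho> s) (?B s (\<Union>i. E i))" by simp
    qed
    show "?f t proj_points = ?g t proj_points"
    proof -
      have "(*v) (A s) ` L \<in> proj_points" if "L \<in> proj_points" for s L
        using span_in_proj_points[OF image_pts(2)[OF that, of s]] image_pts(1)[OF that, of s] by simp
      then have "?B s proj_points = proj_points" for s by auto
      then show ?thesis
        using stationary[OF projective_const, of t 1] \<rho>.prob_space by (simp add: space)
    qed
    fix U assume "U \<in> ?G"
    then have U: "U \<subseteq> proj_points" "open {x :: real^'d. x \<noteq> 0 \<and> span {x} \<in> U}" by auto
    have U_sets: "U \<in> sets proj_space"
      using \<open>U \<in> ?G\<close> unfolding sets_proj_space by (rule sigma_sets.Basic)
    obtain f where f: "\<And>n::nat. projective (f n)" and f01: "\<And>n x. 0 \<le> f n x" "\<And>n x. f n x \<le> 1"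
      and lim: "\<And>x :: real^'d. x \<noteq> 0 \<Longrightarrow> (\<lambda>n. f n x) \<longlonglongrightarrow> indicator U (span {x})"
      by (rule projective_indicator_limit[OF U(2)]) (rule that)
    have f_meas: "(\<lambda>L. g (unit_rep L)) \<in> borel_measurable (\<rho> s)" if "projective g" for g s
      using projective_measurable[OF that] by (simp add: measurable_cong_sets[OF sets refl])
    have lim_f: "(\<lambda>n. \<integral>L. f n (unit_rep L) \<partial>\<rho> t) \<longlonglongrightarrow> measure (\<rho> t) U"
    proof -
      have "(\<lambda>n. \<integral>L. f n (unit_rep L) \<partial>\<rho> t) \<longlonglongrightarrow> (\<integral>L. indicator U L \<partial>\<rho> t)"
      proof (rule integral_dominated_convergence[where w = "\<lambda>_. 1"])
        show "AE L in \<rho> t. (\<lambda>n. f n (unit_rep L)) \<longlonglongrightarrow> indicator U L"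
        proof (rule AE_I2)
          fix L assume "L \<in> space (\<rho> t)"
          then have "L \<in> proj_points" by (simp add: space)
          from lim[OF unit_rep_nonzero[OF this]] span_unit_rep[OF this]
          show "(\<lambda>n. f n (unit_rep L)) \<longlonglongrightarrow> indicator U L" by simp
        qed
      qed (use U_sets f_meas[OF f] f01 in \<open>auto simp: sets intro!: borel_measurable_indicator\<close>)
      then show ?thesis using U_sets U(1) by (simp add: sets space Int_absorb2)
    qed
    have lim_g: "(\<lambda>n. \<integral>L. f n (A s *v unit_rep L) \<partial>\<rho> s) \<longlonglongrightarrow> measure (\<rho> s) (?B s U)" for s
    proof -
      have B_sets: "?B s U \<in> sets (\<rho> s)" using image_A_sets[OF U_sets] by (simp add: sets)
      have "(\<lambda>n. \<integral>L. f n (A s *v unit_rep L) \<partial>\<rho> s) \<longlonglongrightarrow> (\<integral>L. indicator (?B s U) L \<partial>\<rho> s)"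
      proof (rule integral_dominated_convergence[where w = "\<lambda>_. 1"])
        show "AE L in \<rho> s. (\<lambda>n. f n (A s *v unit_rep L)) \<longlonglongrightarrow> indicator (?B s U) L"
        proof (rule AE_I2)
          fix L assume "L \<in> space (\<rho> s)"
          then have L: "L \<in> proj_points" by (simp add: space)
          from lim[OF image_pts(2)[OF L, of s]]
          show "(\<lambda>n. f n (A s *v unit_rep L)) \<longlonglongrightarrow> indicator (?B s U) L"
            by (simp only: image_pts(1)[OF L, symmetric]) (simp add: indicator_def L)
        qed
      qed (use B_sets f_meas[OF projective_comp_A[OF f]] f01 in auto)
      then show ?thesis using B_sets by (simp add: space Int_absorb2 Collect_restrict)
    qed
    have "(\<lambda>n. stat t * (\<integral>L. f n (unit_rep L) \<partial>\<rho> t)) \<longlonglongrightarrow> ?f t U"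
      by (intro tendsto_mult tendsto_const lim_f)
    moreover have "(\<lambda>n. stat t * (\<integral>L. f n (unit_rep L) \<partial>\<rho> t)) \<longlonglongrightarrow> ?g t U"
      unfolding stationary[OF f] by (intro tendsto_sum tendsto_mult tendsto_const lim_g)
    ultimately show "?f t U = ?g t U" by (rule LIMSEQ_unique)
  qed
  then show ?thesis by (intro invariant_from_stationary[OF prob sets])
qed

end

section \<open>The theorem\<close>

theorem theorem3p8:
  fixes P :: "(nat \<Rightarrow> 's::finite) measure"
    and M :: "(nat \<Rightarrow> 's) \<Rightarrow> real^'d^'d"
  assumes "markovian_full_shift P"
    and "strongly_irreducible M"
    and "\<forall>\<omega>. invertible (M \<omega>)"
    and "depends_on_first M"
    and "integrable P (\<lambda>\<omega>. log_plus (opnorm (M \<omega>)))"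
  shows
    "(\<forall>X x. X \<longlonglongrightarrow> x \<and> x \<noteq> 0 \<longrightarrow>
        (AE \<omega> in P. (\<lambda>n. (1 / real n) * ln (norm (lrds M n \<omega> *v X n)))
           \<longlonglongrightarrow> lyapunov_exponent P M)) \<and>
     (\<forall>\<nu>. the_invariant_measure P M \<nu> \<longrightarrow>
        lyapunov_exponent P M = (\<integral>(\<omega>, L). ln (norm (M \<omega> *v unit_rep L)) \<partial>\<nu>)) \<and>
     (integrable P (\<lambda>\<omega>. log_plus (opnorm (matrix_inv (M \<omega>)))) \<longrightarrow>
        uniform_limit {x. norm x = 1}
          (\<lambda>n x. (1 / real n) * (\<integral>\<omega>. ln (norm (lrds M n \<omega> *v x)) \<partial>P))
          (\<lambda>x. lyapunov_exponent P M) sequentially)"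
proof -
  interpret markov_cocycle P M
    by unfold_locales (rule assms(1) assms(2) assms(3)[THEN spec] assms(4))+
  have formula: "(\<integral>(\<omega>, L). ln (norm (M \<omega> *v unit_rep L)) \<partial>\<nu>) = \<beta>"
    if inv: "invariant_measure P M \<nu>" and mark: "markovian_disintegration P \<nu>" for \<nu>
  proof -
    obtain \<rho> where \<rho>: "\<forall>s. prob_space (\<rho> s) \<and> sets (\<rho> s) = sets proj_space"
      and dis: "\<forall>E\<in>sets P. \<forall>B\<in>sets proj_space.
        emeasure \<nu> (E \<times> B) = (\<integral>\<^sup>+\<omega>\<in>E. emeasure (\<rho> (\<omega> 0)) B \<partial>P)"
      using mark unfolding markovian_disintegration_def by (elim exE conjE) (rule that)
    interpret markovian_invariant P M \<nu> \<rho>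
    proof (rule markovian_invariant.intro)
      show "markov_cocycle P M" by (rule markov_cocycle_axioms)
      show "markovian_invariant_axioms P M \<nu> \<rho>"
        by (rule markovian_invariant_axioms.intro)
          (use inv \<rho> dis in auto)
    qed
    show ?thesis by (rule furstenberg_formula)
  qed
  show ?thesis
  proof (intro conjI allI impI)
    fix X :: "nat \<Rightarrow> real^'d" and x assume X: "X \<longlonglongrightarrow> x \<and> x \<noteq> 0"
    show "AE \<omega> in P. (\<lambda>n. (1 / real n) * ln (norm (lrds M n \<omega> *v X n))) \<longlonglongrightarrow> lyapunov_exponent P M"
      unfolding lyapunov_eq_\<beta> by (rule AE_growth[OF conjunct1[OF X] conjunct2[OF X]])
  next
    fix \<nu> assume the: "the_invariant_measure P M \<nu>"
    obtain \<nu>' where \<nu>': "invariant_measure P M \<nu>'" "markovian_disintegration P \<nu>'"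
      using markovian_invariant_measure_exists by (elim exE conjE) (rule that)
    have "invariant_measure P M \<nu>" using the by (simp add: the_invariant_measure_def)
    \<comment> \<open>If \<open>\<nu>\<close> is the only invariant measure, it coincides with the Markovian
      one.\<close>
    moreover have "markovian_disintegration P \<nu>"
      using the \<nu>' unfolding the_invariant_measure_def by metis
    ultimately show "lyapunov_exponent P M = (\<integral>(\<omega>, L). ln (norm (M \<omega> *v unit_rep L)) \<partial>\<nu>)"
      by (simp only: formula lyapunov_eq_\<beta>)
  next
    show "uniform_limit {x. norm x = 1}
        (\<lambda>n x. (1 / real n) * (\<integral>\<omega>. ln (norm (lrds M n \<omega> *v x)) \<partial>P))
        (\<lambda>x. lyapunov_exponent P M) sequentially"
      unfolding lyapunov_eq_\<beta> by (rule expectation_uniform_limit)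
  qed
qed

end
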